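(* Let $\Phi\colon\mathbb{R}^n\to\mathbb{R}$ be a convex function. Let $a_1,\dots,a_n,b_1,\dots,b_n>0$, for each $i$ let $U_i\colon\mathbb{R}\to(-\infty,0]$ be given by $U_i(x)=-a_ix$ for $x\ge0$ and $U_i(x)=b_ix$ for $x<0$, and let $U(\mathbf{x})=\sum_{i=1}^nU_i(x_i)$ for $\mathbf{x}=(x_1,\dots,x_n)\in\mathbb{R}^n$. Let $V\colon\mathbb{R}^n\times[0,+\infty)\to\mathbb{R}$ be defined by $$V(\mathbf{x},t)=\sup_{\mathbf{p}\in\mathbb{R}^n}\left\{\sum_{i=1}^nV(x_i,t;p_i,a_i,b_i)-\Phi^*(\mathbf{p})\right\},$$ where $V(x,t;p,a,b)$ is the explicit function given in the context and $\Phi^*$ is the Legendre-Fenchel transform of $\Phi$. Consider the Hamilton-Jacobi PDE $$\frac{\partial V}{\partial t}(\mathbf{x},t)+\frac12\|\nabla_{\mathbf{x}}V(\mathbf{x},t)\|^2+U(\mathbf{x})=0\ \ (\mathbf{x}\in\mathbb{R}^n,\ t\in(0,+\infty)),\qquad V(\mathbf{x},0)=\Phi(\mathbf{x})\ \ (\mathbf{x}\in\mathbb{R}^n).\tag{HJ}$$ Then: (a) The function $V$ is a continuously differentiable solution to (HJ). (b) Furthermore, assume there are constants $C\ge0$, $\delta\ge0$ such that $|\Phi(\mathbf{x})-\Phi(\mathbf{y})|\le C\|\mathbf{x}-\mathbf{y}\|(1+\|\mathbf{x}\|^\delta+\|\mathbf{y}\|^\delta)$ for all $\mathbf{x},\mathbf{y}\in\mathbb{R}^n$.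 Then $V$ is the unique viscosity solution to (HJ) in the set $$\mathcal{G}=\{W\in C(\mathbb{R}^n\times[0,+\infty))\colon\|W\|_R<\infty\ \forall R>0;\ \exists\boldsymbol\alpha\in\mathbb{R}^n\text{ s.t. }\forall T>0\ \exists C_T\in\mathbb{R}\text{ s.t. }W(\mathbf{x},t)-\langle\boldsymbol\alpha,\mathbf{x}\rangle\ge C_T\ \forall\mathbf{x}\in\mathbb{R}^n,\forall t\in[0,T]\},$$ where $\|W\|_R=\sup\{|W(\mathbf{x},t)|+\|\mathbf{q}\|\colon(\mathbf{x},t)\in B_R(\mathbb{R}^n)\times[0,R],\ \mathbf{q}\in D_{\mathbf{x}}^-W(\mathbf{x},t)\}$.
   Context: Explicit function. For $a,b>0$, $x,p\in\mathbb{R}$, $t\ge0$, define $V(x,t;p,a,b)$ as follows. If $p\ge0$, then $V(x,t;p,a,b)=f_i(x,t;p,a,b)$ whenever $(x,t,p)\in\Omega_i$, $i=1,\dots,5$, where (the regions depend on $a,b$, are subsets of $\mathbb{R}\times[0,+\infty)\times[0,+\infty)$, and partition it) $\Omega_1=\{x\ge pt+\frac a2t^2\}$; $\Omega_2=\{x<0,\ t<\frac pb\}\cup\{x<-\frac b2(t-\frac pb)^2,\ t\ge\frac pb\}$; $\Omega_3=\{0\le x<pt+\frac a2t^2,\ t<\frac pb\}\cup\{\frac a2(t-\frac pb)^2\le x<pt+\frac a2t^2,\ t\ge\frac pb\}$; $\Omega_4=\{0\le x<\frac a2(t-\frac pb)^2,\ t\ge\frac pb\}$; $\Omega_5=\{-\frac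 b2(t-\frac pb)^2\le x<0,\ t\ge\frac pb\}$; and $f_1=-\frac{a^2}{6}t^3-\frac a2pt^2+atx-\frac12p^2t+px$; $f_2=-\frac{b^2}{6}t^3+\frac b2pt^2-\frac12p^2t+px-btx$; $f_3=\frac{a+b}{3(a+2b)^2}\left((bt-p)^3+((bt-p)^2+2x(a+2b))^{3/2}\right)-\frac{b}{a+2b}(bt-p)x-\frac{b^2}{6}t^3+\frac b2pt^2-\frac12p^2t$; $f_4=\frac{a^2}{3}\left(\frac{2x}{a}\right)^{3/2}-\frac{p^3}{6b}$; $f_5=\frac{b^2}{3}\left(\frac{-2x}{b}\right)^{3/2}-\frac{p^3}{6b}$. If $p<0$, then $V(x,t;p,a,b)=V(-x,t;-p,b,a)$ (the right-hand side being given by the case $-p>0$ with $a$ and $b$ exchanged). Other notation. $\Phi^*(\mathbf{p})=\sup_{\mathbf{x}}\{\langle\mathbf{p},\mathbf{x}\rangle-\Phi(\mathbf{x})\}\in\mathbb{R}\cup\{+\infty\}$. $\|\cdot\|$ and $\langle\cdot,\cdot\rangle$ are the Euclidean norm and inner product. $B_R(\mathbb{R}^n)$ is the closed ball with center $\mathbf{0}$ and radius $R$. $D_{\mathbf{x}}^-W(\mathbf{x},t)$ is the (Fréchet/viscosity) subdifferential of $\mathbf{y}\mapsto W(\mathbf{y},t)$ at $\mathbf{y}=\mathbf{x}$. A "continuously differentiable solution" is a function continuous on $\mathbb{R}^n\times[0,+\infty)$, continuously differentiable on $\mathbb{R}^n\times(0,+\infty)$, satisfying the PDE pointwise there and the initial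 condition at $t=0$. "Viscosity solution" has the standard (Crandall-Lions) meaning, together with the initial condition. *)

theory Defs
  imports "HOL-Analysis.Analysis"
begin

subsection \<open>The explicit one-dimensional function\<close>

definition region1 :: "real \<Rightarrow> real \<Rightarrow> (real \<times> real \<times> real) set" where
  "region1 a b = {(x, t, p). 0 \<le> t \<and> 0 \<le> p \<and> x \<ge> p * t + a / 2 * t\<^sup>2}"

definition region2 :: "real \<Rightarrow> real \<Rightarrow> (real \<times> real \<times> real) set" where
  "region2 a b =
     {(x, t, p). 0 \<le> t \<and> 0 \<le> p \<and> x < 0 \<and> t < p / b} \<union>
     {(x, t, p). 0 \<le> t \<and> 0 \<le> p \<and> x < - (b / 2) * (t - p / b)\<^sup>2 \<and> t \<ge> p / b}"

definition region3 :: "real \<Rightarrow> real \<Rightarrow> (real \<times> real \<times> real) set" where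
  "region3 a b =
     {(x, t, p). 0 \<le> t \<and> 0 \<le> p \<and> 0 \<le> x \<and> x < p * t + a / 2 * t\<^sup>2 \<and> t < p / b} \<union>
     {(x, t, p). 0 \<le> t \<and> 0 \<le> p \<and> a / 2 * (t - p / b)\<^sup>2 \<le> x \<and> x < p * t + a / 2 * t\<^sup>2 \<and> t \<ge> p / b}"

definition region4 :: "real \<Rightarrow> real \<Rightarrow> (real \<times> real \<times> real) set" where
  "region4 a b =
     {(x, t, p). 0 \<le> t \<and> 0 \<le> p \<and> 0 \<le> x \<and> x < a / 2 * (t - p / b)\<^sup>2 \<and> t \<ge> p / b}"

definition region5 :: "real \<Rightarrow> real \<Rightarrow> (real \<times> real \<times> real) set" where
  "region5 a b =
     {(x, t, p). 0 \<le> t \<and> 0 \<le> p \<and> - (b / 2) * (t - p / b)\<^sup>2 \<le> x \<and> x < 0 \<and> t \<ge> p / b}"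

definition piece1 :: "real \<Rightarrow> real \<Rightarrow> real \<Rightarrow> real \<Rightarrow> real \<Rightarrow> real" where
  "piece1 x t p a b =
     - (a\<^sup>2 / 6) * t ^ 3 - a / 2 * p * t\<^sup>2 + a * t * x - 1 / 2 * p\<^sup>2 * t + p * x"

definition piece2 :: "real \<Rightarrow> real \<Rightarrow> real \<Rightarrow> real \<Rightarrow> real \<Rightarrow> real" where
  "piece2 x t p a b =
     - (b\<^sup>2 / 6) * t ^ 3 + b / 2 * p * t\<^sup>2 - 1 / 2 * p\<^sup>2 * t + p * x - b * t * x"

definition piece3 :: "real \<Rightarrow> real \<Rightarrow> real \<Rightarrow> real \<Rightarrow> real \<Rightarrow> real" where
  "piece3 x t p a b =
     (a + b) / (3 * (a + 2 * b)\<^sup>2)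
       * ((b * t - p) ^ 3 + ((b * t - p)\<^sup>2 + 2 * x * (a + 2 * b)) powr (3 / 2))
     - b / (a + 2 * b) * (b * t - p) * x
     - b\<^sup>2 / 6 * t ^ 3 + b / 2 * p * t\<^sup>2 - 1 / 2 * p\<^sup>2 * t"

definition piece4 :: "real \<Rightarrow> real \<Rightarrow> real \<Rightarrow> real \<Rightarrow> real \<Rightarrow> real" where
  "piece4 x t p a b = a\<^sup>2 / 3 * (2 * x / a) powr (3 / 2) - p ^ 3 / (6 * b)"

definition piece5 :: "real \<Rightarrow> real \<Rightarrow> real \<Rightarrow> real \<Rightarrow> real \<Rightarrow> real" where
  "piece5 x t p a b = b\<^sup>2 / 3 * (- 2 * x / b) powr (3 / 2) - p ^ 3 / (6 * b)"

text \<open>The final value 0 is never used for \<open>t \<ge> 0\<close> and \<open>p \<ge> 0\<close>; see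
  \<open>regions_cover\<close> and \<open>regions_disjoint\<close> below.\<close>

definition V1_nonneg :: "real \<Rightarrow> real \<Rightarrow> real \<Rightarrow> real \<Rightarrow> real \<Rightarrow> real" where
  "V1_nonneg x t p a b =
     (if (x, t, p) \<in> region1 a b then piece1 x t p a b
      else if (x, t, p) \<in> region2 a b then piece2 x t p a b
      else if (x, t, p) \<in> region3 a b then piece3 x t p a b
      else if (x, t, p) \<in> region4 a b then piece4 x t p a b
      else if (x, t, p) \<in> region5 a b then piece5 x t p a b
      else 0)"

definition V1 :: "real \<Rightarrow> real \<Rightarrow> real \<Rightarrow> real \<Rightarrow> real \<Rightarrow> real" where
  "V1 x t p a b = (if p \<ge> 0 then V1_nonneg x t p a b else V1_nonneg (- x) t (- p) b a)"

lemma regions_cover: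
  assumes "0 \<le> t" "0 \<le> p"
  shows "(x, t, p) \<in>
    region1 a b \<union> region2 a b \<union> region3 a b \<union> region4 a b \<union> region5 a b"
  using assms
  unfolding region1_def region2_def region3_def region4_def region5_def
  by auto

lemma regions_disjoint:
  assumes "0 < a" "0 < b"
  shows
    "region1 a b \<inter> region2 a b = {}" "region1 a b \<inter> region3 a b = {}"
    "region1 a b \<inter> region4 a b = {}" "region1 a b \<inter> region5 a b = {}"
    "region2 a b \<inter> region3 a b = {}" "region2 a b \<inter> region4 a b = {}"
    "region2 a b \<inter> region5 a b = {}" "region3 a b \<inter> region4 a b = {}"
    "region3 a b \<inter> region5 a b = {}" "region4 a b \<inter> region5 a b = {}"
proof -
  have *: "a / 2 * (t - p / b)\<^sup>2 \<le> p * t + a / 2 * t\<^sup>2"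
    if "0 \<le> t" "0 \<le> p" "p / b \<le> t" for t p :: real
  proof -
    have "0 \<le> p / b" using that assms by simp
    hence "(t - p / b)\<^sup>2 \<le> t\<^sup>2" using that by (intro power_mono) auto
    hence "a / 2 * (t - p / b)\<^sup>2 \<le> a / 2 * t\<^sup>2" using assms by (intro mult_left_mono) auto
    moreover have "0 \<le> p * t" using that by simp
    ultimately show ?thesis by linarith
  qed
  have r1: "0 \<le> x \<and> p * t + a / 2 * t\<^sup>2 \<le> x" if "(x, t, p) \<in> region1 a b" for x t p
  proof -
    have "0 \<le> p * t + a / 2 * t\<^sup>2" "p * t + a / 2 * t\<^sup>2 \<le> x"
      using that assms by (auto simp: region1_def)
    thus ?thesis by linarith
  qed
  have r2: "x < 0 \<and> (t < p / b \<or> x < - (b / 2) * (t - p / b)\<^sup>2)"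
    if "(x, t, p) \<in> region2 a b" for x t p
  proof -
    have "0 \<le> b / 2 * (t - p / b)\<^sup>2" using assms by simp
    moreover have "x < 0 \<and> t < p / b \<or> x < - (b / 2 * (t - p / b)\<^sup>2)"
      using that by (auto simp: region2_def)
    ultimately show ?thesis by auto
  qed
  have r3: "0 \<le> x \<and> x < p * t + a / 2 * t\<^sup>2 \<and> (t < p / b \<or> a / 2 * (t - p / b)\<^sup>2 \<le> x)"
    if "(x, t, p) \<in> region3 a b" for x t p
  proof -
    have "0 \<le> a / 2 * (t - p / b)\<^sup>2" using assms by simp
    thus ?thesis using that by (auto simp: region3_def)
  qed
  have r4: "0 \<le> x \<and> x < p * t + a / 2 * t\<^sup>2 \<and> p / b \<le> t \<and> x < a / 2 * (t - p / b)\<^sup>2"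
    if "(x, t, p) \<in> region4 a b" for x t p
    using that *[of t p] by (auto simp: region4_def)
  have r5: "x < 0 \<and> p / b \<le> t \<and> - (b / 2) * (t - p / b)\<^sup>2 \<le> x"
    if "(x, t, p) \<in> region5 a b" for x t p
    using that by (auto simp: region5_def)
  have disj: "A \<inter> B = {}" if "\<And>x t p. (x, t, p) \<in> A \<Longrightarrow> (x, t, p) \<in> B \<Longrightarrow> False"
    for A B :: "(real \<times> real \<times> real) set"
    using that by auto
  show "region1 a b \<inter> region2 a b = {}" "region1 a b \<inter> region3 a b = {}"
    "region1 a b \<inter> region4 a b = {}" "region1 a b \<inter> region5 a b = {}"
    "region2 a b \<inter> region3 a b = {}" "region2 a b \<inter> region4 a b = {}"
    "region2 a b \<inter> region5 a b = {}" "region3 a b \<inter> region4 a b = {}"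
    "region3 a b \<inter> region5 a b = {}" "region4 a b \<inter> region5 a b = {}"
    by (rule disj, (drule r1 r2 r3 r4 r5)+, linarith)+
qed


subsection \<open>The value function\<close>

definition fenchel_conj :: "('a::real_inner \<Rightarrow> real) \<Rightarrow> 'a \<Rightarrow> ereal" where
  "fenchel_conj \<Phi> p = (SUP x. ereal (p \<bullet> x - \<Phi> x))"

definition potential1 :: "real \<Rightarrow> real \<Rightarrow> real \<Rightarrow> real" where
  "potential1 a b x = (if x \<ge> 0 then - a * x else b * x)"

definition potential :: "real ^ 'n \<Rightarrow> real ^ 'n \<Rightarrow> real ^ 'n \<Rightarrow> real" where
  "potential a b x = (\<Sum>i\<in>UNIV. potential1 (a $ i) (b $ i) (x $ i))"

text \<open>Functions on $\mathbf{R}^n \times [0, +\infty)$ are functions on \<open>real ^ 'n \<times> real\<close>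
  whose values at negative times are irrelevant.\<close>

definition value_ereal ::
  "(real ^ 'n \<Rightarrow> real) \<Rightarrow> real ^ 'n \<Rightarrow> real ^ 'n \<Rightarrow> (real ^ 'n) \<times> real \<Rightarrow> ereal" where
  "value_ereal \<Phi> a b = (\<lambda>(x, t).
     SUP p. ereal (\<Sum>i\<in>UNIV. V1 (x $ i) t (p $ i) (a $ i) (b $ i)) - fenchel_conj \<Phi> p)"

definition value_fun ::
  "(real ^ 'n \<Rightarrow> real) \<Rightarrow> real ^ 'n \<Rightarrow> real ^ 'n \<Rightarrow> (real ^ 'n) \<times> real \<Rightarrow> real" where
  "value_fun \<Phi> a b z = real_of_ereal (value_ereal \<Phi> a b z)"


subsection \<open>Classical and viscosity solutions of the Hamilton-Jacobi equation\<close>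

definition C1_on :: "'a::real_inner set \<Rightarrow> ('a \<Rightarrow> real) \<Rightarrow> ('a \<Rightarrow> 'a) \<Rightarrow> bool" where
  "C1_on S f g \<longleftrightarrow> (\<forall>z\<in>S. GDERIV f z :> g z) \<and> continuous_on S g"

text \<open>The gradient of a function of \<open>(x, t)\<close> is the pair of its spatial gradient (\<open>fst\<close>) and its
  time derivative (\<open>snd\<close>).\<close>

definition classical_solution ::
  "('a::real_inner \<Rightarrow> real) \<Rightarrow> ('a \<Rightarrow> real) \<Rightarrow> ('a \<times> real \<Rightarrow> real) \<Rightarrow> bool" where
  "classical_solution U \<Phi> W \<longleftrightarrow>
     continuous_on (UNIV \<times> {0..}) W \<and>
     (\<exists>DW. C1_on (UNIV \<times> {0<..}) W DW \<and>
        (\<forall>x. \<forall>t>0. snd (DW (x, t)) + 1 / 2 * (norm (fst (DW (x, t))))\<^sup>2 + U x = 0)) \<and>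
     (\<forall>x. W (x, 0) = \<Phi> x)"

definition viscosity_subsolution ::
  "('a::real_inner \<Rightarrow> real) \<Rightarrow> ('a \<times> real \<Rightarrow> real) \<Rightarrow> bool" where
  "viscosity_subsolution U W \<longleftrightarrow>
     (\<forall>\<phi> D\<phi>. C1_on (UNIV \<times> {0<..}) \<phi> D\<phi> \<longrightarrow>
        (\<forall>x. \<forall>t>0. (\<forall>\<^sub>F z in nhds (x, t). W z - \<phi> z \<le> W (x, t) - \<phi> (x, t)) \<longrightarrow>
           snd (D\<phi> (x, t)) + 1 / 2 * (norm (fst (D\<phi> (x, t))))\<^sup>2 + U x \<le> 0))"

definition viscosity_supersolution ::
  "('a::real_inner \<Rightarrow> real) \<Rightarrow> ('a \<times> real \<Rightarrow> real) \<Rightarrow> bool" where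
  "viscosity_supersolution U W \<longleftrightarrow>
     (\<forall>\<phi> D\<phi>. C1_on (UNIV \<times> {0<..}) \<phi> D\<phi> \<longrightarrow>
        (\<forall>x. \<forall>t>0. (\<forall>\<^sub>F z in nhds (x, t). W z - \<phi> z \<ge> W (x, t) - \<phi> (x, t)) \<longrightarrow>
           snd (D\<phi> (x, t)) + 1 / 2 * (norm (fst (D\<phi> (x, t))))\<^sup>2 + U x \<ge> 0))"

definition viscosity_solution ::
  "('a::real_inner \<Rightarrow> real) \<Rightarrow> ('a \<Rightarrow> real) \<Rightarrow> ('a \<times> real \<Rightarrow> real) \<Rightarrow> bool" where
  "viscosity_solution U \<Phi> W \<longleftrightarrow>
     continuous_on (UNIV \<times> {0..}) W \<and>
     viscosity_subsolution U W \<and> viscosity_supersolution U W \<and>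
     (\<forall>x. W (x, 0) = \<Phi> x)"


subsection \<open>The uniqueness class\<close>

definition frechet_subdifferential :: "('a::real_inner \<Rightarrow> real) \<Rightarrow> 'a \<Rightarrow> 'a set" where
  "frechet_subdifferential f x =
     {q. Liminf (at x) (\<lambda>y. ereal ((f y - f x - q \<bullet> (y - x)) / norm (y - x))) \<ge> 0}"

definition local_norm :: "real \<Rightarrow> ('a::real_inner \<times> real \<Rightarrow> real) \<Rightarrow> ereal" where
  "local_norm R W =
     Sup {ereal (\<bar>W (x, t)\<bar> + norm q) | x t q.
            x \<in> cball 0 R \<and> t \<in> {0..R} \<and> q \<in> frechet_subdifferential (\<lambda>y. W (y, t)) x}"

definition uniqueness_class :: "('a::real_inner \<times> real \<Rightarrow> real) set" where
  "uniqueness_class =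
     {W. continuous_on (UNIV \<times> {0..}) W \<and>
         (\<forall>R>0. local_norm R W < \<infinity>) \<and>
         (\<exists>\<alpha>. \<forall>T>0. \<exists>C. \<forall>x. \<forall>t\<in>{0..T}. W (x, t) - \<alpha> \<bullet> x \<ge> C)}"

text \<open>The growth condition uses the convention $0^0 = 1$, whereas \<open>0 powr 0 = 0\<close>.\<close>

definition rpow :: "real \<Rightarrow> real \<Rightarrow> real" where
  "rpow r \<delta> = (if \<delta> = 0 then 1 else r powr \<delta>)"

definition growth_condition :: "('a::real_inner \<Rightarrow> real) \<Rightarrow> real \<Rightarrow> real \<Rightarrow> bool" where
  "growth_condition \<Phi> C \<delta> \<longleftrightarrow>
     (\<forall>x y. \<bar>\<Phi> x - \<Phi> y\<bar> \<le> C * norm (x - y) * (1 + rpow (norm x) \<delta> + rpow (norm y) \<delta>))"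

end

theory Submission
  imports Defs
begin

text \<open>
  The problem is separable when the initial value is linear, and the explicit function \<open>V1\<close> is the
  value in one coordinate. It is of class $C^1$ in \<open>(x, t, p)\<close> jointly, and its \<open>p\<close>-derivative, the
  starting point of the optimal trajectory, is strictly decreasing in \<open>p\<close>. Hence the supremum over
  \<open>p\<close> is attained at a unique point, which depends continuously on \<open>(x, t)\<close>, and Danskin's argument
  shows that the supremum is of class $C^1$ with the gradient of the maximizing linear problem, so that
  it inherits the equation.

  For uniqueness let \<open>W\<close> be a viscosity solution. The velocity of each linear problem is bounded for
  bounded times, so \<open>W\<close>, being bounded below by an affine function, dominates the linear problem by
  comparison with a quadratic barrier; taking the supremum, \<open>W\<close> dominates the value function \<open>V\<close>.
  Conversely, \<open>V\<close> is bounded below by an affine function and \<open>V(0, t) \<le> \<Phi>(0)\<close>, which gives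
  \<open>\<langle>\<nabla>V, x\<rangle> \<ge> - C (1 + |x|\<^sup>2)\<close>: backward characteristics cannot escape to infinity. Therefore a high
  power of \<open>(1 + |x|\<^sup>2) exp (2 C t)\<close> is a barrier that confines the comparison \<open>W \<le> V\<close> to a compact
  set, whatever the growth of \<open>W\<close> at infinity.
\<close>

section \<open>Gluing on closed regions\<close>

text \<open>Behind \<open>V1\<close> is the minimization of p x(0) plus the integral of x'^2/2 -
  U(x) over motions ending at x at time t. Optimal motions have initial velocity p, acceleration a
  right of zero and -b left of it, and may rest at zero. For p >= 0 they stay on one side in regions
  1 and 2 and rest at zero in regions 4 and 5. No motion is constructed below; end velocity and
  starting point are read off as the derivatives \<open>vx\<close> and \<open>vp\<close>.

  Obstacle to smoothness: five formulas meet, and the derivative is wanted up to t = 0 and across p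
  = 0. The half-open regions are enlarged to closed ones, since a function with the same
  differential within each of finitely many closed sets has it within their union; only agreement on
  overlaps remains to be checked.

  Obstacle to uniqueness: the Hamiltonian is quadratic in the gradient. When a barrier is added to a
  solution, its squared gradient has the favourable sign, so the upper barrier may be large. When it
  is subtracted the sign is unfavourable, so the lower barrier must be small and the velocities
  bounded. This is why linear problems, and not \<open>value_fun\<close>, are compared with
  \<open>W\<close> from below.\<close>

definition cl1 :: "real \<Rightarrow> real \<Rightarrow> (real \<times> real \<times> real) set" where
  "cl1 a b = {(x, t, p). 0 \<le> t \<and> 0 \<le> p \<and> p * t + a / 2 * t\<^sup>2 \<le> x}"

definition cl2 :: "real \<Rightarrow> real \<Rightarrow> (real \<times> real \<times> real) set" where
  "cl2 a b = {(x, t, p). 0 \<le> t \<and> 0 \<le> p \<and> x \<le> 0 \<and> (b * t \<le> p \<or> 2 * b * x \<le> - (b * t - p)\<^sup>2)}"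

definition cl3 :: "real \<Rightarrow> real \<Rightarrow> (real \<times> real \<times> real) set" where
  "cl3 a b = {(x, t, p). 0 \<le> t \<and> 0 \<le> p \<and> 0 \<le> x \<and> x \<le> p * t + a / 2 * t\<^sup>2 \<and>
     (b * t \<le> p \<or> a * (b * t - p)\<^sup>2 \<le> 2 * b\<^sup>2 * x)}"

definition cl4 :: "real \<Rightarrow> real \<Rightarrow> (real \<times> real \<times> real) set" where
  "cl4 a b = {(x, t, p). 0 \<le> t \<and> 0 \<le> p \<and> 0 \<le> x \<and> p \<le> b * t \<and> 2 * b\<^sup>2 * x \<le> a * (b * t - p)\<^sup>2}"

definition cl5 :: "real \<Rightarrow> real \<Rightarrow> (real \<times> real \<times> real) set" where
  "cl5 a b = {(x, t, p). 0 \<le> t \<and> 0 \<le> p \<and> x \<le> 0 \<and> p \<le> b * t \<and> - (b * t - p)\<^sup>2 \<le> 2 * b * x}"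

text \<open>The order of the tests matters only on overlaps, where \<open>glue_eq\<close> removes
  it; the last branch serves \<open>cl5\<close>. The pieces are parameters because value, velocity
  and starting point are all glued in this way.\<close>

definition glue :: "real \<Rightarrow> real \<Rightarrow> (real \<times> real \<times> real \<Rightarrow> real) \<Rightarrow> (real \<times> real \<times> real \<Rightarrow> real)
  \<Rightarrow> (real \<times> real \<times> real \<Rightarrow> real) \<Rightarrow> (real \<times> real \<times> real \<Rightarrow> real) \<Rightarrow> (real \<times> real \<times> real \<Rightarrow> real)
  \<Rightarrow> real \<times> real \<times> real \<Rightarrow> real" where
  "glue a b f1 f2 f3 f4 f5 z =
     (if z \<in> cl1 a b then f1 z else if z \<in> cl2 a b then f2 z else if z \<in> cl3 a b then f3 z
      else if z \<in> cl4 a b then f4 z else f5 z)"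

lemma cl_cover:
  assumes "0 \<le> t" "0 \<le> p"
  shows "(x, t, p) \<in> cl1 a b \<union> cl2 a b \<union> cl3 a b \<union> cl4 a b \<union> cl5 a b"
  using assms by (auto simp: cl1_def cl2_def cl3_def cl4_def cl5_def)

lemma closed_cl:
  "closed (cl1 a b)" "closed (cl2 a b)" "closed (cl3 a b)" "closed (cl4 a b)" "closed (cl5 a b)"
  unfolding cl1_def cl2_def cl3_def cl4_def cl5_def case_prod_beta
  by (intro closed_Collect_conj closed_Collect_disj closed_Collect_le continuous_intros)+

text \<open>With the denominators cleared, \<open>p / b \<le> t\<close> reads
  \<open>p \<le> b * t\<close>, and two opposite non-strict inequalities leave an equation on each
  overlap: an interface surface, or a lower-dimensional corner.\<close>

lemma cl_inter:
  assumes "0 < a" "0 < b"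
  shows "(x, t, p) \<in> cl1 a b \<Longrightarrow> (x, t, p) \<in> cl2 a b \<Longrightarrow> x = 0 \<and> t = 0"
    and "(x, t, p) \<in> cl1 a b \<Longrightarrow> (x, t, p) \<in> cl3 a b \<Longrightarrow> x = p * t + a / 2 * t\<^sup>2"
    and "(x, t, p) \<in> cl1 a b \<Longrightarrow> (x, t, p) \<in> cl4 a b \<Longrightarrow> p = 0 \<and> x = a / 2 * t\<^sup>2"
    and "(x, t, p) \<in> cl1 a b \<Longrightarrow> (x, t, p) \<in> cl5 a b \<Longrightarrow> x = 0 \<and> t = 0 \<and> p = 0"
    and "(x, t, p) \<in> cl2 a b \<Longrightarrow> (x, t, p) \<in> cl3 a b \<Longrightarrow> x = 0 \<and> b * t \<le> p"
    and "(x, t, p) \<in> cl2 a b \<Longrightarrow> (x, t, p) \<in> cl4 a b \<Longrightarrow> x = 0 \<and> p = b * t"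
    and "(x, t, p) \<in> cl2 a b \<Longrightarrow> (x, t, p) \<in> cl5 a b \<Longrightarrow> p \<le> b * t \<and> x = - (b * t - p)\<^sup>2 / (2 * b)"
    and "(x, t, p) \<in> cl3 a b \<Longrightarrow> (x, t, p) \<in> cl4 a b \<Longrightarrow> p \<le> b * t \<and> x = a * (b * t - p)\<^sup>2 / (2 * b\<^sup>2)"
    and "(x, t, p) \<in> cl3 a b \<Longrightarrow> (x, t, p) \<in> cl5 a b \<Longrightarrow> x = 0 \<and> p = b * t"
    and "(x, t, p) \<in> cl4 a b \<Longrightarrow> (x, t, p) \<in> cl5 a b \<Longrightarrow> x = 0"
proof -
  have pos: "0 \<le> p * t" "0 \<le> a / 2 * t\<^sup>2" if "0 \<le> t" "0 \<le> p" using that assms by auto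
  show c12: "x = 0 \<and> t = 0" if "(x, t, p) \<in> cl1 a b" "(x, t, p) \<in> cl2 a b"
  proof -
    have "0 \<le> t" "0 \<le> p" "p * t + a / 2 * t\<^sup>2 \<le> x" "x \<le> 0" using that by (auto simp: cl1_def cl2_def)
    hence "x = 0" "a / 2 * t\<^sup>2 = 0" using pos by linarith+
    thus ?thesis using assms by auto
  qed
  show "x = p * t + a / 2 * t\<^sup>2" if "(x, t, p) \<in> cl1 a b" "(x, t, p) \<in> cl3 a b"
    using that by (auto simp: cl1_def cl3_def)
  show c14: "p = 0 \<and> x = a / 2 * t\<^sup>2" if "(x, t, p) \<in> cl1 a b" "(x, t, p) \<in> cl4 a b"
  proof -
    have h: "0 \<le> t" "0 \<le> p" "p \<le> b * t" "p * t + a / 2 * t\<^sup>2 \<le> x" "2 * b\<^sup>2 * x \<le> a * (b * t - p)\<^sup>2"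
      using that by (auto simp: cl1_def cl4_def)
    have "2 * b\<^sup>2 * (p * t + a / 2 * t\<^sup>2) \<le> 2 * b\<^sup>2 * x" using h assms by (intro mult_left_mono) auto
    hence e: "2 * b\<^sup>2 * (p * t) + a * (b * t)\<^sup>2 \<le> a * (b * t - p)\<^sup>2" using h(5)
      by (simp add: algebra_simps power2_eq_square)
    have "2 * b\<^sup>2 * (p * t) \<ge> 0" using h by simp
    hence "a * (b * t)\<^sup>2 \<le> a * (b * t - p)\<^sup>2" using e by linarith
    hence "(b * t)\<^sup>2 \<le> (b * t - p)\<^sup>2" using assms by simp
    hence "b * t \<le> b * t - p" using h power2_le_imp_le[of "b*t" "b * t - p"] by linarith
    hence p0: "p = 0" using h by linarith
    hence "2 * b\<^sup>2 * x \<le> 2 * b\<^sup>2 * (a / 2 * t\<^sup>2)" using h by (simp add: power_mult_distrib mult_ac)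
    hence "x \<le> a / 2 * t\<^sup>2" using assms by simp
    thus ?thesis using h p0 by auto
  qed
  show "x = 0 \<and> t = 0 \<and> p = 0" if "(x, t, p) \<in> cl1 a b" "(x, t, p) \<in> cl5 a b"
  proof -
    have "0 \<le> t" "0 \<le> p" "p * t + a / 2 * t\<^sup>2 \<le> x" "x \<le> 0" using that by (auto simp: cl1_def cl5_def)
    hence "x = 0" "a / 2 * t\<^sup>2 = 0" using pos by linarith+
    thus ?thesis using assms that by (auto simp: cl5_def)
  qed
  show "x = 0 \<and> b * t \<le> p" if "(x, t, p) \<in> cl2 a b" "(x, t, p) \<in> cl3 a b"
    using that by (auto simp: cl2_def cl3_def)
  show "x = 0 \<and> p = b * t" if "(x, t, p) \<in> cl2 a b" "(x, t, p) \<in> cl4 a b"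
  proof -
    have h: "x = 0" "p \<le> b * t" "b * t \<le> p \<or> 2 * b * x \<le> - (b * t - p)\<^sup>2"
      using that by (auto simp: cl2_def cl4_def)
    thus ?thesis by auto
  qed
  show "p \<le> b * t \<and> x = - (b * t - p)\<^sup>2 / (2 * b)" if "(x, t, p) \<in> cl2 a b" "(x, t, p) \<in> cl5 a b"
  proof -
    have h: "p \<le> b * t" "x \<le> 0" "- (b * t - p)\<^sup>2 \<le> 2 * b * x" "b * t \<le> p \<or> 2 * b * x \<le> - (b * t - p)\<^sup>2"
      using that by (auto simp: cl2_def cl5_def)
    have "2 * b * x \<le> 0" using h assms by (simp add: mult_nonneg_nonpos)
    hence "2 * b * x = - (b * t - p)\<^sup>2" using h by (cases "b * t = p") auto
    thus ?thesis using h assms by (auto simp: field_simps)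
  qed
  show c34: "p \<le> b * t \<and> x = a * (b * t - p)\<^sup>2 / (2 * b\<^sup>2)" if "(x, t, p) \<in> cl3 a b" "(x, t, p) \<in> cl4 a b"
  proof -
    have h: "p \<le> b * t" "x \<ge> 0" "2 * b\<^sup>2 * x \<le> a * (b * t - p)\<^sup>2" "b * t \<le> p \<or> a * (b * t - p)\<^sup>2 \<le> 2 * b\<^sup>2 * x"
      using that by (auto simp: cl3_def cl4_def)
    have "2 * b\<^sup>2 * x \<ge> 0" using h assms by simp
    hence "2 * b\<^sup>2 * x = a * (b * t - p)\<^sup>2"
    proof (cases "b * t \<le> p")
      case True
      hence e: "b * t = p" using h by simp
      thus ?thesis using h(2,3) assms by (auto simp: mult_le_0_iff)
    qed (use h in auto)
    thus ?thesis using h assms by (auto simp: field_simps)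
  qed
  show "x = 0 \<and> p = b * t" if "(x, t, p) \<in> cl3 a b" "(x, t, p) \<in> cl5 a b"
  proof -
    have h: "x = 0" "p \<le> b * t" "b * t \<le> p \<or> a * (b * t - p)\<^sup>2 \<le> 0" using that by (auto simp: cl3_def cl5_def)
    moreover have "a * (b * t - p)\<^sup>2 \<le> 0 \<Longrightarrow> b * t = p" using assms by (simp add: mult_le_0_iff)
    ultimately show ?thesis by auto
  qed
  show "x = 0" if "(x, t, p) \<in> cl4 a b" "(x, t, p) \<in> cl5 a b"
    using that by (auto simp: cl4_def cl5_def)
qed

text \<open>Six interface identities suffice: the overlaps 14, 15, 24 and 35 lie where several
  interfaces meet, and there equality is obtained by passing through further pieces.\<close>

lemma glue_eq:
  assumes ab: "0 < a" "0 < b"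
    and e12: "\<And>p. 0 \<le> p \<Longrightarrow> f1 (0, 0, p) = f2 (0, 0, p)"
    and e13: "\<And>t p. 0 \<le> t \<Longrightarrow> 0 \<le> p \<Longrightarrow>
      f1 (p * t + a / 2 * t\<^sup>2, t, p) = f3 (p * t + a / 2 * t\<^sup>2, t, p)"
    and e23: "\<And>t p. 0 \<le> t \<Longrightarrow> 0 \<le> p \<Longrightarrow> b * t \<le> p \<Longrightarrow> f2 (0, t, p) = f3 (0, t, p)"
    and e25: "\<And>t p. 0 \<le> t \<Longrightarrow> 0 \<le> p \<Longrightarrow> p \<le> b * t \<Longrightarrow>
      f2 (- (b * t - p)\<^sup>2 / (2 * b), t, p) = f5 (- (b * t - p)\<^sup>2 / (2 * b), t, p)"
    and e34: "\<And>t p. 0 \<le> t \<Longrightarrow> 0 \<le> p \<Longrightarrow> p \<le> b * t \<Longrightarrow>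
      f3 (a * (b * t - p)\<^sup>2 / (2 * b\<^sup>2), t, p) = f4 (a * (b * t - p)\<^sup>2 / (2 * b\<^sup>2), t, p)"
    and e45: "\<And>t p. 0 \<le> t \<Longrightarrow> 0 \<le> p \<Longrightarrow> p \<le> b * t \<Longrightarrow> f4 (0, t, p) = f5 (0, t, p)"
  shows "z \<in> cl1 a b \<Longrightarrow> glue a b f1 f2 f3 f4 f5 z = f1 z"
    and "z \<in> cl2 a b \<Longrightarrow> glue a b f1 f2 f3 f4 f5 z = f2 z"
    and "z \<in> cl3 a b \<Longrightarrow> glue a b f1 f2 f3 f4 f5 z = f3 z"
    and "z \<in> cl4 a b \<Longrightarrow> glue a b f1 f2 f3 f4 f5 z = f4 z"
    and "z \<in> cl5 a b \<Longrightarrow> glue a b f1 f2 f3 f4 f5 z = f5 z"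
proof -
  obtain x t p where z: "z = (x, t, p)" using prod_cases3 by blast
  note ci = cl_inter[OF ab, of x t p]
  have i: "0 \<le> t" "0 \<le> p" if "(x, t, p) \<in> cl1 a b \<union> cl2 a b \<union> cl3 a b \<union> cl4 a b \<union> cl5 a b"
    using that by (auto simp: cl1_def cl2_def cl3_def cl4_def cl5_def)
  have j: "p \<le> b * t" if "(x, t, p) \<in> cl4 a b \<union> cl5 a b"
    using that by (auto simp: cl4_def cl5_def)
  have bb: "a * (b * t)\<^sup>2 / (2 * b\<^sup>2) = a / 2 * t\<^sup>2" using ab by (simp add: field_simps)
  have 12: "f1 z = f2 z" if "z \<in> cl1 a b" "z \<in> cl2 a b"
    using ci(1) e12[of p] i that z by auto
  have 13: "f1 z = f3 z" if "z \<in> cl1 a b" "z \<in> cl3 a b"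
    using ci(2) e13[of t p] i that z by auto
  \<comment> \<open>At \<open>p = 0\<close> the boundary curves of the third region coincide, so
    \<open>f3\<close> mediates between \<open>f1\<close> and \<open>f4\<close>.\<close>
  have 14: "f1 z = f4 z" if "z \<in> cl1 a b" "z \<in> cl4 a b"
  proof -
    have e: "z = (a / 2 * t\<^sup>2, t, 0)" "0 \<le> t" "0 \<le> b * t" using ci(3) i j that z ab by auto
    show ?thesis unfolding e(1) using e13[OF e(2), of 0] e34[OF e(2), of 0] e(3) bb by auto
  qed
  have 15: "f1 z = f5 z" if "z \<in> cl1 a b" "z \<in> cl5 a b"
    using ci(4) e13[of 0 0] e34[of 0 0] e45[of 0 0] i that z by auto
  have 23: "f2 z = f3 z" if "z \<in> cl2 a b" "z \<in> cl3 a b"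
    using ci(5) e23[of t p] i that z by auto
  have 24: "f2 z = f4 z" if "z \<in> cl2 a b" "z \<in> cl4 a b"
    using ci(6) e25[of t p] e45[of t p] i j that z by auto
  have 25: "f2 z = f5 z" if "z \<in> cl2 a b" "z \<in> cl5 a b"
    using ci(7) e25[of t p] i that z by auto
  have 34: "f3 z = f4 z" if "z \<in> cl3 a b" "z \<in> cl4 a b"
    using ci(8) e34[of t p] i that z by auto
  have 35: "f3 z = f5 z" if "z \<in> cl3 a b" "z \<in> cl5 a b"
    using ci(9) e34[of t p] e45[of t p] i j that z by auto
  have 45: "f4 z = f5 z" if "z \<in> cl4 a b" "z \<in> cl5 a b"
    using ci(10) e45[of t p] i j that z by auto
  show "z \<in> cl1 a b \<Longrightarrow> glue a b f1 f2 f3 f4 f5 z = f1 z"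
    and "z \<in> cl2 a b \<Longrightarrow> glue a b f1 f2 f3 f4 f5 z = f2 z"
    and "z \<in> cl3 a b \<Longrightarrow> glue a b f1 f2 f3 f4 f5 z = f3 z"
    and "z \<in> cl4 a b \<Longrightarrow> glue a b f1 f2 f3 f4 f5 z = f4 z"
    and "z \<in> cl5 a b \<Longrightarrow> glue a b f1 f2 f3 f4 f5 z = f5 z"
    using 12 13 14 15 23 24 25 34 35 45 unfolding glue_def by auto
qed

section \<open>Derivatives of the pieces\<close>

text \<open>Since \<open>sqrt\<close> is odd, \<open>w * sqrt w\<close> is of class $C^1$ on the whole line, while \<open>w powr (3 / 2)\<close>
  agrees with it only for \<open>w \<ge> 0\<close>. The pieces are therefore rewritten with \<open>w * sqrt w\<close>.\<close>

lemma DERIV_mult_sqrt: "((\<lambda>w. w * sqrt w) has_real_derivative 3 / 2 * sqrt w) (at w)"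
proof (cases "w = 0")
  case True
  have "(sqrt \<longlongrightarrow> sqrt 0) (at 0)" by (intro tendsto_intros)
  hence "((\<lambda>h. (h * sqrt h - 0) / h) \<longlongrightarrow> 0) (at 0)"
    by (auto elim!: Lim_transform_eventually simp: eventually_at_filter)
  thus ?thesis using True by (simp add: DERIV_def)
next
  case False
  have "((\<lambda>w. w * sqrt w) has_real_derivative sqrt w + w * (if w > 0 then inverse (sqrt w) / 2 else - inverse (sqrt w) / 2)) (at w)"
    using False by (auto intro!: derivative_eq_intros)
  moreover have "w * inverse (sqrt w) = sqrt w" if "w > 0" using that
    by (metis real_div_sqrt divide_inverse less_imp_le)
  moreover have "w * inverse (sqrt w) = - sqrt w" if "w < 0"
    using that real_div_sqrt[of "-w"] by (simp add: real_sqrt_minus divide_inverse)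
  ultimately show ?thesis using False
    by (cases "w > 0") auto
qed

text \<open>Root of the discriminant in the quadratic equation \<open>x = (p - b * (t - \<sigma>)) *
  \<sigma> + a * \<sigma>\<^sup>2 / 2\<close> for the time \<sigma> elapsed since the motion crossed
  zero.\<close>

abbreviation crossing_root :: "real \<Rightarrow> real \<Rightarrow> real \<Rightarrow> real \<Rightarrow> real \<Rightarrow> real" where
  "crossing_root x t p a b \<equiv> sqrt ((b * t - p)\<^sup>2 + 2 * x * (a + 2 * b))"

definition pc3 :: "real \<Rightarrow> real \<Rightarrow> real \<Rightarrow> real \<Rightarrow> real \<Rightarrow> real" where
  "pc3 x t p a b =
     (a + b) / (3 * (a + 2 * b)\<^sup>2)
       * ((b * t - p) ^ 3 + ((b * t - p)\<^sup>2 + 2 * x * (a + 2 * b)) * crossing_root x t p a b)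
     - b / (a + 2 * b) * (b * t - p) * x
     - b\<^sup>2 / 6 * t ^ 3 + b / 2 * p * t\<^sup>2 - 1 / 2 * p\<^sup>2 * t"

definition gx3 :: "real \<Rightarrow> real \<Rightarrow> real \<Rightarrow> real \<Rightarrow> real \<Rightarrow> real" where
  "gx3 x t p a b = ((a + b) * crossing_root x t p a b - b * (b * t - p)) / (a + 2 * b)"

definition gp3 :: "real \<Rightarrow> real \<Rightarrow> real \<Rightarrow> real \<Rightarrow> real \<Rightarrow> real" where
  "gp3 x t p a b = - ((a + b) / (a + 2 * b)\<^sup>2) * (b * t - p) * (b * t - p + crossing_root x t p a b)
     + b / (a + 2 * b) * x + b / 2 * t\<^sup>2 - p * t"

lemma powr_three_halves: "0 \<le> w \<Longrightarrow> w powr (3 / 2) = w * sqrt (w::real)"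
proof -
  assume "0 \<le> w"
  have "w powr (3/2) = w powr (1 + 1/2)" by simp
  also have "\<dots> = w * sqrt w" using \<open>0 \<le> w\<close> by (subst powr_add) (simp add: powr_half_sqrt)
  finally show ?thesis .
qed

lemma FDERIV_mult_sqrt:
  "(u has_derivative u') (at z within A) \<Longrightarrow>
   ((\<lambda>z. u z * sqrt (u z)) has_derivative (\<lambda>h. u' h * (3 / 2 * sqrt (u z)))) (at z within A)"
  using DERIV_compose_FDERIV[OF DERIV_mult_sqrt] .

definition dform :: "real \<Rightarrow> real \<Rightarrow> real \<Rightarrow> real \<times> real \<times> real \<Rightarrow> real" where
  "dform g h m = (\<lambda>(dx, dt, dp). g * dx + h * dt + m * dp)"

text \<open>The time coefficient is written as minus half the square of the space coefficient minus
  the potential. The one-dimensional equation is thus part of the differential, here and for the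
  other four pieces.\<close>

lemma deriv_piece1:
  "((\<lambda>(x, t, p). piece1 x t p a b) has_derivative
     dform (p + a * t) (- (p + a * t)\<^sup>2 / 2 + a * x) (x - p * t - a / 2 * t\<^sup>2)) (at (x, t, p) within A)"
  unfolding piece1_def case_prod_beta dform_def
  by (rule has_derivative_eq_rhs, (rule derivative_intros)+)
     (auto simp: fun_eq_iff field_simps power2_eq_square)

lemma deriv_piece2:
  "((\<lambda>(x, t, p). piece2 x t p a b) has_derivative
     dform (p - b * t) (- (p - b * t)\<^sup>2 / 2 - b * x) (x - p * t + b / 2 * t\<^sup>2)) (at (x, t, p) within A)"
  unfolding piece2_def case_prod_beta dform_def
  by (rule has_derivative_eq_rhs, (rule derivative_intros)+)
     (auto simp: fun_eq_iff field_simps power2_eq_square)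

lemma deriv_pc3:
  assumes "0 < a" "0 < b" "0 \<le> x"
  shows "((\<lambda>(x, t, p). pc3 x t p a b) has_derivative
     dform (gx3 x t p a b) (- (gx3 x t p a b)\<^sup>2 / 2 + a * x) (gp3 x t p a b)) (at (x, t, p) within A)"
proof -
  define c where "c = a + 2 * b"
  define S where "S = crossing_root x t p a b"
  define q where "q = b * t - p"
  have S2: "S\<^sup>2 = q\<^sup>2 + 2 * x * c" using assms unfolding S_def q_def c_def by simp
  have c0: "c \<noteq> 0" using assms by (simp add: c_def)
  define D where "D = (\<lambda>h::real\<times>real\<times>real. (a + b) / (3 * c\<^sup>2) *
     (3 * q\<^sup>2 * (b * fst (snd h) - snd (snd h)) + (2 * q * (b * fst (snd h) - snd (snd h)) + 2 * fst h * c) * (3 / 2 * S))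
     - b / c * (q * fst h + x * (b * fst (snd h) - snd (snd h)))
     - b\<^sup>2 / 2 * t\<^sup>2 * fst (snd h) + b / 2 * (p * (2 * t * fst (snd h)) + t\<^sup>2 * snd (snd h))
     - 1 / 2 * (p\<^sup>2 * fst (snd h) + 2 * p * t * snd (snd h)))"
  have "((\<lambda>(x, t, p). pc3 x t p a b) has_derivative D) (at (x, t, p) within A)"
  proof -
    define k where "k = (a + b) / (3 * c\<^sup>2)"
    define v where "v = b / c"
    define q' where "q' = (\<lambda>z::real\<times>real\<times>real. b * fst (snd z) - snd (snd z))"
    define w where "w = (\<lambda>z::real\<times>real\<times>real. (q' z)\<^sup>2 + 2 * fst z * c)"
    have eq: "(\<lambda>(x, t, p). pc3 x t p a b) = (\<lambda>z. k * (q' z ^ 3 + w z * sqrt (w z)) - v * (q' z * fst z)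
       - b\<^sup>2 / 6 * fst (snd z) ^ 3 + b / 2 * (snd (snd z) * (fst (snd z))\<^sup>2) - 1 / 2 * ((snd (snd z))\<^sup>2 * fst (snd z)))"
      unfolding pc3_def case_prod_beta k_def v_def c_def w_def q'_def by (simp add: mult.assoc)
    have dq: "(q' has_derivative q') (at z within A)" for z
      unfolding q'_def by (intro derivative_intros)
    have dw: "(w has_derivative (\<lambda>h. 2 * q' z * q' h + 2 * fst h * c)) (at z within A)" for z
      unfolding w_def by (rule derivative_eq_intros dq refl)+ (simp add: fun_eq_iff)
    have 1: "((\<lambda>z. q' z ^ 3 + w z * sqrt (w z)) has_derivative
       (\<lambda>h. 3 * (q' z)\<^sup>2 * q' h + (2 * q' z * q' h + 2 * fst h * c) * (3 / 2 * sqrt (w z)))) (at z within A)" for z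
      by (rule derivative_eq_intros dq refl FDERIV_mult_sqrt[OF dw])+ (simp add: fun_eq_iff)
    have 2: "((\<lambda>z. q' z * fst z) has_derivative (\<lambda>h. q' z * fst h + fst z * q' h)) (at z within A)" for z
      by (rule derivative_eq_intros dq refl)+ (simp add: fun_eq_iff)
    have 3: "((\<lambda>z. b\<^sup>2 / 6 * fst (snd z) ^ 3) has_derivative (\<lambda>h. b\<^sup>2 / 2 * (fst (snd z))\<^sup>2 * fst (snd h))) (at z within A)"
      for z :: "real \<times> real \<times> real"
      by (rule derivative_eq_intros refl)+ (simp add: fun_eq_iff)
    have 4: "((\<lambda>z. snd (snd z) * (fst (snd z))\<^sup>2) has_derivative
        (\<lambda>h. snd (snd z) * (2 * fst (snd z) * fst (snd h)) + (fst (snd z))\<^sup>2 * snd (snd h))) (at z within A)"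
      for z :: "real \<times> real \<times> real"
      by (rule derivative_eq_intros refl)+ (simp add: fun_eq_iff)
    have 5: "((\<lambda>z. (snd (snd z))\<^sup>2 * fst (snd z)) has_derivative
        (\<lambda>h. (snd (snd z))\<^sup>2 * fst (snd h) + 2 * snd (snd z) * fst (snd z) * snd (snd h))) (at z within A)"
      for z :: "real \<times> real \<times> real"
      by (rule derivative_eq_intros refl)+ (simp add: fun_eq_iff)
    have z: "q' (x, t, p) = q" "sqrt (w (x, t, p)) = S"
      unfolding w_def q'_def q_def S_def c_def by simp_all
    show ?thesis unfolding eq D_def
      unfolding k_def[symmetric] v_def[symmetric]
      by (rule has_derivative_eq_rhs, (rule 3 has_derivative_add has_derivative_diff
            has_derivative_mult_right[OF 1] has_derivative_mult_right[OF 2] has_derivative_mult_right[OF 4]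
            has_derivative_mult_right[OF 5])+)
         (simp add: z q'_def fun_eq_iff q_def)
  qed
  moreover have "D = dform (gx3 x t p a b) (- (gx3 x t p a b)\<^sup>2 / 2 + a * x) (gp3 x t p a b)"
  proof
    fix h :: "real \<times> real \<times> real"
    obtain dx dt dp where h: "h = (dx, dt, dp)" using prod_cases3 by blast
    \<comment> \<open>After division by \<open>c\<close> the slopes satisfy
      \<open>u = 1 - v\<close>, and \<open>S2\<close> eliminates \<open>x * c\<close>; what remains
      is a polynomial identity in \<open>v\<close>, \<open>q\<close> and \<open>S\<close>.\<close>
    define u v where "u = (a + b) / c" and "v = b / c"
    have uv: "u = 1 - v" and b: "b = v * c" and a: "a = c - 2 * v * c" and ab: "a + b = u * c"
      using c0 by (auto simp: u_def v_def c_def field_simps)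
    have cx: "x * c = (S\<^sup>2 - q\<^sup>2) / 2" using S2 by simp
    have gx: "gx3 x t p a b = u * S - v * q"
      unfolding gx3_def S_def q_def c_def u_def v_def by (simp add: diff_divide_distrib)
    have gp: "gp3 x t p a b = - (u / c) * q * (q + S) + v * x + b / 2 * t\<^sup>2 - p * t"
      unfolding gp3_def S_def q_def c_def u_def v_def by (simp add: power2_eq_square)
    have k1: "(a + b) / (3 * c\<^sup>2) * (2 * c * (3 / 2 * S)) = u * S"
      using c0 by (simp add: u_def power2_eq_square)
    have k2: "(a + b) / (3 * c\<^sup>2) * (3 * q\<^sup>2 * b + 2 * q * b * (3 / 2 * S)) = u * v * (q\<^sup>2 + q * S)"
      using c0 by (simp add: u_def v_def field_simps power2_eq_square)
    have k3: "v * (x * b) = v\<^sup>2 * ((S\<^sup>2 - q\<^sup>2) / 2)" unfolding cx[symmetric] b by (simp add: power2_eq_square)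
    have k4: "a * x = (1 - 2 * v) * ((S\<^sup>2 - q\<^sup>2) / 2)" unfolding cx[symmetric] a by (simp add: algebra_simps)
    have k5: "b\<^sup>2 / 2 * t\<^sup>2 - b * p * t + p\<^sup>2 / 2 = q\<^sup>2 / 2"
      unfolding q_def by (simp add: power2_eq_square field_simps)
    have 1: "(a + b) / (3 * c\<^sup>2) * (2 * c * (3 / 2 * S)) - v * q = u * S - v * q"
      unfolding k1 ..
    have "u * v * (q\<^sup>2 + q * S) - v\<^sup>2 * ((S\<^sup>2 - q\<^sup>2) / 2) - q\<^sup>2 / 2
        = - (u * S - v * q)\<^sup>2 / 2 + (1 - 2 * v) * ((S\<^sup>2 - q\<^sup>2) / 2)"
      unfolding uv by (simp add: power2_eq_square field_simps)
    hence 2: "(a + b) / (3 * c\<^sup>2) * (3 * q\<^sup>2 * b + 2 * q * b * (3 / 2 * S)) - v * (x * b)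
        - b\<^sup>2 / 2 * t\<^sup>2 + b * p * t - p\<^sup>2 / 2 = - (u * S - v * q)\<^sup>2 / 2 + a * x"
      unfolding k2 k3 k4 using k5 by linarith
    have 3: "- (a + b) / (3 * c\<^sup>2) * (3 * q\<^sup>2 + 2 * q * (3 / 2 * S)) = - (u / c) * q * (q + S)"
      using c0 by (simp add: u_def field_simps power2_eq_square)
    have "D h = ((a + b) / (3 * c\<^sup>2) * (2 * c * (3 / 2 * S)) - v * q) * dx
       + ((a + b) / (3 * c\<^sup>2) * (3 * q\<^sup>2 * b + 2 * q * b * (3 / 2 * S)) - v * (x * b)
        - b\<^sup>2 / 2 * t\<^sup>2 + b * p * t - p\<^sup>2 / 2) * dt
       + (- (a + b) / (3 * c\<^sup>2) * (3 * q\<^sup>2 + 2 * q * (3 / 2 * S)) + v * x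
        + b / 2 * t\<^sup>2 - p * t) * dp"
      unfolding D_def h v_def[symmetric] by (simp add: algebra_simps add_divide_distrib diff_divide_distrib)
    also have "\<dots> = dform (gx3 x t p a b) (- (gx3 x t p a b)\<^sup>2 / 2 + a * x) (gp3 x t p a b) h"
      unfolding 1 2 3 gx gp dform_def h by simp
    finally show "D h = dform (gx3 x t p a b) (- (gx3 x t p a b)\<^sup>2 / 2 + a * x) (gp3 x t p a b) h" .
  qed
  ultimately show ?thesis by simp
qed

definition pc4 :: "real \<Rightarrow> real \<Rightarrow> real \<Rightarrow> real \<Rightarrow> real \<Rightarrow> real" where
  "pc4 x t p a b = a\<^sup>2 / 3 * (2 / a * x * sqrt (2 / a * x)) - 1 / (6 * b) * p ^ 3"

definition pc5 :: "real \<Rightarrow> real \<Rightarrow> real \<Rightarrow> real \<Rightarrow> real \<Rightarrow> real" where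
  "pc5 x t p a b = b\<^sup>2 / 3 * (- 2 / b * x * sqrt (- 2 / b * x)) - 1 / (6 * b) * p ^ 3"

lemma deriv_pc4:
  assumes "0 < a" "0 < b" "0 \<le> x"
  shows "((\<lambda>(x, t, p). pc4 x t p a b) has_derivative
     dform (a * sqrt (2 * x / a)) (- (a * sqrt (2 * x / a))\<^sup>2 / 2 + a * x) (- p\<^sup>2 / (2 * b))) (at (x, t, p) within A)"
proof -
  have "((\<lambda>(x, t, p). pc4 x t p a b) has_derivative (\<lambda>h.
      a\<^sup>2 / 3 * (2 * fst h / a * (3 / 2 * sqrt (2 * x / a))) - 3 * p\<^sup>2 * snd (snd h) / (6 * b))) (at (x, t, p) within A)"
    unfolding pc4_def case_prod_beta
    by (rule has_derivative_eq_rhs, (rule FDERIV_mult_sqrt derivative_intros)+)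
       (use assms in \<open>auto simp: fun_eq_iff field_simps power2_eq_square\<close>)
  thus ?thesis
    apply (rule has_derivative_eq_rhs)
    using assms by (auto simp: fun_eq_iff dform_def field_simps power2_eq_square)
qed

lemma deriv_pc5:
  assumes "0 < a" "0 < b" "x \<le> 0"
  shows "((\<lambda>(x, t, p). pc5 x t p a b) has_derivative
     dform (- b * sqrt (- 2 * x / b)) (- (- b * sqrt (- 2 * x / b))\<^sup>2 / 2 - b * x) (- p\<^sup>2 / (2 * b))) (at (x, t, p) within A)"
proof -
  have "((\<lambda>(x, t, p). pc5 x t p a b) has_derivative (\<lambda>h.
      b\<^sup>2 / 3 * (- 2 * fst h / b * (3 / 2 * sqrt (- 2 * x / b))) - 3 * p\<^sup>2 * snd (snd h) / (6 * b))) (at (x, t, p) within A)"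
    unfolding pc5_def case_prod_beta
    by (rule has_derivative_eq_rhs, (rule FDERIV_mult_sqrt derivative_intros)+)
       (use assms in \<open>auto simp: fun_eq_iff field_simps power2_eq_square\<close>)
  moreover have "(sqrt (- 2 * x / b))\<^sup>2 = - 2 * x / b" using assms by (simp add: divide_nonpos_pos)
  ultimately show ?thesis
    apply (elim has_derivative_eq_rhs)
    using assms by (auto simp: fun_eq_iff dform_def field_simps power2_eq_square)
qed

section \<open>Value, velocity and starting point for nonnegative p\<close>

definition vxN :: "real \<Rightarrow> real \<Rightarrow> real \<times> real \<times> real \<Rightarrow> real" where
  "vxN a b = glue a b (\<lambda>(x, t, p). p + a * t) (\<lambda>(x, t, p). p - b * t) (\<lambda>(x, t, p). gx3 x t p a b)
     (\<lambda>(x, t, p). a * sqrt (2 * x / a)) (\<lambda>(x, t, p). - b * sqrt (- 2 * x / b))"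

text \<open>Starting point of the optimal motion. In regions 4 and 5 it depends on \<open>p\<close>
  alone: a motion with initial velocity \<open>p\<close> and deceleration \<open>b\<close> that
  comes to rest exactly at zero must start at \<open>- p\<^sup>2 / (2 * b)\<close>.\<close>

definition vpN :: "real \<Rightarrow> real \<Rightarrow> real \<times> real \<times> real \<Rightarrow> real" where
  "vpN a b = glue a b (\<lambda>(x, t, p). x - p * t - a / 2 * t\<^sup>2) (\<lambda>(x, t, p). x - p * t + b / 2 * t\<^sup>2)
     (\<lambda>(x, t, p). gp3 x t p a b) (\<lambda>(x, t, p). - p\<^sup>2 / (2 * b)) (\<lambda>(x, t, p). - p\<^sup>2 / (2 * b))"

definition vN :: "real \<Rightarrow> real \<Rightarrow> real \<times> real \<times> real \<Rightarrow> real" where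
  "vN a b = glue a b (\<lambda>(x, t, p). piece1 x t p a b) (\<lambda>(x, t, p). piece2 x t p a b)
     (\<lambda>(x, t, p). pc3 x t p a b) (\<lambda>(x, t, p). pc4 x t p a b) (\<lambda>(x, t, p). pc5 x t p a b)"

context
  fixes a b :: real
  assumes a: "0 < a" and b: "0 < b"
begin

text \<open>On each interface of the third region the radicand is a perfect square (see also
  \<open>root23\<close> and \<open>root34\<close>), which turns the gluing identities into rational
  ones.\<close>

lemma root13: "0 \<le> t \<Longrightarrow> 0 \<le> p \<Longrightarrow> crossing_root (p * t + a / 2 * t\<^sup>2) t p a b = (a + b) * t + p"
proof -
  assume "0 \<le> t" "0 \<le> p"
  have "(b * t - p)\<^sup>2 + 2 * (p * t + a / 2 * t\<^sup>2) * (a + 2 * b) = ((a + b) * t + p)\<^sup>2"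
    by (simp add: field_simps power2_eq_square)
  thus ?thesis using a b \<open>0 \<le> t\<close> \<open>0 \<le> p\<close> by simp
qed

lemma root23: "b * t \<le> p \<Longrightarrow> crossing_root 0 t p a b = p - b * t"
  by (simp add: real_sqrt_unique)

lemma root34: "p \<le> b * t \<Longrightarrow> crossing_root (a * (b * t - p)\<^sup>2 / (2 * b\<^sup>2)) t p a b = (a + b) / b * (b * t - p)"
proof -
  assume p: "p \<le> b * t"
  define q where "q = b * t - p"
  have "q\<^sup>2 + 2 * (a * q\<^sup>2 / (2 * b\<^sup>2)) * (a + 2 * b) = ((a + b) / b * q)\<^sup>2"
    using b by (simp add: field_simps power2_eq_square)
  thus ?thesis using a b p unfolding q_def by simp
qed

lemma pc3_eq:
  assumes "crossing_root x t p a b = S" "(b * t - p)\<^sup>2 + 2 * x * (a + 2 * b) \<ge> 0"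
  shows "pc3 x t p a b = (a + b) / (3 * (a + 2 * b)\<^sup>2) * ((b * t - p) ^ 3 + S ^ 3)
     - b / (a + 2 * b) * (b * t - p) * x - b\<^sup>2 / 6 * t ^ 3 + b / 2 * p * t\<^sup>2 - 1 / 2 * p\<^sup>2 * t"
proof -
  have "(b * t - p)\<^sup>2 + 2 * x * (a + 2 * b) = S\<^sup>2" using assms by auto
  thus ?thesis unfolding pc3_def assms(1) by (simp add: power2_eq_square power3_eq_cube)
qed

lemma vN_simps:
  shows "z \<in> cl1 a b \<Longrightarrow> vN a b z = (\<lambda>(x, t, p). piece1 x t p a b) z"
    and "z \<in> cl2 a b \<Longrightarrow> vN a b z = (\<lambda>(x, t, p). piece2 x t p a b) z"
    and "z \<in> cl3 a b \<Longrightarrow> vN a b z = (\<lambda>(x, t, p). pc3 x t p a b) z"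
    and "z \<in> cl4 a b \<Longrightarrow> vN a b z = (\<lambda>(x, t, p). pc4 x t p a b) z"
    and "z \<in> cl5 a b \<Longrightarrow> vN a b z = (\<lambda>(x, t, p). pc5 x t p a b) z"
proof -
  have e12: "piece1 0 0 p a b = piece2 0 0 p a b" for p
    by (simp add: piece1_def piece2_def)
  have e13: "piece1 (p * t + a / 2 * t\<^sup>2) t p a b = pc3 (p * t + a / 2 * t\<^sup>2) t p a b"
    if "0 \<le> t" "0 \<le> p" for t p
  proof -
    define c where "c = a + 2 * b"
    have c: "c > 0" "a = c - 2 * b" "a + b = c - b" using a b by (auto simp: c_def)
    \<comment> \<open>Sum of two cubes: the bases add up to \<open>c * t\<close>, which cancels one
      of the two factors \<open>c\<close> in the denominator.\<close>
    have "(b * t - p) ^ 3 + ((a + b) * t + p) ^ 3 = c * t * ((b * t - p)\<^sup>2 - (b * t - p) * ((a + b) * t + p) + ((a + b) * t + p)\<^sup>2)"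
      by (simp add: c_def power2_eq_square power3_eq_cube algebra_simps)
    moreover have "(a + b) / (3 * c\<^sup>2) * (c * t * X) = (c - b) * t * X / (3 * c)" for X
      using c by (simp add: c(3) power2_eq_square)
    moreover have "b / c * X * Y = 3 * b * X * Y / (3 * c)" for X Y using c(1) by simp
    ultimately have 1: "(a + b) / (3 * c\<^sup>2) * ((b * t - p) ^ 3 + ((a + b) * t + p) ^ 3) - b / c * (b * t - p) * (p * t + a / 2 * t\<^sup>2)
      = ((c - b) * t * ((b * t - p)\<^sup>2 - (b * t - p) * ((c - b) * t + p) + ((c - b) * t + p)\<^sup>2) - 3 * b * (b * t - p) * (p * t + (c - 2 * b) / 2 * t\<^sup>2)) / (3 * c)"
      by (simp only: c(3)) (simp add: c(2) diff_divide_distrib)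
    have 2: "((c - b) * t * ((b * t - p)\<^sup>2 - (b * t - p) * ((c - b) * t + p) + ((c - b) * t + p)\<^sup>2) - 3 * b * (b * t - p) * (p * t + (c - 2 * b) / 2 * t\<^sup>2))
      = (3 * c) * (piece1 (p * t + a / 2 * t\<^sup>2) t p a b + b\<^sup>2 / 6 * t ^ 3 - b / 2 * p * t\<^sup>2 + 1 / 2 * p\<^sup>2 * t)"
      unfolding piece1_def c(2) by (simp add: power2_eq_square power3_eq_cube field_simps)
    show ?thesis
      apply (subst pc3_eq[OF root13[OF that]])
      using that a b apply simp
      unfolding c_def[symmetric] 1 2 using c(1) by simp
  qed
  have e23: "piece2 0 t p a b = pc3 0 t p a b" if "b * t \<le> p" for t p
    apply (subst pc3_eq[OF root23[OF that]])
    apply simp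
    by (simp add: piece2_def power2_eq_square power3_eq_cube field_simps)
  have e25: "piece2 (- (b * t - p)\<^sup>2 / (2 * b)) t p a b = pc5 (- (b * t - p)\<^sup>2 / (2 * b)) t p a b"
    if "p \<le> b * t" for t p
  proof -
    have 1: "- 2 / b * (- (b * t - p)\<^sup>2 / (2 * b)) = ((b * t - p) / b)\<^sup>2"
      using b by (simp add: field_simps power2_eq_square)
    have 2: "sqrt (((b * t - p) / b)\<^sup>2) = (b * t - p) / b" using that b by simp
    show ?thesis unfolding pc5_def 1 2 piece2_def
      using b by (simp add: field_simps power2_eq_square power3_eq_cube)
  qed
  have e34: "pc3 (a * (b * t - p)\<^sup>2 / (2 * b\<^sup>2)) t p a b = pc4 (a * (b * t - p)\<^sup>2 / (2 * b\<^sup>2)) t p a b"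
    if "p \<le> b * t" for t p
  proof -
    define q where "q = b * t - p"
    define c where "c = a + 2 * b"
    have c: "c > 0" "a = c - 2 * b" "a + b = c - b" using a b by (auto simp: c_def)
    have 1: "2 / a * (a * q\<^sup>2 / (2 * b\<^sup>2)) = (q / b)\<^sup>2"
      using a b by (simp add: field_simps power2_eq_square)
    have 2: "sqrt ((q / b)\<^sup>2) = q / b" using that b by (simp add: q_def)
    have 3: "- b\<^sup>2 / 6 * t ^ 3 + b / 2 * p * t\<^sup>2 - 1 / 2 * p\<^sup>2 * t = - (q ^ 3 / (6 * b)) - p ^ 3 / (6 * b)"
      unfolding q_def using b by (simp add: field_simps power2_eq_square power3_eq_cube)
    define u where "u = q / b"
    have q: "q = b * u" using b by (simp add: u_def)
    have q2: "(a + b) / b * q = (c - b) * u" using b by (simp add: q c(3))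
    have q3: "a * q\<^sup>2 / (2 * b\<^sup>2) = (c - 2 * b) * u\<^sup>2 / 2" using b by (simp add: q c(2) power_mult_distrib)
    \<comment> \<open>Again a sum of two cubes, now with bases adding up to
      \<open>c * u\<close>.\<close>
    have "q ^ 3 + ((c - b) * u) ^ 3 = c * (u ^ 3 * (b\<^sup>2 - b * (c - b) + (c - b)\<^sup>2))"
      unfolding q by (simp add: power2_eq_square power3_eq_cube algebra_simps)
    hence 4: "(a + b) / (3 * c\<^sup>2) * (q ^ 3 + ((a + b) / b * q) ^ 3) = (c - b) * (u ^ 3 * (b\<^sup>2 - b * (c - b) + (c - b)\<^sup>2)) / (3 * c)"
      using c(1) unfolding q2 unfolding c(3) by (simp add: power2_eq_square)
    have 5: "b / c * q * (a * q\<^sup>2 / (2 * b\<^sup>2)) = b\<^sup>2 * u * ((c - 2 * b) * u\<^sup>2) / (2 * c)"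
      unfolding q3 unfolding q by (simp add: power2_eq_square)
    have 6: "a\<^sup>2 / 3 * ((q / b)\<^sup>2 * (q / b)) + q ^ 3 / (6 * b) = (c - 2 * b)\<^sup>2 / 3 * u ^ 3 + b\<^sup>2 * u ^ 3 / 6"
      unfolding u_def[symmetric] unfolding q c(2) using b by (simp add: power2_eq_square power3_eq_cube)
    have 8: "(a + b) / (3 * c\<^sup>2) * (q ^ 3 + ((a + b) / b * q) ^ 3) - b / c * q * (a * q\<^sup>2 / (2 * b\<^sup>2))
      = a\<^sup>2 / 3 * ((q / b)\<^sup>2 * (q / b)) + q ^ 3 / (6 * b)"
      unfolding 4 5 6 using c(1) by (simp add: field_simps power2_eq_square power3_eq_cube)
    show ?thesis
      apply (subst pc3_eq[OF root34[OF that]])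
      using that a b apply simp
      unfolding pc4_def q_def[symmetric] c_def[symmetric] 1 2
      using 3 8 by (simp add: field_simps)
  qed
  have e45: "pc4 0 t p a b = pc5 0 t p a b" for t p
    by (simp add: pc4_def pc5_def)
  show "z \<in> cl1 a b \<Longrightarrow> vN a b z = (\<lambda>(x, t, p). piece1 x t p a b) z"
    and "z \<in> cl2 a b \<Longrightarrow> vN a b z = (\<lambda>(x, t, p). piece2 x t p a b) z"
    and "z \<in> cl3 a b \<Longrightarrow> vN a b z = (\<lambda>(x, t, p). pc3 x t p a b) z"
    and "z \<in> cl4 a b \<Longrightarrow> vN a b z = (\<lambda>(x, t, p). pc4 x t p a b) z"
    and "z \<in> cl5 a b \<Longrightarrow> vN a b z = (\<lambda>(x, t, p). pc5 x t p a b) z"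
    unfolding vN_def by ((rule glue_eq[OF a b]; simp only: split_conv e12 e13 e23 e25 e34 e45)+)
qed

text \<open>Agreement of the velocities across the interfaces; with \<open>vpN_simps\<close> it
  gives all pieces that meet at a point one common differential there.\<close>

lemma vxN_simps:
  shows "z \<in> cl1 a b \<Longrightarrow> vxN a b z = (\<lambda>(x, t, p). p + a * t) z"
    and "z \<in> cl2 a b \<Longrightarrow> vxN a b z = (\<lambda>(x, t, p). p - b * t) z"
    and "z \<in> cl3 a b \<Longrightarrow> vxN a b z = (\<lambda>(x, t, p). gx3 x t p a b) z"
    and "z \<in> cl4 a b \<Longrightarrow> vxN a b z = (\<lambda>(x, t, p). a * sqrt (2 * x / a)) z"
    and "z \<in> cl5 a b \<Longrightarrow> vxN a b z = (\<lambda>(x, t, p). - b * sqrt (- 2 * x / b)) z"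
proof -
  have c: "a + 2 * b \<noteq> 0" using a b by simp
  have e13: "gx3 (p * t + a / 2 * t\<^sup>2) t p a b = p + a * t" if "0 \<le> t" "0 \<le> p" for t p
    unfolding gx3_def root13[OF that] using c by (simp add: field_simps)
  have e23: "gx3 0 t p a b = p - b * t" if "b * t \<le> p" for t p
    unfolding gx3_def root23[OF that] using c by (simp add: field_simps)
  have e34: "gx3 (a * (b * t - p)\<^sup>2 / (2 * b\<^sup>2)) t p a b = a * sqrt (2 * (a * (b * t - p)\<^sup>2 / (2 * b\<^sup>2)) / a)"
    if "p \<le> b * t" for t p
  proof -
    have 1: "2 * (a * (b * t - p)\<^sup>2 / (2 * b\<^sup>2)) / a = ((b * t - p) / b)\<^sup>2"
      using a b by (simp add: field_simps power2_eq_square)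
    have 2: "sqrt (((b * t - p) / b)\<^sup>2) = (b * t - p) / b" using that b by simp
    define q where "q = b * t - p"
    have "(a + b) * ((a + b) / b * q) - b * q = (a + 2 * b) * (a * (q / b))"
      using b by (simp add: field_simps)
    hence "((a + b) * ((a + b) / b * q) - b * q) / (a + 2 * b) = a * (q / b)"
      using c by simp
    thus ?thesis unfolding gx3_def root34[OF that] 1 2 q_def .
  qed
  have e25: "p - b * t = - b * sqrt (- 2 * (- (b * t - p)\<^sup>2 / (2 * b)) / b)" if "p \<le> b * t" for t p
  proof -
    have 1: "- 2 * (- (b * t - p)\<^sup>2 / (2 * b)) / b = ((b * t - p) / b)\<^sup>2"
      using b by (simp add: field_simps power2_eq_square)
    have 2: "sqrt (((b * t - p) / b)\<^sup>2) = (b * t - p) / b" using that b by simp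
    show ?thesis unfolding 1 2 using b by simp
  qed
  show "z \<in> cl1 a b \<Longrightarrow> vxN a b z = (\<lambda>(x, t, p). p + a * t) z"
    and "z \<in> cl2 a b \<Longrightarrow> vxN a b z = (\<lambda>(x, t, p). p - b * t) z"
    and "z \<in> cl3 a b \<Longrightarrow> vxN a b z = (\<lambda>(x, t, p). gx3 x t p a b) z"
    and "z \<in> cl4 a b \<Longrightarrow> vxN a b z = (\<lambda>(x, t, p). a * sqrt (2 * x / a)) z"
    and "z \<in> cl5 a b \<Longrightarrow> vxN a b z = (\<lambda>(x, t, p). - b * sqrt (- 2 * x / b)) z"
    unfolding vxN_def by ((rule glue_eq[OF a b]; simp only: e13 e23 e25[symmetric] e34 split_conv; simp)+)
qed

text \<open>On the interface of regions 1 and 3 the motion starts at zero; on that of regions 3 and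
  4 it reaches zero with velocity zero.\<close>

lemma vpN_simps:
  shows "z \<in> cl1 a b \<Longrightarrow> vpN a b z = (\<lambda>(x, t, p). x - p * t - a / 2 * t\<^sup>2) z"
    and "z \<in> cl2 a b \<Longrightarrow> vpN a b z = (\<lambda>(x, t, p). x - p * t + b / 2 * t\<^sup>2) z"
    and "z \<in> cl3 a b \<Longrightarrow> vpN a b z = (\<lambda>(x, t, p). gp3 x t p a b) z"
    and "z \<in> cl4 a b \<Longrightarrow> vpN a b z = (\<lambda>(x, t, p). - p\<^sup>2 / (2 * b)) z"
    and "z \<in> cl5 a b \<Longrightarrow> vpN a b z = (\<lambda>(x, t, p). - p\<^sup>2 / (2 * b)) z"
proof -
  have c: "a + 2 * b \<noteq> 0" using a b by simp
  have e13: "gp3 (p * t + a / 2 * t\<^sup>2) t p a b = 0" if "0 \<le> t" "0 \<le> p" for t p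
  proof -
    define c where "c = a + 2 * b"
    have c: "c > 0" "a = c - 2 * b" using a b by (auto simp: c_def)
    have 1: "b * t - p + ((a + b) * t + p) = c * t" by (simp add: c_def algebra_simps)
    show ?thesis unfolding gp3_def root13[OF that] unfolding 1 c_def[symmetric] using c(1)
      by (simp add: c(2) field_simps power2_eq_square)
  qed
  have e23: "gp3 0 t p a b = b / 2 * t\<^sup>2 - p * t" if "b * t \<le> p" for t p
    unfolding gp3_def root23[OF that] by simp
  have e34: "gp3 (a * (b * t - p)\<^sup>2 / (2 * b\<^sup>2)) t p a b = - p\<^sup>2 / (2 * b)" if "p \<le> b * t" for t p
  proof -
    define c where "c = a + 2 * b"
    have c: "c > 0" "a = c - 2 * b" using a b by (auto simp: c_def)
    define q where "q = b * t - p"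
    have 1: "q + (a + b) / b * q = c / b * q" using b by (simp add: c_def field_simps)
    have 2: "b / 2 * t\<^sup>2 - p * t = (q\<^sup>2 - p\<^sup>2) / (2 * b)"
      unfolding q_def using b by (simp add: field_simps power2_eq_square)
    have "- ((a + b) / c\<^sup>2) * q * (c / b * q) + b / c * (a * q\<^sup>2 / (2 * b\<^sup>2)) + (q\<^sup>2 - p\<^sup>2) / (2 * b) = - p\<^sup>2 / (2 * b)"
      using b c(1) by (simp add: c(2) field_simps power2_eq_square)
    thus ?thesis unfolding gp3_def root34[OF that] unfolding q_def[symmetric] c_def[symmetric] 1
      using 2 by simp
  qed
  have e25: "- (b * t - p)\<^sup>2 / (2 * b) - p * t + b / 2 * t\<^sup>2 = - p\<^sup>2 / (2 * b)" for t p
    using b by (simp add: field_simps power2_eq_square)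
  show "z \<in> cl1 a b \<Longrightarrow> vpN a b z = (\<lambda>(x, t, p). x - p * t - a / 2 * t\<^sup>2) z"
    and "z \<in> cl2 a b \<Longrightarrow> vpN a b z = (\<lambda>(x, t, p). x - p * t + b / 2 * t\<^sup>2) z"
    and "z \<in> cl3 a b \<Longrightarrow> vpN a b z = (\<lambda>(x, t, p). gp3 x t p a b) z"
    and "z \<in> cl4 a b \<Longrightarrow> vpN a b z = (\<lambda>(x, t, p). - p\<^sup>2 / (2 * b)) z"
    and "z \<in> cl5 a b \<Longrightarrow> vpN a b z = (\<lambda>(x, t, p). - p\<^sup>2 / (2 * b)) z"
    unfolding vpN_def by ((rule glue_eq[OF a b]; simp only: e13 e23 e25 e34 split_conv; simp)+)
qed

end

section \<open>The one-dimensional function\<close>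

text \<open>The filter \<open>at z within A \<union> B\<close> is the supremum of the two filters,
  so the difference quotients converge along it as well.\<close>

lemma has_derivative_within_Un:
  assumes "(f has_derivative D) (at z within A)" "(f has_derivative D) (at z within B)"
  shows "(f has_derivative D) (at z within A \<union> B)"
proof -
  have "((\<lambda>y. (1 / norm (y - z)) *\<^sub>R (f y - (f z + D (y - z)))) \<longlongrightarrow> 0) (at z within A \<union> B)"
    using assms unfolding at_within_union has_derivative_within by (auto intro: filterlim_sup)
  thus ?thesis using assms(1) unfolding has_derivative_within by blast
qed

text \<open>Off the closed set \<open>C\<close> the filter \<open>at z within C\<close> is trivial
  and any bounded linear \<open>D\<close> is a derivative. Hence the same \<open>D\<close> can be
  claimed on every piece, whether or not it contains \<open>z\<close>.\<close>

lemma has_derivative_within_closed_piece: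
  fixes f g :: "'a::euclidean_space \<Rightarrow> 'b::real_normed_vector"
  assumes "closed C" "\<And>w. w \<in> C \<Longrightarrow> f w = g w" "bounded_linear D"
    and "z \<in> C \<Longrightarrow> (g has_derivative D) (at z within C)"
  shows "(f has_derivative D) (at z within C)"
proof (cases "z \<in> C")
  case True
  show ?thesis by (rule has_derivative_transform[OF True _ assms(4)[OF True]]) (rule assms(2))
next
  case False
  hence "at z within C = bot" using \<open>closed C\<close>
    by (metis at_within_eq_bot_iff closed_limpt islimpt_in_closure Diff_iff closure_closed)
  thus ?thesis using assms(3) unfolding has_derivative_within by simp
qed

lemma bounded_linear_dform: "bounded_linear (dform g h m)"
  unfolding dform_def case_prod_beta
  by (intro bounded_linear_add bounded_linear_compose[OF bounded_linear_mult_right] bounded_linear_fst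
     bounded_linear_compose[OF bounded_linear_fst bounded_linear_snd] bounded_linear_compose[OF bounded_linear_snd bounded_linear_snd])

definition quadrant :: "(real \<times> real \<times> real) set" where
  "quadrant = {(x, t, p). 0 \<le> t \<and> 0 \<le> p}"

lemma quadrant_eq: "quadrant = cl1 a b \<union> cl2 a b \<union> cl3 a b \<union> cl4 a b \<union> cl5 a b"
  using cl_cover unfolding quadrant_def
  by (auto simp: cl1_def cl2_def cl3_def cl4_def cl5_def)

context
  fixes a b :: real
  assumes a: "0 < a" and b: "0 < b"
begin

text \<open>Each half-open region lies in its closed counterpart, where the radicands are
  nonnegative, so that \<open>powr_three_halves\<close> applies.\<close>

lemma V1_nonneg_eq:
  assumes "0 \<le> t" "0 \<le> p"
  shows "V1_nonneg x t p a b = vN a b (x, t, p)"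
proof -
  have q: "(b * t - p)\<^sup>2 = b\<^sup>2 * (t - p / b)\<^sup>2"
    using b by (simp add: power_mult_distrib[symmetric] algebra_simps)
  have tb: "t < p / b \<longleftrightarrow> b * t < p" "p / b \<le> t \<longleftrightarrow> p \<le> b * t"
    using b by (auto simp: field_simps)
  have cancel: "2 * b * y \<le> 2 * b * y' \<longleftrightarrow> y \<le> y'" for y y' using b by simp
  have s2: "2 * b * x \<le> - (b * t - p)\<^sup>2 \<longleftrightarrow> x \<le> - (b / 2) * (t - p / b)\<^sup>2"
  proof -
    have "- (b * t - p)\<^sup>2 = 2 * b * (- (b / 2) * (t - p / b)\<^sup>2)" unfolding q by (simp add: power2_eq_square)
    thus ?thesis using cancel by presburger
  qed
  have s5: "- (b * t - p)\<^sup>2 \<le> 2 * b * x \<longleftrightarrow> - (b / 2) * (t - p / b)\<^sup>2 \<le> x"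
  proof -
    have "- (b * t - p)\<^sup>2 = 2 * b * (- (b / 2) * (t - p / b)\<^sup>2)" unfolding q by (simp add: power2_eq_square)
    thus ?thesis using cancel by presburger
  qed
  have cancel2: "2 * b\<^sup>2 * y \<le> 2 * b\<^sup>2 * y' \<longleftrightarrow> y \<le> y'" for y y' using b by simp
  have e3: "a * (b * t - p)\<^sup>2 = 2 * b\<^sup>2 * (a / 2 * (t - p / b)\<^sup>2)" unfolding q by simp
  have s3: "a * (b * t - p)\<^sup>2 \<le> 2 * b\<^sup>2 * x \<longleftrightarrow> a / 2 * (t - p / b)\<^sup>2 \<le> x"
    unfolding e3 using cancel2 by presburger
  have s4: "2 * b\<^sup>2 * x \<le> a * (b * t - p)\<^sup>2 \<longleftrightarrow> x \<le> a / 2 * (t - p / b)\<^sup>2"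
    unfolding e3 using cancel2 by presburger
  have r1: "(x, t, p) \<in> cl1 a b" if "(x, t, p) \<in> region1 a b"
    using that by (auto simp: region1_def cl1_def)
  have r2: "(x, t, p) \<in> cl2 a b" if "(x, t, p) \<in> region2 a b"
  proof -
    have "- (b / 2) * (t - p / b)\<^sup>2 \<le> 0" using b by simp
    thus ?thesis using that unfolding cl2_def region2_def mem_Collect_eq case_prod_conv tb Un_iff s2
      by linarith
  qed
  have r3: "(x, t, p) \<in> cl3 a b" if "(x, t, p) \<in> region3 a b"
  proof -
    have "0 \<le> a / 2 * (t - p / b)\<^sup>2" using a by simp
    thus ?thesis using that unfolding cl3_def region3_def mem_Collect_eq case_prod_conv tb Un_iff s3
      by linarith
  qed
  have r4: "(x, t, p) \<in> cl4 a b" if "(x, t, p) \<in> region4 a b"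
    using that unfolding cl4_def region4_def mem_Collect_eq case_prod_conv tb s4 by linarith
  have r5: "(x, t, p) \<in> cl5 a b" if "(x, t, p) \<in> region5 a b"
    using that unfolding cl5_def region5_def mem_Collect_eq case_prod_conv tb s5 by linarith
  have p3: "piece3 x t p a b = pc3 x t p a b" if "(x, t, p) \<in> region3 a b"
  proof -
    have "0 \<le> x" using r3[OF that] by (simp add: cl3_def)
    hence "0 \<le> (b * t - p)\<^sup>2 + 2 * x * (a + 2 * b)" using a b by simp
    thus ?thesis unfolding piece3_def pc3_def by (simp add: powr_three_halves)
  qed
  have p4: "piece4 x t p a b = pc4 x t p a b" if "(x, t, p) \<in> region4 a b"
  proof -
    have "0 \<le> x" using r4[OF that] by (simp add: cl4_def)
    hence "0 \<le> 2 * x / a" using a by simp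
    thus ?thesis unfolding piece4_def pc4_def by (simp add: powr_three_halves)
  qed
  have p5: "piece5 x t p a b = pc5 x t p a b" if "(x, t, p) \<in> region5 a b"
  proof -
    have "x \<le> 0" using r5[OF that] by (simp add: cl5_def)
    hence "0 \<le> - 2 * x / b" using b by (simp add: divide_nonpos_pos)
    thus ?thesis unfolding piece5_def pc5_def by (simp add: powr_three_halves)
  qed
  show ?thesis
    using regions_cover[OF assms, of x a b] r1 r2 r3 r4 r5 p3 p4 p5
    unfolding V1_nonneg_def by (auto simp: vN_simps[OF a b])
qed

text \<open>The differential is one-sided at \<open>t = 0\<close> and at \<open>p = 0\<close>. The
  first restriction stays and serves the estimates up to the initial time; the second is removed by
  reflection.\<close>

lemma vN_deriv:
  assumes "0 \<le> t" "0 \<le> p"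
  shows "(vN a b has_derivative dform (vxN a b (x, t, p)) (- (vxN a b (x, t, p))\<^sup>2 / 2 - potential1 a b x)
     (vpN a b (x, t, p))) (at (x, t, p) within quadrant)"
proof -
  let ?z = "(x, t, p)"
  let ?D = "dform (vxN a b ?z) (- (vxN a b ?z)\<^sup>2 / 2 - potential1 a b x) (vpN a b ?z)"
  have pos: "h - potential1 a b x = h + a * x" if "0 \<le> x" for h using that by (simp add: potential1_def)
  have neg: "h - potential1 a b x = h - b * x" if "x \<le> 0" for h using that by (auto simp: potential1_def)
  note piece = has_derivative_within_closed_piece[OF _ _ bounded_linear_dform]
  have 1: "(vN a b has_derivative ?D) (at ?z within cl1 a b)"
  proof (rule piece[OF closed_cl(1) vN_simps(1)[OF a b]])
    assume z: "?z \<in> cl1 a b"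
    hence "0 \<le> p * t" "0 \<le> a / 2 * t\<^sup>2" "p * t + a / 2 * t\<^sup>2 \<le> x" using a by (auto simp: cl1_def)
    hence xx: "0 \<le> x" by linarith
    show "((\<lambda>(x, t, p). piece1 x t p a b) has_derivative ?D) (at ?z within cl1 a b)"
      unfolding vxN_simps(1)[OF a b z] vpN_simps(1)[OF a b z] split_conv pos[OF xx] by (rule deriv_piece1)
  qed
  have 2: "(vN a b has_derivative ?D) (at ?z within cl2 a b)"
  proof (rule piece[OF closed_cl(2) vN_simps(2)[OF a b]])
    assume z: "?z \<in> cl2 a b"
    hence xx: "x \<le> 0" by (auto simp: cl2_def)
    show "((\<lambda>(x, t, p). piece2 x t p a b) has_derivative ?D) (at ?z within cl2 a b)"
      unfolding vxN_simps(2)[OF a b z] vpN_simps(2)[OF a b z] split_conv neg[OF xx] by (rule deriv_piece2)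
  qed
  have 3: "(vN a b has_derivative ?D) (at ?z within cl3 a b)"
  proof (rule piece[OF closed_cl(3) vN_simps(3)[OF a b]])
    assume z: "?z \<in> cl3 a b"
    hence xx: "0 \<le> x" by (auto simp: cl3_def)
    show "((\<lambda>(x, t, p). pc3 x t p a b) has_derivative ?D) (at ?z within cl3 a b)"
      unfolding vxN_simps(3)[OF a b z] vpN_simps(3)[OF a b z] split_conv pos[OF xx] by (rule deriv_pc3[OF a b xx])
  qed
  have 4: "(vN a b has_derivative ?D) (at ?z within cl4 a b)"
  proof (rule piece[OF closed_cl(4) vN_simps(4)[OF a b]])
    assume z: "?z \<in> cl4 a b"
    hence xx: "0 \<le> x" by (auto simp: cl4_def)
    show "((\<lambda>(x, t, p). pc4 x t p a b) has_derivative ?D) (at ?z within cl4 a b)"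
      unfolding vxN_simps(4)[OF a b z] vpN_simps(4)[OF a b z] split_conv pos[OF xx] by (rule deriv_pc4[OF a b xx])
  qed
  have 5: "(vN a b has_derivative ?D) (at ?z within cl5 a b)"
  proof (rule piece[OF closed_cl(5) vN_simps(5)[OF a b]])
    assume z: "?z \<in> cl5 a b"
    hence xx: "x \<le> 0" by (auto simp: cl5_def)
    show "((\<lambda>(x, t, p). pc5 x t p a b) has_derivative ?D) (at ?z within cl5 a b)"
      unfolding vxN_simps(5)[OF a b z] vpN_simps(5)[OF a b z] split_conv neg[OF xx] by (rule deriv_pc5[OF a b xx])
  qed
  show ?thesis unfolding quadrant_eq[of a b]
    by (intro has_derivative_within_Un 1 2 3 4 5)
qed

lemma continuous_vxN: "continuous_on quadrant (vxN a b)"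
proof -
  have c: "a + 2 * b \<noteq> 0" using a b by simp
  have 1: "continuous_on (cl1 a b) (vxN a b)"
    by (rule continuous_on_eq[OF _ vxN_simps(1)[OF a b, symmetric]], unfold case_prod_beta gx3_def) (use a b in \<open>auto intro!: continuous_intros\<close>)
  have 2: "continuous_on (cl2 a b) (vxN a b)"
    by (rule continuous_on_eq[OF _ vxN_simps(2)[OF a b, symmetric]], unfold case_prod_beta gx3_def) (use a b in \<open>auto intro!: continuous_intros\<close>)
  have 3: "continuous_on (cl3 a b) (vxN a b)"
    by (rule continuous_on_eq[OF _ vxN_simps(3)[OF a b, symmetric]], unfold case_prod_beta gx3_def) (use a b in \<open>auto intro!: continuous_intros\<close>)
  have 4: "continuous_on (cl4 a b) (vxN a b)"
    by (rule continuous_on_eq[OF _ vxN_simps(4)[OF a b, symmetric]], unfold case_prod_beta gx3_def) (use a b in \<open>auto intro!: continuous_intros\<close>)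
  have 5: "continuous_on (cl5 a b) (vxN a b)"
    by (rule continuous_on_eq[OF _ vxN_simps(5)[OF a b, symmetric]], unfold case_prod_beta gx3_def) (use a b in \<open>auto intro!: continuous_intros\<close>)
  show ?thesis unfolding quadrant_eq[of a b]
    by (intro continuous_on_closed_Un closed_Un closed_cl 1 2 3 4 5)
qed

section \<open>Bounds for the velocity\<close>

lemma crossing_root_ge: "0 \<le> x \<Longrightarrow> \<bar>b * t - p\<bar> \<le> crossing_root x t p a b"
  using a b by (intro real_le_rsqrt) simp

lemma crossing_root_le:
  assumes "0 \<le> t" "0 \<le> p" "x \<le> p * t + a / 2 * t\<^sup>2"
  shows "crossing_root x t p a b \<le> (a + b) * t + p"
proof -
  have "crossing_root x t p a b \<le> crossing_root (p * t + a / 2 * t\<^sup>2) t p a b"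
    using assms(3) a b by (intro real_sqrt_le_mono add_mono order_refl mult_right_mono mult_left_mono) auto
  thus ?thesis unfolding root13[OF a b assms(1,2)] .
qed

text \<open>The acceleration of an optimal motion lies between \<open>- b\<close> and
  \<open>a\<close>, so its velocity moves away from \<open>p\<close> by at most these rates times
  \<open>t\<close>, wherever the motion ends.\<close>

lemma vxN_bounds:
  assumes "0 \<le> t" "0 \<le> p"
  shows "p - b * t \<le> vxN a b (x, t, p)" "vxN a b (x, t, p) \<le> p + a * t"
proof -
  have at: "0 \<le> a * t" "0 \<le> b * t" using assms a b by auto
  have c: "0 < a + 2 * b" using a b by simp
  have "p - b * t \<le> vxN a b (x, t, p) \<and> vxN a b (x, t, p) \<le> p + a * t"
    using cl_cover[OF assms, of x a b]
  proof (elim UnE)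
    assume "(x, t, p) \<in> cl1 a b" thus ?thesis using at by (simp add: vxN_simps[OF a b])
  next
    assume "(x, t, p) \<in> cl2 a b" thus ?thesis using at by (simp add: vxN_simps[OF a b])
  next
    assume z: "(x, t, p) \<in> cl3 a b"
    define S where "S = crossing_root x t p a b"
    have h: "0 \<le> x" "x \<le> p * t + a / 2 * t\<^sup>2" using z by (auto simp: cl3_def)
    have "(a + b) * (p - b * t) \<le> (a + b) * S" "(a + b) * S \<le> (a + b) * ((a + b) * t + p)"
      using a b crossing_root_ge[OF h(1), of t p] crossing_root_le[OF assms h(2)] unfolding S_def
      by (intro mult_left_mono; simp)+
    hence "(p - b * t) * (a + 2 * b) \<le> (a + b) * S - b * (b * t - p)"
      "(a + b) * S - b * (b * t - p) \<le> (p + a * t) * (a + 2 * b)"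
      by (simp_all add: algebra_simps)
    thus ?thesis unfolding vxN_simps(3)[OF a b z] gx3_def S_def using c
      by (simp add: pos_le_divide_eq pos_divide_le_eq)
  next
    assume z: "(x, t, p) \<in> cl4 a b"
    hence h: "p \<le> b * t" "0 \<le> x" "2 * b\<^sup>2 * x \<le> a * (b * t - p)\<^sup>2" by (auto simp: cl4_def)
    have "2 * b\<^sup>2 * x \<le> a * (b * t)\<^sup>2"
    proof -
      have "(b * t - p)\<^sup>2 \<le> (b * t)\<^sup>2" using h assms by (intro power_mono) auto
      hence "a * (b * t - p)\<^sup>2 \<le> a * (b * t)\<^sup>2" using a by simp
      thus ?thesis using h by simp
    qed
    hence "b\<^sup>2 * (2 * x) \<le> b\<^sup>2 * (a * t\<^sup>2)" by (simp add: power_mult_distrib mult_ac)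
    hence "2 * x \<le> a * t\<^sup>2" using b by simp
    hence "2 * x / a \<le> t\<^sup>2" using a by (simp add: field_simps)
    hence "sqrt (2 * x / a) \<le> t" using assms by (simp add: real_le_lsqrt)
    hence "a * sqrt (2 * x / a) \<le> a * t" using a by simp
    moreover have "0 \<le> a * sqrt (2 * x / a)" using a h by simp
    ultimately show ?thesis using h assms by (simp add: vxN_simps(4)[OF a b z])
  next
    assume z: "(x, t, p) \<in> cl5 a b"
    hence h: "p \<le> b * t" "x \<le> 0" "- (b * t - p)\<^sup>2 \<le> 2 * b * x" by (auto simp: cl5_def)
    have "- 2 * x / b = (- 2 * b * x) / b\<^sup>2" using b by (simp add: power2_eq_square)
    also have "\<dots> \<le> ((b * t - p) / b)\<^sup>2" using h(3) unfolding power_divide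
      by (intro divide_right_mono) auto
    finally have "sqrt (- 2 * x / b) \<le> (b * t - p) / b" using h b by (intro real_le_lsqrt) auto
    hence "b * sqrt (- 2 * x / b) \<le> b * t - p" using b by (simp add: field_simps)
    moreover have "0 \<le> b * sqrt (- 2 * x / b)" using b h by (simp add: divide_nonpos_pos)
    ultimately show ?thesis using h assms at by (simp add: vxN_simps(5)[OF a b z])
  qed
  thus "p - b * t \<le> vxN a b (x, t, p)" "vxN a b (x, t, p) \<le> p + a * t" by auto
qed

end

section \<open>Strict monotonicity of the starting point in p, and a lower bound for the
  value\<close>

context
  fixes a b :: real
  assumes a: "0 < a" and b: "0 < b"
begin

text \<open>On the third region the optimal trajectory starts below zero, crosses zero at time \<open>\<tau>\<close> with
  velocity \<open>w\<close> and then moves on for the remaining time \<open>\<sigma>\<close>; the derivative in \<open>p\<close> is its starting point.\<close>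

lemma cl3_crossing:
  assumes z: "(x, t, p) \<in> cl3 a b"
  defines "\<sigma> \<equiv> (b * t - p + crossing_root x t p a b) / (a + 2 * b)"
  defines "\<tau> \<equiv> t - \<sigma>"
  shows "0 \<le> \<sigma>" "0 \<le> \<tau>" "b * \<tau> \<le> p" "vpN a b (x, t, p) = - p * \<tau> + b * \<tau>\<^sup>2 / 2"
    "x = (p - b * \<tau>) * \<sigma> + a * \<sigma>\<^sup>2 / 2"
proof -
  define c where "c = a + 2 * b"
  have c: "c > 0" "a = c - 2 * b" using a b by (auto simp: c_def)
  define S where "S = crossing_root x t p a b"
  define q where "q = b * t - p"
  have h: "0 \<le> t" "0 \<le> p" "0 \<le> x" "x \<le> p * t + a / 2 * t\<^sup>2"
    "b * t \<le> p \<or> a * (b * t - p)\<^sup>2 \<le> 2 * b\<^sup>2 * x"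
    using z by (auto simp: cl3_def)
  have S: "\<bar>q\<bar> \<le> S" "S \<le> (a + b) * t + p"
    using crossing_root_ge[OF a b h(3)] crossing_root_le[OF a b h(1,2,4)] by (auto simp: S_def q_def)
  have S2: "S\<^sup>2 = q\<^sup>2 + 2 * x * c" using h a b unfolding S_def q_def c_def by simp
  have \<sigma>: "\<sigma> = (q + S) / c" unfolding \<sigma>_def q_def S_def c_def ..
  have cs: "c * \<sigma> = q + S" using c by (simp add: \<sigma>)
  have p: "p = b * t - q" by (simp add: q_def)
  show "0 \<le> \<sigma>" using S c by (simp add: \<sigma>)
  have "q + S \<le> c * t" using S unfolding q_def c_def by (simp add: algebra_simps)
  hence "\<sigma> \<le> t" using c unfolding \<sigma> by (simp add: pos_divide_le_eq mult.commute)
  thus "0 \<le> \<tau>" by (simp add: \<tau>_def)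
  have w: "p - b * \<tau> = S - (a + b) * \<sigma>"
    using cs unfolding p \<tau>_def c_def by (simp add: algebra_simps)
  \<comment> \<open>Up to the factor \<open>c\<close> this says that the velocity
    \<open>p - b * \<tau>\<close> at the crossing is nonnegative; it is here that the lower boundary
    of the third region enters.\<close>
  have "(a + b) * q \<le> b * S"
  proof (cases "q \<le> 0")
    case True
    hence "(a + b) * q \<le> 0" using a b by (simp add: mult_nonneg_nonpos)
    moreover have "0 \<le> b * S" using S b by simp
    ultimately show ?thesis by linarith
  next
    case False
    hence "a * q\<^sup>2 \<le> 2 * b\<^sup>2 * x" using h by (auto simp: q_def)
    hence "c * (a * q\<^sup>2) \<le> c * (2 * b\<^sup>2 * x)" using c by simp
    moreover have "(b * S)\<^sup>2 - ((a + b) * q)\<^sup>2 = c * (2 * b\<^sup>2 * x) - c * (a * q\<^sup>2)"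
      unfolding power_mult_distrib S2 c_def by (simp add: power2_eq_square algebra_simps)
    ultimately have "((a + b) * q)\<^sup>2 \<le> (b * S)\<^sup>2" by linarith
    moreover have "0 \<le> S" using S by linarith
    hence "0 \<le> b * S" using b by simp
    ultimately show ?thesis by (rule power2_le_imp_le)
  qed
  hence "0 \<le> b * S - (a + b) * q" by simp
  also have "b * S - (a + b) * q = c * S - (a + b) * (c * \<sigma>)"
    unfolding cs by (simp add: c_def algebra_simps)
  also have "\<dots> = c * (p - b * \<tau>)" unfolding w by (simp add: algebra_simps)
  finally show "b * \<tau> \<le> p" using c by (simp add: zero_le_mult_iff)
  have S': "S = c * \<sigma> - q" using cs by simp
  have bx: "b / c * x = b * \<sigma> * (S - q) / (2 * c)"
  proof -
    have "2 * c * x = (S + q) * (S - q)" using S2 by (simp add: power2_eq_square algebra_simps)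
    also have "\<dots> = c * \<sigma> * (S - q)" using cs by (simp add: algebra_simps)
    finally have "2 * x = \<sigma> * (S - q)" using c(1) by simp
    hence x2: "x = \<sigma> * (S - q) / 2" by simp
    show ?thesis by (subst x2) simp
  qed
  have "vpN a b (x, t, p) = - ((a + b) / c\<^sup>2) * q * (q + S) + b / c * x + b / 2 * t\<^sup>2 - p * t"
    unfolding vpN_simps(3)[OF a b z] by (simp add: gp3_def q_def S_def c_def)
  also have "\<dots> = - ((a + b) / c) * q * \<sigma> + b * \<sigma> * (c * \<sigma> - 2 * q) / (2 * c) + b / 2 * t\<^sup>2 - p * t"
    unfolding bx cs[symmetric] S' using c(1) by (simp add: power2_eq_square)
  also have "\<dots> = - p * \<tau> + b * \<tau>\<^sup>2 / 2"
    using c(1) unfolding \<tau>_def p by (simp add: c(2) field_simps power2_eq_square)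
  finally show "vpN a b (x, t, p) = - p * \<tau> + b * \<tau>\<^sup>2 / 2" .
  have "2 * c * x = (S - q) * (S + q)" using S2 by (simp add: power2_eq_square algebra_simps)
  also have "\<dots> = (c * \<sigma> - 2 * q) * (c * \<sigma>)" unfolding S' by simp
  finally have "2 * x = (c * \<sigma> - 2 * q) * \<sigma>" using c(1) by simp
  thus "x = (p - b * \<tau>) * \<sigma> + a * \<sigma>\<^sup>2 / 2"
    unfolding p \<tau>_def c_def by (simp add: power2_eq_square field_simps)
qed

text \<open>The start \<open>- p * \<tau> + b * \<tau>\<^sup>2 / 2\<close> decreases in
  \<open>p\<close>, and it decreases in \<tau> as long as \<open>b * \<tau> \<le> p\<close>. Since
  \<tau> itself is nondecreasing in \<open>p\<close>, both effects have the same sign.\<close>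

lemma vpN_anti_cl3:
  assumes z: "(x, t, p) \<in> cl3 a b" "(x, t, p') \<in> cl3 a b" and pp: "p < p'" and t: "0 < t"
  shows "vpN a b (x, t, p') < vpN a b (x, t, p)"
proof -
  define c where "c = a + 2 * b"
  have c: "c > 0" using a b by (auto simp: c_def)
  define \<sigma> where "\<sigma> p = (b * t - p + crossing_root x t p a b) / (a + 2 * b)" for p
  define \<tau> where "\<tau> p = t - \<sigma> p" for p
  note 1 = cl3_crossing[OF z(1), folded \<sigma>_def, folded \<tau>_def]
  note 2 = cl3_crossing[OF z(2), folded \<sigma>_def, folded \<tau>_def]
  have x: "0 \<le> x" using z by (simp add: cl3_def)
  have "\<sigma> p' \<le> \<sigma> p"
  proof -
    define q q' where "q = b * t - p" and "q' = b * t - p'"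
    \<comment> \<open>The map \<open>q \<mapsto> sqrt (q\<^sup>2 + K)\<close> is 1-Lipschitz, so
      adding \<open>q\<close> to it gives a nondecreasing function of \<open>q\<close>.\<close>
    have lip: "sqrt (q'\<^sup>2 + K) \<le> sqrt (q\<^sup>2 + K) + (q - q')" if "K \<ge> 0" for K
    proof (rule real_le_lsqrt)
      have r: "\<bar>q\<bar> \<le> sqrt (q\<^sup>2 + K)" using that by (intro real_le_rsqrt) simp
      have d: "q' \<le> q" using pp by (simp add: q_def q'_def)
      show "0 \<le> sqrt (q\<^sup>2 + K) + (q - q')" using r d by linarith
      have "0 \<le> 2 * (sqrt (q\<^sup>2 + K) + q) * (q - q')" using r d by (intro mult_nonneg_nonneg) auto
      moreover have "(sqrt (q\<^sup>2 + K) + (q - q'))\<^sup>2 = q\<^sup>2 + K + 2 * sqrt (q\<^sup>2 + K) * (q - q') + (q - q')\<^sup>2"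
        using that by (simp add: power2_sum)
      ultimately show "q'\<^sup>2 + K \<le> (sqrt (q\<^sup>2 + K) + (q - q'))\<^sup>2"
        by (simp add: power2_eq_square algebra_simps)
    qed
    have "0 \<le> 2 * x * (a + 2 * b)" using x a b by simp
    from lip[OF this] show ?thesis using c unfolding \<sigma>_def q_def q'_def c_def
      by (intro divide_right_mono) auto
  qed
  hence ord: "\<tau> p \<le> \<tau> p'" by (simp add: \<tau>_def)
  have d1: "- p' * \<tau> p' + b * (\<tau> p')\<^sup>2 / 2 - (- p' * \<tau> p + b * (\<tau> p)\<^sup>2 / 2)
      = (\<tau> p' - \<tau> p) * (- p' + b * (\<tau> p + \<tau> p') / 2)"
    by (simp add: power2_eq_square field_simps)
  have "b * \<tau> p \<le> b * \<tau> p'" using ord b by simp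
  show ?thesis
  proof (cases "\<tau> p = 0")
    case True
    \<comment> \<open>With \<open>\<tau> p = 0\<close> a change of the factor \<open>p\<close> has
      no effect, so strictness must come from the crossing time: two motions starting at zero with
      different \<open>p\<close> cannot both end at \<open>x\<close>.\<close>
    have "\<tau> p' \<noteq> 0"
    proof
      assume "\<tau> p' = 0"
      hence "x = p' * t + a * t\<^sup>2 / 2" "x = p * t + a * t\<^sup>2 / 2" using 1(5) 2(5) True by (auto simp: \<tau>_def)
      hence "p * t = p' * t" by linarith
      thus False using pp t by simp
    qed
    hence p': "0 < \<tau> p'" using 2(2) by simp
    hence "b * \<tau> p' > 0" using b by simp
    hence "- p' + b * \<tau> p' / 2 < 0" using 2(3) by linarith
    hence "\<tau> p' * (- p' + b * \<tau> p' / 2) < 0" using p' by (simp add: mult_pos_neg)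
    thus ?thesis unfolding 1(4) 2(4) True by (simp add: power2_eq_square field_simps)
  next
    case False
    hence "0 < \<tau> p" using 1(2) by simp
    hence "p * \<tau> p < p' * \<tau> p" using pp by simp
    moreover have "(\<tau> p' - \<tau> p) * (- p' + b * (\<tau> p + \<tau> p') / 2) \<le> 0"
      using ord \<open>b * \<tau> p \<le> b * \<tau> p'\<close> 2(3) by (intro mult_nonneg_nonpos) (auto simp: algebra_simps)
    ultimately show ?thesis unfolding 1(4) 2(4) using d1 by linarith
  qed
qed

text \<open>For fixed \<open>x\<close> and \<open>t\<close> the regions 1, 4 and 5 are downward
  closed in \<open>p\<close>, so a growing \<open>p\<close> can only pass from 1 or 4 into 3, or
  from 5 into 2. Within one region the formulas decide; only these three transitions need an
  argument.\<close>

lemma vpN_strict_antimono: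
  assumes t: "0 < t" and p: "0 \<le> p" "p < p'"
  shows "vpN a b (x, t, p') < vpN a b (x, t, p)"
proof -
  note V = vpN_simps[OF a b]
  have pt: "p * t < p' * t" and sq: "p\<^sup>2 < p'\<^sup>2" using p t by (auto intro: power_strict_mono)
  have t0: "0 \<le> t" and p'0: "0 \<le> p'" using t p by auto
  have at: "0 < a / 2 * t\<^sup>2" using a t by simp
  have c1: ?thesis if "(x, t, p) \<in> cl1 a b" "(x, t, p') \<in> cl1 a b"
    using that pt by (simp add: V(1))
  have c2: ?thesis if "(x, t, p) \<in> cl2 a b" "(x, t, p') \<in> cl2 a b"
    using that pt by (simp add: V(2))
  have c4: ?thesis if "(x, t, p) \<in> cl4 a b" "(x, t, p') \<in> cl4 a b"
    using that sq b by (simp add: V(4) divide_strict_right_mono)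
  have c5: ?thesis if "(x, t, p) \<in> cl5 a b" "(x, t, p') \<in> cl5 a b"
    using that sq b by (simp add: V(5) divide_strict_right_mono)
  have sqm: "(b * t - p')\<^sup>2 \<le> (b * t - p)\<^sup>2" if "p' \<le> b * t" using that p by (intro power_mono) auto
  have d1: "(x, t, p) \<in> cl1 a b" if "(x, t, p') \<in> cl1 a b" using that p pt by (auto simp: cl1_def)
  have d4: "(x, t, p) \<in> cl4 a b" if "(x, t, p') \<in> cl4 a b"
  proof -
    have h: "p' \<le> b * t" "2 * b\<^sup>2 * x \<le> a * (b * t - p')\<^sup>2" "0 \<le> x" using that by (auto simp: cl4_def)
    have "a * (b * t - p')\<^sup>2 \<le> a * (b * t - p)\<^sup>2" using sqm[OF h(1)] a by simp
    thus ?thesis using h p t by (auto simp: cl4_def)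
  qed
  have d5: "(x, t, p) \<in> cl5 a b" if "(x, t, p') \<in> cl5 a b"
  proof -
    have h: "p' \<le> b * t" "- (b * t - p')\<^sup>2 \<le> 2 * b * x" "x \<le> 0" using that by (auto simp: cl5_def)
    have "- (b * t - p)\<^sup>2 \<le> 2 * b * x" "p \<le> b * t" using sqm[OF h(1)] h p by linarith+
    thus ?thesis using h p t by (simp add: cl5_def)
  qed
  show ?thesis
  proof (cases "0 \<le> x")
    case True
    have lo: "(x, t, r) \<in> cl1 a b \<union> cl3 a b \<union> cl4 a b" if "0 \<le> r" for r
      using True that t by (auto simp: cl1_def cl3_def cl4_def)
    show ?thesis
    proof (cases "(x, t, p') \<in> cl1 a b \<union> cl4 a b")
      case True
      thus ?thesis using d1 d4 c1 c4 by blast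
    next
      case False
      hence z': "(x, t, p') \<in> cl3 a b" using lo[OF p'0] by blast
      show ?thesis
      proof (cases "(x, t, p) \<in> cl3 a b")
        case True
        thus ?thesis using vpN_anti_cl3[OF True z' p(2) t] by blast
      next
        case n3: False
        show ?thesis
        proof (cases "(x, t, p) \<in> cl1 a b")
          case True
          define \<sigma> where "\<sigma> = (b * t - p' + crossing_root x t p' a b) / (a + 2 * b)"
          define \<tau> where "\<tau> = t - \<sigma>"
          note 2 = cl3_crossing[OF z', folded \<sigma>_def, folded \<tau>_def]
          \<comment> \<open>The start is nonnegative in the first region and at most zero in the
            third. If it is zero in the third, then \<open>\<tau> = 0\<close>, and the two
            parameters are compared through \<open>p * t < p' * t\<close>.\<close>
          have h: "p * t + a / 2 * t\<^sup>2 \<le> x" using True by (simp add: cl1_def)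
          have e: "vpN a b (x, t, p) = x - p * t - a / 2 * t\<^sup>2" using True by (simp add: V(1))
          show ?thesis
          proof (cases "\<tau> = 0")
            case True
            hence "x = p' * t + a * t\<^sup>2 / 2" using 2(5) by (simp add: \<tau>_def)
            thus ?thesis unfolding e 2(4) using True pt by simp
          next
            case False
            hence \<tau>: "0 < \<tau>" using 2 by simp
            hence "0 < b * \<tau>" using b by simp
            hence "\<tau> * (- p' + b * \<tau> / 2) < 0" using 2(3) \<tau> by (intro mult_pos_neg) linarith+
            thus ?thesis unfolding e 2(4) using h by (simp add: power2_eq_square field_simps)
          qed
        next
          case False
          hence z: "(x, t, p) \<in> cl4 a b" using lo[OF p(1)] n3 by blast
          define s where "s = sqrt (2 * x / a)"
          \<comment> \<open>The parameter at which the motion ending at \<open>x\<close> passes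
            through zero without resting. There regions 3 and 4 meet, and it separates
            \<open>p\<close> from \<open>p'\<close>.\<close>
          define r where "r = b * t - b * s"
          have s: "0 \<le> s" "s\<^sup>2 = 2 * x / a" using True a \<open>0 \<le> x\<close> by (auto simp: s_def)
          have xs: "2 * x = a * s\<^sup>2" using s a by simp
          have h: "p \<le> b * t" "2 * b\<^sup>2 * x \<le> a * (b * t - p)\<^sup>2" using z by (auto simp: cl4_def)
          have "a * (b * s)\<^sup>2 = 2 * b\<^sup>2 * x" unfolding power_mult_distrib using xs by simp
          hence eq: "a * (b * t - r)\<^sup>2 = 2 * b\<^sup>2 * x" by (simp add: r_def)
          hence "(b * t - r)\<^sup>2 \<le> (b * t - p)\<^sup>2" using h(2) a by (metis mult_le_cancel_left_pos)
          hence "b * t - r \<le> b * t - p" using h by (intro power2_le_imp_le[of "b * t - r"]) auto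
          hence pr: "p \<le> r" by simp
          have rp': "r \<le> p'"
          proof (cases "b * t \<le> p'")
            case True
            have "0 \<le> b * s" using b s by simp
            thus ?thesis using True by (simp add: r_def)
          next
            case False
            hence "a * (b * t - p')\<^sup>2 \<le> 2 * b\<^sup>2 * x" using z' by (simp add: cl3_def)
            hence "(b * t - p')\<^sup>2 \<le> (b * t - r)\<^sup>2" unfolding eq[symmetric] using a by simp
            moreover have "0 \<le> b * t - r" using b s by (simp add: r_def)
            ultimately have "b * t - p' \<le> b * t - r" by (intro power2_le_imp_le[of "b * t - p'"])
            thus ?thesis by simp
          qed
          have rbt: "r \<le> b * t" using b s by (simp add: r_def)
          have r0: "0 \<le> r" using pr p by simp
          have z4: "(x, t, r) \<in> cl4 a b" using rbt r0 t \<open>0 \<le> x\<close> eq by (simp add: cl4_def)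
          have "x \<le> r * t + a / 2 * t\<^sup>2"
          proof -
            have "b * s \<le> b * t" using r0 by (simp add: r_def)
            hence "s \<le> t" using b by simp
            hence "s\<^sup>2 \<le> t\<^sup>2" using s by (intro power_mono) auto
            hence "a * s\<^sup>2 \<le> a * t\<^sup>2" using a by simp
            hence "x \<le> a / 2 * t\<^sup>2" using xs by simp
            moreover have "0 \<le> r * t" using r0 t by simp
            ultimately show ?thesis by linarith
          qed
          hence z3: "(x, t, r) \<in> cl3 a b" using r0 t \<open>0 \<le> x\<close> eq by (simp add: cl3_def)
          have "vpN a b (x, t, r) \<le> vpN a b (x, t, p)"
          proof -
            have "p\<^sup>2 \<le> r\<^sup>2" using pr p by (intro power_mono) auto
            thus ?thesis using z z4 b by (simp add: V(4) divide_right_mono)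
          qed
          moreover have "vpN a b (x, t, p') \<le> vpN a b (x, t, r)"
            using vpN_anti_cl3[OF z3 z' _ t] rp' by (cases "r = p'") auto
          moreover have "vpN a b (x, t, r) < vpN a b (x, t, p)"
          proof -
            have "p < r" using pr n3 z3 by (cases "p = r") auto
            hence "p\<^sup>2 < r\<^sup>2" using p by (intro power_strict_mono) auto
            thus ?thesis using z z4 b by (simp add: V(4) divide_strict_right_mono)
          qed
          ultimately show ?thesis by linarith
        qed
      qed
    qed
  next
    case False
    hence x: "x < 0" by simp
    have lo: "(x, t, r) \<in> cl2 a b \<union> cl5 a b" if "0 \<le> r" for r
      using x that t by (auto simp: cl2_def cl5_def)
    show ?thesis
    proof (cases "(x, t, p') \<in> cl5 a b \<or> (x, t, p) \<in> cl2 a b")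
      case True
      thus ?thesis using d5 c5 c2 lo[OF p'0] by blast
    next
      case False
      hence z': "(x, t, p') \<in> cl2 a b" and z: "(x, t, p) \<in> cl5 a b" using lo p p'0 by blast+
      have e: "vpN a b (x, t, p') = x + ((b * t - p')\<^sup>2 - p'\<^sup>2) / (2 * b)"
        using b by (simp add: V(2)[OF z'] field_simps power2_eq_square)
      show ?thesis
      proof (cases "b * t \<le> p'")
        case True
        have pb: "p \<le> b * t" using z by (simp add: cl5_def)
        \<comment> \<open>Only a weak inequality is proved here; strictness comes from
          \<open>x < 0\<close>.\<close>
        have "p * p \<le> b * t * (b * t)" using pb p by (intro mult_mono) auto
        moreover have "b * t * (b * t) \<le> b * t * (2 * p' - b * t)" using True b t by (intro mult_left_mono) auto
        ultimately have "p * p \<le> b * t * (2 * p' - b * t)" by (rule order.trans)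
        hence "p * p / (2 * b) \<le> b * t * (2 * p' - b * t) / (2 * b)" using b by (intro divide_right_mono) auto
        also have "\<dots> = t * p' - b / 2 * t\<^sup>2" using b by (simp add: field_simps power2_eq_square)
        finally show ?thesis unfolding V(2)[OF z'] V(5)[OF z] using x by (simp add: power2_eq_square mult.commute)
      next
        case False
        hence "2 * b * x \<le> - (b * t - p')\<^sup>2" using z' by (simp add: cl2_def)
        hence "x \<le> - (b * t - p')\<^sup>2 / (2 * b)" using b by (simp add: field_simps)
        hence "vpN a b (x, t, p') \<le> - p'\<^sup>2 / (2 * b)" unfolding e by (simp add: diff_divide_distrib)
        also have "\<dots> < - p\<^sup>2 / (2 * b)" using sq b by (simp add: divide_strict_right_mono)
        finally show ?thesis unfolding V(5)[OF z] by simp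
      qed
    qed
  qed
qed

text \<open>For large \<open>\<bar>x\<bar>\<close> only the polynomial pieces 1 and 2 occur, and
  they differ from \<open>p * x\<close> by something bounded below; the remaining \<open>x\<close>
  form a compact set.\<close>

lemma vN_lower:
  assumes "0 \<le> p"
  shows "\<exists>C. \<forall>x t. 0 \<le> t \<longrightarrow> t \<le> T \<longrightarrow> C \<le> vN a b (x, t, p) - p * x"
proof (cases "0 \<le> T")
  case True
  \<comment> \<open>Exceeds, for all times up to \<open>T\<close>, both the lower edge of region 1
    and the depth \<open>(b * t - p)\<^sup>2 / (2 * b)\<close> of region 5.\<close>
  define X where "X = p * T + a / 2 * T\<^sup>2 + (b * T + p)\<^sup>2 / (2 * b)"
  define K where "K = {-X..X} \<times> {0..T} \<times> {p}"
  have Kq: "K \<subseteq> quadrant" using assms by (auto simp: K_def quadrant_def)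
  have "continuous_on quadrant (vN a b)"
  proof (rule has_derivative_continuous_on)
    fix z :: "real \<times> real \<times> real" assume z: "z \<in> quadrant"
    obtain x t p where e: "z = (x, t, p)" using prod_cases3 by blast
    show "(vN a b has_derivative dform (vxN a b z) (- (vxN a b z)\<^sup>2 / 2 - potential1 a b (fst z)) (vpN a b z)) (at z within quadrant)"
      using vN_deriv[OF a b, of t p x] z unfolding e by (simp add: quadrant_def)
  qed
  hence "continuous_on K (\<lambda>z. vN a b z - p * fst z)" using Kq by (intro continuous_intros) (rule continuous_on_subset)
  moreover have "compact K" unfolding K_def by (intro compact_Times compact_Icc finite_imp_compact) auto
  ultimately have "compact ((\<lambda>z. vN a b z - p * fst z) ` K)" by (rule compact_continuous_image)
  then obtain B where B: "\<And>z. z \<in> K \<Longrightarrow> \<bar>vN a b z - p * fst z\<bar> \<le> B"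
    unfolding compact_eq_bounded_closed bounded_iff by force
  have "min (- \<bar>B\<bar>) (- p\<^sup>2 * T - b\<^sup>2 * T ^ 3) \<le> vN a b (x, t, p) - p * x" if t: "0 \<le> t" "t \<le> T" for x t
  proof -
    have t3: "t ^ 3 \<le> T ^ 3" "p\<^sup>2 * t \<le> p\<^sup>2 * T" "0 \<le> p\<^sup>2 * t" "0 \<le> t ^ 3" using t by (auto intro: power_mono mult_left_mono)
    have b3: "b\<^sup>2 * t ^ 3 \<le> b\<^sup>2 * T ^ 3" "0 \<le> b\<^sup>2 * t ^ 3" "0 \<le> b / 2 * p * t\<^sup>2" using t3 b assms t by (auto intro: mult_left_mono)
    have X: "p * t + a / 2 * t\<^sup>2 \<le> X" "(b * t - p)\<^sup>2 / (2 * b) \<le> X"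
    proof -
      have "p * t + a / 2 * t\<^sup>2 \<le> p * T + a / 2 * T\<^sup>2"
        using t assms a by (intro add_mono mult_left_mono power_mono) auto
      moreover have "0 \<le> (b * T + p)\<^sup>2 / (2 * b)" using b by simp
      ultimately show "p * t + a / 2 * t\<^sup>2 \<le> X" unfolding X_def by linarith
      have bt: "b * t \<le> b * T" "0 \<le> b * t" using t b by auto
      hence "\<bar>b * t - p\<bar> \<le> \<bar>b * T + p\<bar>" using assms by linarith
      hence "(b * t - p)\<^sup>2 \<le> (b * T + p)\<^sup>2" by (simp only: abs_le_square_iff)
      hence "(b * t - p)\<^sup>2 / (2 * b) \<le> (b * T + p)\<^sup>2 / (2 * b)" using b by (intro divide_right_mono) auto
      moreover have "0 \<le> p * T" "0 \<le> a / 2 * T\<^sup>2" using assms a True by auto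
      ultimately show "(b * t - p)\<^sup>2 / (2 * b) \<le> X" unfolding X_def by linarith
    qed
    have mid: ?thesis if "- X \<le> x" "x \<le> X"
    proof -
      have "(x, t, p) \<in> K" using that t unfolding K_def by auto
      hence "\<bar>vN a b (x, t, p) - p * x\<bar> \<le> B" using B[of "(x, t, p)"] by simp
      thus ?thesis by linarith
    qed
    consider "x < - X" | "- X \<le> x" "x \<le> X" | "X < x" by linarith
    thus ?thesis
    proof cases
      case 1
      have x0: "x < 0" "x \<le> - ((b * t - p)\<^sup>2 / (2 * b))" using 1 X b
        by (smt (verit) zero_le_divide_iff zero_le_power2)+
      hence "2 * b * x \<le> 2 * b * - ((b * t - p)\<^sup>2 / (2 * b))" using b by (intro mult_left_mono) auto
      hence "2 * b * x \<le> - (b * t - p)\<^sup>2" using b by simp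
      hence z: "(x, t, p) \<in> cl2 a b" using x0 t assms by (simp add: cl2_def)
      have "b * t * x \<le> 0" using x0 b t by (simp add: mult_nonneg_nonpos)
      thus ?thesis unfolding vN_simps(2)[OF a b z] split_conv piece2_def using t3 b3 by linarith
    next
      case 2 thus ?thesis by (rule mid)
    next
      case 3
      hence h: "p * t + a / 2 * t\<^sup>2 \<le> x" using X by linarith
      hence z: "(x, t, p) \<in> cl1 a b" using t assms by (simp add: cl1_def)
      \<comment> \<open>In region 1 the term \<open>a * t * x\<close> outweighs the negative terms
        of \<open>piece1\<close> in \<open>a\<close>: \<open>a * p * t\<^sup>2\<close> against half
        of it, and \<open>a\<^sup>2 / 2 * t ^ 3\<close> against a third of it.\<close>
      have "a * t * (p * t + a / 2 * t\<^sup>2) \<le> a * t * x" using h a t by (intro mult_left_mono) auto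
      moreover have "a * t * (p * t + a / 2 * t\<^sup>2) = a * p * t\<^sup>2 + a\<^sup>2 / 2 * t ^ 3"
        by (simp add: power2_eq_square power3_eq_cube field_simps)
      moreover have "0 \<le> a * p * t\<^sup>2" "0 \<le> a\<^sup>2 * t ^ 3" using a assms t by auto
      moreover have "a / 2 * p * t\<^sup>2 = a * p * t\<^sup>2 / 2" "a\<^sup>2 / 6 * t ^ 3 = a\<^sup>2 * t ^ 3 / 6" "a\<^sup>2 / 2 * t ^ 3 = a\<^sup>2 * t ^ 3 / 2" by simp_all
      ultimately show ?thesis unfolding vN_simps(1)[OF a b z] split_conv piece1_def using t3 b3 by linarith
    qed
  qed
  thus ?thesis by blast
next
  case False
  thus ?thesis by (meson order.trans)
qed

end

section \<open>Reflection to negative p\<close>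

definition vx :: "real \<Rightarrow> real \<Rightarrow> real \<Rightarrow> real \<Rightarrow> real \<Rightarrow> real" where
  "vx x t p a b = (if p \<ge> 0 then vxN a b (x, t, p) else - vxN b a (- x, t, - p))"

definition vp :: "real \<Rightarrow> real \<Rightarrow> real \<Rightarrow> real \<Rightarrow> real \<Rightarrow> real" where
  "vp x t p a b = (if p \<ge> 0 then vpN a b (x, t, p) else - vpN b a (- x, t, - p))"

text \<open>At \<open>p = 0\<close> the third region degenerates, and the reflection with
  \<open>a\<close> and \<open>b\<close> exchanged swaps region 1 with 2 and region 4 with 5. Both
  definitions therefore agree on the seam.\<close>

lemma mirror_zero_nonneg:
  assumes a: "0 < a" and b: "0 < b" and t: "0 \<le> t" and x: "0 \<le> x"
  shows "vN a b (x, t, 0) = vN b a (- x, t, 0)" "vxN a b (x, t, 0) = - vxN b a (- x, t, 0)"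
    "vpN a b (x, t, 0) = - vpN b a (- x, t, 0)"
proof -
  have "vN a b (x, t, 0) = vN b a (- x, t, 0) \<and> vxN a b (x, t, 0) = - vxN b a (- x, t, 0) \<and>
    vpN a b (x, t, 0) = - vpN b a (- x, t, 0)"
  proof (cases "a / 2 * t\<^sup>2 \<le> x")
    case True
    hence z: "(x, t, 0) \<in> cl1 a b" using t by (simp add: cl1_def)
    have "2 * a * (a / 2 * t\<^sup>2) \<le> 2 * a * x" using True a by (intro mult_left_mono) auto
    hence z': "(- x, t, 0) \<in> cl2 b a" using t x by (simp add: cl2_def power_mult_distrib power2_eq_square mult_ac)
    show ?thesis by (simp add: vN_simps(1)[OF a b z] vxN_simps(1)[OF a b z] vpN_simps(1)[OF a b z]
       vN_simps(2)[OF b a z'] vxN_simps(2)[OF b a z'] vpN_simps(2)[OF b a z'] piece1_def piece2_def)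
  next
    case False
    hence "b\<^sup>2 * (2 * x) \<le> b\<^sup>2 * (a * t\<^sup>2)" by (intro mult_left_mono) auto
    hence z: "(x, t, 0) \<in> cl4 a b" using t x b by (simp add: cl4_def power_mult_distrib mult_ac)
    have "a * (2 * x) \<le> a * (a * t\<^sup>2)" using False a by (intro mult_left_mono) auto
    hence z': "(- x, t, 0) \<in> cl5 b a" using t x a by (simp add: cl5_def power_mult_distrib power2_eq_square mult_ac)
    show ?thesis by (simp add: vN_simps(4)[OF a b z] vxN_simps(4)[OF a b z] vpN_simps(4)[OF a b z]
       vN_simps(5)[OF b a z'] vxN_simps(5)[OF b a z'] vpN_simps(5)[OF b a z'] pc4_def pc5_def)
  qed
  thus "vN a b (x, t, 0) = vN b a (- x, t, 0)" "vxN a b (x, t, 0) = - vxN b a (- x, t, 0)"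
    "vpN a b (x, t, 0) = - vpN b a (- x, t, 0)" by auto
qed

lemma mirror_zero:
  assumes "0 < a" "0 < b" "0 \<le> t"
  shows "vN a b (x, t, 0) = vN b a (- x, t, 0)" "vxN a b (x, t, 0) = - vxN b a (- x, t, 0)"
    "vpN a b (x, t, 0) = - vpN b a (- x, t, 0)"
proof -
  have "vN a b (x, t, 0) = vN b a (- x, t, 0) \<and> vxN a b (x, t, 0) = - vxN b a (- x, t, 0) \<and>
    vpN a b (x, t, 0) = - vpN b a (- x, t, 0)"
  proof (cases "0 \<le> x")
    case True
    show ?thesis using mirror_zero_nonneg[OF assms True] by blast
  next
    case False
    hence "0 \<le> - x" by simp
    from mirror_zero_nonneg[OF assms(2,1,3) this] show ?thesis by simp
  qed
  thus "vN a b (x, t, 0) = vN b a (- x, t, 0)" "vxN a b (x, t, 0) = - vxN b a (- x, t, 0)"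
    "vpN a b (x, t, 0) = - vpN b a (- x, t, 0)" by auto
qed

context
  fixes a b :: real
  assumes a: "0 < a" and b: "0 < b"
begin

lemma V1_eq_nonneg: "0 \<le> t \<Longrightarrow> 0 \<le> p \<Longrightarrow> V1 x t p a b = vN a b (x, t, p)"
  using V1_nonneg_eq[OF a b] by (simp add: V1_def)

lemma V1_eq_nonpos: "0 \<le> t \<Longrightarrow> p \<le> 0 \<Longrightarrow> V1 x t p a b = vN b a (- x, t, - p)"
  using V1_nonneg_eq[OF b a] V1_nonneg_eq[OF a b] mirror_zero(1)[OF a b] by (cases "p = 0") (auto simp: V1_def)

lemma vx_eq_nonpos: "0 \<le> t \<Longrightarrow> p \<le> 0 \<Longrightarrow> vx x t p a b = - vxN b a (- x, t, - p)"
  using mirror_zero(2)[OF a b] by (cases "p = 0") (auto simp: vx_def)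

lemma vp_eq_nonpos: "0 \<le> t \<Longrightarrow> p \<le> 0 \<Longrightarrow> vp x t p a b = - vpN b a (- x, t, - p)"
  using mirror_zero(3)[OF a b] by (cases "p = 0") (auto simp: vp_def)

lemma potential1_mirror: "potential1 b a (- x) = potential1 a b x"
  by (simp add: potential1_def)

lemma half_space_split:
  "{(x, t, p). 0 \<le> t} = quadrant \<union> {(x::real, t::real, p::real). 0 \<le> t \<and> p \<le> 0}"
  by (auto simp: quadrant_def)

text \<open>Gluing along \<open>p = 0\<close>: on the lower half the chain rule with the reflection
  applies. Velocity and starting point change sign, while the squared velocity and the potential do
  not.\<close>

lemma V1_deriv:
  assumes t: "0 \<le> t"
  shows "((\<lambda>(x, t, p). V1 x t p a b) has_derivative
     dform (vx x t p a b) (- (vx x t p a b)\<^sup>2 / 2 - potential1 a b x) (vp x t p a b))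
     (at (x, t, p) within {(x, t, p). 0 \<le> t})"
    (is "(?V has_derivative ?D) _")
proof -
  let ?N = "{(x::real, t::real, p::real). 0 \<le> t \<and> p \<le> 0}"
  let ?\<rho> = "\<lambda>(x::real, t::real, p::real). (- x, t, - p)"
  have cl: "closed quadrant" "closed ?N" unfolding quadrant_def case_prod_beta
    by (intro closed_Collect_conj closed_Collect_le continuous_intros)+
  have 1: "(?V has_derivative ?D) (at (x, t, p) within quadrant)"
  proof (rule has_derivative_within_closed_piece[OF cl(1) _ bounded_linear_dform])
    show "?V w = vN a b w" if "w \<in> quadrant" for w
      using that V1_eq_nonneg by (auto simp: quadrant_def)
    assume "(x, t, p) \<in> quadrant"
    thus "(vN a b has_derivative ?D) (at (x, t, p) within quadrant)"
      using vN_deriv[OF a b t] by (auto simp: quadrant_def vx_def vp_def)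
  qed
  have 2: "(?V has_derivative ?D) (at (x, t, p) within ?N)"
  proof (rule has_derivative_within_closed_piece[OF cl(2) _ bounded_linear_dform])
    show "?V w = vN b a (?\<rho> w)" if "w \<in> ?N" for w
      using that V1_eq_nonpos by auto
    assume "(x, t, p) \<in> ?N"
    hence p: "p \<le> 0" by simp
    have "?\<rho> ` ?N \<subseteq> quadrant" by (auto simp: quadrant_def)
    moreover have "(?\<rho> has_derivative ?\<rho>) (at (x, t, p) within ?N)"
      unfolding case_prod_beta by (intro derivative_intros)
    moreover have "(vN b a has_derivative dform (vxN b a (- x, t, - p)) (- (vxN b a (- x, t, - p))\<^sup>2 / 2 - potential1 b a (- x))
       (vpN b a (- x, t, - p))) (at (?\<rho> (x, t, p)) within quadrant)"
      using vN_deriv[OF b a t, of "- p" "- x"] p by simp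
    ultimately have "((\<lambda>w. vN b a (?\<rho> w)) has_derivative (\<lambda>h. dform (vxN b a (- x, t, - p)) (- (vxN b a (- x, t, - p))\<^sup>2 / 2 - potential1 b a (- x))
       (vpN b a (- x, t, - p)) (?\<rho> h))) (at (x, t, p) within ?N)"
      by (intro has_derivative_in_compose[of ?\<rho> ?\<rho> _ ?N "vN b a"]) (auto intro: has_derivative_subset)
    thus "((\<lambda>w. vN b a (?\<rho> w)) has_derivative ?D) (at (x, t, p) within ?N)"
      by (rule has_derivative_eq_rhs)
         (auto simp: fun_eq_iff dform_def vx_eq_nonpos[OF t p] vp_eq_nonpos[OF t p] potential1_mirror)
  qed
  show ?thesis unfolding half_space_split by (rule has_derivative_within_Un[OF 1 2])
qed

lemma continuous_on_vx: "continuous_on {(x, t, p). 0 \<le> t} (\<lambda>(x, t, p). vx x t p a b)"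
proof -
  let ?N = "{(x::real, t::real, p::real). 0 \<le> t \<and> p \<le> 0}"
  let ?\<rho> = "\<lambda>(x::real, t::real, p::real). (- x, t, - p)"
  have cl: "closed quadrant" "closed ?N" unfolding quadrant_def case_prod_beta
    by (intro closed_Collect_conj closed_Collect_le continuous_intros)+
  have 1: "continuous_on quadrant (\<lambda>(x, t, p). vx x t p a b)"
    by (rule continuous_on_eq[OF continuous_vxN[OF a b]]) (auto simp: quadrant_def vx_def)
  have "continuous_on ?N ?\<rho>" unfolding case_prod_beta by (intro continuous_intros)
  moreover have "?\<rho> ` ?N \<subseteq> quadrant" by (auto simp: quadrant_def)
  ultimately have "continuous_on ?N (\<lambda>w. - vxN b a (?\<rho> w))"
    by (intro continuous_on_minus continuous_on_compose2[OF continuous_vxN[OF b a]])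
  hence 2: "continuous_on ?N (\<lambda>(x, t, p). vx x t p a b)"
    by (rule continuous_on_eq) (auto simp: vx_eq_nonpos)
  show ?thesis unfolding half_space_split by (rule continuous_on_closed_Un[OF cl 1 2])
qed

lemma continuous_on_V1: "continuous_on {(x, t, p). 0 \<le> t} (\<lambda>(x, t, p). V1 x t p a b)"
proof (rule has_derivative_continuous_on)
  fix z :: "real \<times> real \<times> real" assume z: "z \<in> {(x, t, p). 0 \<le> t}"
  obtain x t p where e: "z = (x, t, p)" using prod_cases3 by blast
  show "((\<lambda>(x, t, p). V1 x t p a b) has_derivative (\<lambda>(x, t, p). dform (vx x t p a b) (- (vx x t p a b)\<^sup>2 / 2 - potential1 a b x) (vp x t p a b)) z)
     (at z within {(x, t, p). 0 \<le> t})"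
    using V1_deriv[of t x p] z unfolding e by simp
qed

lemma vx_bounds:
  assumes "0 \<le> t"
  shows "p - b * t \<le> vx x t p a b" "vx x t p a b \<le> p + a * t"
  using vxN_bounds[OF a b assms, of p x] vxN_bounds[OF b a assms, of "- p" "- x"]
  by (auto simp: vx_def)

lemma vp_strict_antimono:
  assumes t: "0 < t" and "p < p'"
  shows "vp x t p' a b < vp x t p a b"
proof -
  have pos: "vp x t r' a b < vp x t r a b" if "0 \<le> r" "r < r'" for r r'
    using vpN_strict_antimono[OF a b t that] that by (simp add: vp_def)
  have neg: "vp x t r' a b < vp x t r a b" if "r' \<le> 0" "r < r'" for r r'
    using vpN_strict_antimono[OF b a t, of "- r'" "- r" "- x"] that t by (simp add: vp_eq_nonpos)
  consider "0 \<le> p" | "p' \<le> 0" | "p < 0" "0 < p'" by linarith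
  thus ?thesis
  proof cases
    case 1 thus ?thesis using pos assms(2) by blast
  next
    case 2 thus ?thesis using neg assms(2) by blast
  next
    case 3 thus ?thesis using pos[of 0 p'] neg[of 0 p] by simp
  qed
qed

lemma V1_lower: "\<exists>C. \<forall>x t. 0 \<le> t \<longrightarrow> t \<le> T \<longrightarrow> C \<le> V1 x t p a b - p * x"
proof (cases "0 \<le> p")
  case True
  thus ?thesis using vN_lower[OF a b True, of T] V1_eq_nonneg by simp
next
  case False
  then obtain C where "\<forall>x t. 0 \<le> t \<longrightarrow> t \<le> T \<longrightarrow> C \<le> vN b a (x, t, - p) - (- p) * x"
    using vN_lower[OF b a, of "- p" T] by auto
  hence "\<forall>x t. 0 \<le> t \<longrightarrow> t \<le> T \<longrightarrow> C \<le> V1 x t p a b - p * x"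
    using False V1_eq_nonpos[of _ p]
  proof (intro allI impI)
    fix x t assume t: "0 \<le> t" "t \<le> T"
    assume C: "\<forall>x t. 0 \<le> t \<longrightarrow> t \<le> T \<longrightarrow> C \<le> vN b a (x, t, - p) - (- p) * x"
    have "C \<le> vN b a (- x, t, - p) - (- p) * (- x)" using C t by blast
    thus "C \<le> V1 x t p a b - p * x" using V1_eq_nonpos[OF t(1), of p x] False by simp
  qed
  thus ?thesis by blast
qed

lemma V1_zero: "V1 x 0 p a b = p * x"
proof -
  have N: "vN a b (x, 0, p) = p * x" if "0 \<le> p" "0 < a" "0 < b" for p x a b :: real
  proof (cases "0 \<le> x")
    case True
    hence "(x, 0, p) \<in> cl1 a b" using that by (simp add: cl1_def)
    thus ?thesis using that by (simp add: vN_simps piece1_def)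
  next
    case False
    hence "(x, 0, p) \<in> cl2 a b" using that by (simp add: cl2_def)
    thus ?thesis using that by (simp add: vN_simps piece2_def)
  qed
  show ?thesis using V1_eq_nonneg[of 0 p x] V1_eq_nonpos[of 0 p x] N[of p a b x] N[of "- p" b a "- x"] a b
    by (cases "0 \<le> p") auto
qed

lemma DERIV_V1_x:
  assumes "0 \<le> t"
  shows "((\<lambda>x. V1 x t p a b) has_real_derivative vx x t p a b) (at x)"
proof -
  have "((\<lambda>q. (\<lambda>(x, t, p). V1 x t p a b) (q, t, p)) has_derivative (\<lambda>h. dform (vx x t p a b) (- (vx x t p a b)\<^sup>2 / 2 - potential1 a b x) (vp x t p a b) (h, 0, 0))) (at x)"
  proof (rule has_derivative_in_compose[where f = "\<lambda>q. (q, t, p)" and f' = "\<lambda>h. (h, 0, 0)"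
      and g = "\<lambda>(x, t, p). V1 x t p a b" and g' = "dform (vx x t p a b) (- (vx x t p a b)\<^sup>2 / 2 - potential1 a b x) (vp x t p a b)"])
    show "((\<lambda>q. (q, t, p)) has_derivative (\<lambda>h. (h, 0, 0))) (at x)" by (intro has_derivative_Pair has_derivative_const has_derivative_ident)
    show "((\<lambda>(x, t, p). V1 x t p a b) has_derivative dform (vx x t p a b) (- (vx x t p a b)\<^sup>2 / 2 - potential1 a b x) (vp x t p a b)) (at (x, t, p) within range (\<lambda>q. (q, t, p)))"
      by (rule has_derivative_subset[OF V1_deriv[OF assms]]) (use assms in auto)
  qed
  thus ?thesis by (simp add: has_field_derivative_def dform_def mult_commute_abs)
qed

lemma DERIV_V1_p:
  assumes "0 \<le> t"
  shows "((\<lambda>p. V1 x t p a b) has_real_derivative vp x t p a b) (at p)"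
proof -
  have "((\<lambda>q. (\<lambda>(x, t, p). V1 x t p a b) (x, t, q)) has_derivative (\<lambda>h. dform (vx x t p a b) (- (vx x t p a b)\<^sup>2 / 2 - potential1 a b x) (vp x t p a b) (0, 0, h))) (at p)"
  proof (rule has_derivative_in_compose[where f = "\<lambda>q. (x, t, q)" and f' = "\<lambda>h. (0, 0, h)"
      and g = "\<lambda>(x, t, p). V1 x t p a b" and g' = "dform (vx x t p a b) (- (vx x t p a b)\<^sup>2 / 2 - potential1 a b x) (vp x t p a b)"])
    show "((\<lambda>q. (x, t, q)) has_derivative (\<lambda>h. (0, 0, h))) (at p)" by (intro has_derivative_Pair has_derivative_const has_derivative_ident)
    show "((\<lambda>(x, t, p). V1 x t p a b) has_derivative dform (vx x t p a b) (- (vx x t p a b)\<^sup>2 / 2 - potential1 a b x) (vp x t p a b)) (at (x, t, p) within range (\<lambda>q. (x, t, q)))"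
      by (rule has_derivative_subset[OF V1_deriv[OF assms]]) (use assms in auto)
  qed
  thus ?thesis by (simp add: has_field_derivative_def dform_def mult_commute_abs)
qed

lemma DERIV_V1_t:
  assumes "0 < t"
  shows "((\<lambda>t. V1 x t p a b) has_real_derivative - (vx x t p a b)\<^sup>2 / 2 - potential1 a b x) (at t)"
proof -
  have "((\<lambda>q. (\<lambda>(x, t, p). V1 x t p a b) (x, q, p)) has_derivative (\<lambda>h. dform (vx x t p a b) (- (vx x t p a b)\<^sup>2 / 2 - potential1 a b x) (vp x t p a b) (0, h, 0))) (at t within {0<..})"
  proof (rule has_derivative_in_compose[where f = "\<lambda>q. (x, q, p)" and f' = "\<lambda>h. (0, h, 0)"
      and g = "\<lambda>(x, t, p). V1 x t p a b" and g' = "dform (vx x t p a b) (- (vx x t p a b)\<^sup>2 / 2 - potential1 a b x) (vp x t p a b)"])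
    show "((\<lambda>q. (x, q, p)) has_derivative (\<lambda>h. (0, h, 0))) (at t within {0<..})" by (intro has_derivative_Pair has_derivative_const has_derivative_ident)
    show "((\<lambda>(x, t, p). V1 x t p a b) has_derivative dform (vx x t p a b) (- (vx x t p a b)\<^sup>2 / 2 - potential1 a b x) (vp x t p a b)) (at (x, t, p) within (\<lambda>q. (x, q, p)) ` {0<..})"
      by (rule has_derivative_subset[OF V1_deriv]) (use assms in auto)
  qed
  thus ?thesis using assms by (simp add: has_field_derivative_def dform_def mult_commute_abs at_within_open[of t "{0<..}"])
qed

text \<open>The time derivative is at most \<open>- potential1 a b x\<close>, because the kinetic
  term has a sign. In terms of motions this is the cost of resting at \<open>x\<close>.\<close>

lemma V1_upper:
  assumes "0 \<le> t"
  shows "V1 x t p a b \<le> p * x - t * potential1 a b x"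
proof (cases "t = 0")
  case False
  hence t: "0 < t" using assms by simp
  have "continuous_on {0..t} (\<lambda>s. (\<lambda>(x, t, p). V1 x t p a b) (x, s, p))"
    by (intro continuous_on_compose2[OF continuous_on_V1] continuous_intros) auto
  hence c: "continuous_on {0..t} (\<lambda>s. V1 x s p a b)" by simp
  obtain s where "0 < s" "s < t"
    and s: "V1 x t p a b - V1 x 0 p a b = (- (vx x s p a b)\<^sup>2 / 2 - potential1 a b x) * (t - 0)"
  proof (rule mvt[OF t c])
    show "((\<lambda>s. V1 x s p a b) has_derivative (*) (- (vx x s p a b)\<^sup>2 / 2 - potential1 a b x)) (at s)" if "0 < s" for s
      using DERIV_V1_t[OF that] by (simp only: has_field_derivative_def)
  qed auto
  have "t * (- (vx x s p a b)\<^sup>2 / 2) \<le> 0" using t by (simp add: mult_nonneg_nonpos)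
  thus ?thesis using s by (simp add: V1_zero algebra_simps)
qed (simp add: V1_zero)

end

section \<open>Linear initial data in several dimensions\<close>

definition lin_val :: "real ^ 'n \<Rightarrow> real ^ 'n \<Rightarrow> (real ^ 'n) \<times> real \<Rightarrow> real ^ 'n \<Rightarrow> real" where
  "lin_val a b z p = (\<Sum>i\<in>UNIV. V1 (fst z $ i) (snd z) (p $ i) (a $ i) (b $ i))"

definition lin_vel :: "real ^ 'n \<Rightarrow> real ^ 'n \<Rightarrow> (real ^ 'n) \<times> real \<Rightarrow> real ^ 'n \<Rightarrow> real ^ 'n" where
  "lin_vel a b z p = (\<chi> i. vx (fst z $ i) (snd z) (p $ i) (a $ i) (b $ i))"

definition lin_grad :: "real ^ 'n \<Rightarrow> real ^ 'n \<Rightarrow> (real ^ 'n) \<times> real \<Rightarrow> real ^ 'n \<Rightarrow> (real ^ 'n) \<times> real" where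
  "lin_grad a b z p = (lin_vel a b z p, - (norm (lin_vel a b z p))\<^sup>2 / 2 - potential a b (fst z))"

lemma power2_norm_vec: "(norm (x :: real ^ 'n))\<^sup>2 = (\<Sum>i\<in>UNIV. (x $ i)\<^sup>2)"
  by (simp add: norm_vec_def L2_set_def sum_nonneg)

text \<open>Mean values of the strictly decreasing \<open>vp\<close> on the two halves of the
  interval. The midpoint form is all that uniqueness of maximizers requires.\<close>

lemma V1_midpoint_concave:
  assumes "0 < a" "0 < b" "0 < t" "p < p'"
  shows "(V1 x t p a b + V1 x t p' a b) / 2 < V1 x t ((p + p') / 2) a b"
proof -
  define m where "m = (p + p') / 2"
  have m: "p < m" "m < p'" "p' - m = m - p" using assms by (auto simp: m_def field_simps)
  note D = DERIV_V1_p[OF assms(1,2) less_imp_le[OF assms(3)]]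
  obtain r where r: "p < r" "r < m" "V1 x t m a b - V1 x t p a b = (m - p) * vp x t r a b"
    using MVT2[OF m(1), of "\<lambda>p. V1 x t p a b" "\<lambda>p. vp x t p a b"] D by blast
  obtain s where s: "m < s" "s < p'" "V1 x t p' a b - V1 x t m a b = (p' - m) * vp x t s a b"
    using MVT2[OF m(2), of "\<lambda>p. V1 x t p a b" "\<lambda>p. vp x t p a b"] D by blast
  have "vp x t s a b < vp x t r a b"
    using vp_strict_antimono[OF assms(1-3)] r s by (meson less_trans)
  hence "(m - p) * vp x t s a b < (m - p) * vp x t r a b" using m by simp
  hence "V1 x t p' a b - V1 x t m a b < V1 x t m a b - V1 x t p a b" using r(3) s(3) m(3) by metis
  hence "(V1 x t p a b + V1 x t p' a b) / 2 < V1 x t m a b" by (simp add: field_simps)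
  thus ?thesis unfolding m_def .
qed

text \<open>By \<open>vx_bounds\<close> slopes at equal \<open>p\<close> and \<open>t\<close> differ
  by at most \<open>(a + b) * t\<close>, so the mean slope between 0 and \<open>x\<close> may be
  replaced by the slope at \<open>x\<close>.\<close>

lemma V1_radial:
  assumes "0 < a" "0 < b" "0 \<le> t"
  shows "V1 x t p a b - V1 0 t p a b - (a + b) * t * \<bar>x\<bar> \<le> x * vx x t p a b"
proof -
  note D = DERIV_V1_x[OF assms] and B = vx_bounds[OF assms]
  consider "x = 0" | "0 < x" | "x < 0" by linarith
  thus ?thesis
  proof cases
    case 1 thus ?thesis by simp
  next
    case 2
    obtain r where r: "V1 x t p a b - V1 0 t p a b = (x - 0) * vx r t p a b"
      using MVT2[OF 2, of "\<lambda>x. V1 x t p a b" "\<lambda>x. vx x t p a b"] D by blast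
    have "vx r t p a b - (a + b) * t \<le> vx x t p a b" using B[where p = p and x = r] B[where p = p and x = x] by (simp add: algebra_simps)
    hence "x * (vx r t p a b - (a + b) * t) \<le> x * vx x t p a b" using 2 by simp
    thus ?thesis using r 2 by (simp add: algebra_simps)
  next
    case 3
    obtain r where r: "V1 0 t p a b - V1 x t p a b = (0 - x) * vx r t p a b"
      using MVT2[OF 3, of "\<lambda>x. V1 x t p a b" "\<lambda>x. vx x t p a b"] D by blast
    have "vx x t p a b \<le> vx r t p a b + (a + b) * t" using B[where p = p and x = r] B[where p = p and x = x] by (simp add: algebra_simps)
    hence "x * (vx r t p a b + (a + b) * t) \<le> x * vx x t p a b" using 3 by simp
    thus ?thesis using r 3 by (simp add: algebra_simps)
  qed
qed

section \<open>Summation over the coordinates\<close>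

context
  fixes a b :: "real ^ 'n"
  assumes a: "\<And>i. 0 < a $ i" and b: "\<And>i. 0 < b $ i"
begin

lemma continuous_on_coord:
  assumes "continuous_on {(x, t, p). 0 \<le> t} (\<lambda>(x, t, p). f x t p (a $ i) (b $ i))"
  shows "continuous_on {(z :: (real ^ 'n) \<times> real, p :: real ^ 'n). 0 \<le> snd z} (\<lambda>(z, p). f (fst z $ i) (snd z) (p $ i) (a $ i) (b $ i))"
proof -
  have "continuous_on {(z :: (real ^ 'n) \<times> real, p :: real ^ 'n). 0 \<le> snd z}
    (\<lambda>w. (\<lambda>(x, t, p). f x t p (a $ i) (b $ i)) (fst (fst w) $ i, snd (fst w), snd w $ i))"
    by (rule continuous_on_compose2[OF assms]) (auto intro!: continuous_intros)
  thus ?thesis by (simp add: case_prod_beta)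
qed

lemma continuous_on_lin_val:
  "continuous_on {(z, p). 0 \<le> snd z} (\<lambda>(z, p). lin_val a b z p)"
  unfolding lin_val_def case_prod_beta
  by (intro continuous_on_sum continuous_on_coord[unfolded case_prod_beta] continuous_on_V1[OF a b, unfolded case_prod_beta])

lemma continuous_on_lin_vel:
  "continuous_on {(z, p). 0 \<le> snd z} (\<lambda>(z, p). lin_vel a b z p)"
  unfolding lin_vel_def case_prod_beta
  by (intro continuous_on_vec_lambda continuous_on_coord[unfolded case_prod_beta] continuous_on_vx[OF a b, unfolded case_prod_beta])

text \<open>A form without case distinction, from which continuity is immediate.\<close>

lemma potential1_eq: "0 < c \<Longrightarrow> 0 < d \<Longrightarrow> potential1 c d x = - max (c * x) (- d * x)"
proof (cases "0 \<le> x")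
  case True
  moreover assume "0 < c" "0 < d"
  ultimately have "0 \<le> c * x" "0 \<le> d * x" by auto
  thus ?thesis using True by (simp add: potential1_def max_def)
next
  case False
  moreover assume "0 < c" "0 < d"
  ultimately have "c * x < 0" "d * x < 0" by (auto simp: mult_pos_neg)
  thus ?thesis using False by (simp add: potential1_def max_def)
qed

lemma continuous_on_potential: "continuous_on S (potential a b)"
proof -
  have "potential a b = (\<lambda>x. \<Sum>i\<in>UNIV. - max (a $ i * x $ i) (- b $ i * x $ i))"
    unfolding potential_def using potential1_eq[OF a b] by auto
  thus ?thesis by (simp only:) (intro continuous_intros)
qed

lemma continuous_on_lin_grad:
  "continuous_on {(z, p). 0 \<le> snd z} (\<lambda>(z, p). lin_grad a b z p)"
  unfolding lin_grad_def case_prod_beta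
  by (intro continuous_intros continuous_on_lin_vel[unfolded case_prod_beta]
     continuous_on_compose2[OF continuous_on_potential]) auto

text \<open>Every coordinate satisfies its own one-dimensional equation, and the squared velocities
  add up to the squared norm.\<close>

lemma deriv_lin_val:
  assumes "0 \<le> snd z"
  shows "((\<lambda>z. lin_val a b z p) has_derivative (\<lambda>h. h \<bullet> lin_grad a b z p)) (at z within {z. 0 \<le> snd z})"
proof -
  let ?H = "{z :: (real ^ 'n) \<times> real. 0 \<le> snd z}"
  have 1: "((\<lambda>z. V1 (fst z $ i) (snd z) (p $ i) (a $ i) (b $ i)) has_derivative
      (\<lambda>h. vx (fst z $ i) (snd z) (p $ i) (a $ i) (b $ i) * (fst h $ i) +
         (- (vx (fst z $ i) (snd z) (p $ i) (a $ i) (b $ i))\<^sup>2 / 2 - potential1 (a $ i) (b $ i) (fst z $ i)) * snd h))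
      (at z within ?H)" for i
  proof -
    let ?D = "dform (vx (fst z $ i) (snd z) (p $ i) (a $ i) (b $ i)) (- (vx (fst z $ i) (snd z) (p $ i) (a $ i) (b $ i))\<^sup>2 / 2 - potential1 (a $ i) (b $ i) (fst z $ i))
        (vp (fst z $ i) (snd z) (p $ i) (a $ i) (b $ i))"
    have "((\<lambda>z. (\<lambda>(x, t, p). V1 x t p (a $ i) (b $ i)) (fst z $ i, snd z, p $ i)) has_derivative
      (\<lambda>h. ?D (fst h $ i, snd h, 0))) (at z within ?H)"
    proof (rule has_derivative_in_compose[where f = "\<lambda>z. (fst z $ i, snd z, p $ i)" and f' = "\<lambda>h. (fst h $ i, snd h, 0)"
      and g = "\<lambda>(x, t, p). V1 x t p (a $ i) (b $ i)" and g' = ?D])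
      show "((\<lambda>z. (fst z $ i, snd z, p $ i)) has_derivative (\<lambda>h. (fst h $ i, snd h, 0))) (at z within ?H)"
        by (intro has_derivative_Pair has_derivative_const has_derivative_fst has_derivative_snd has_derivative_ident
            bounded_linear.has_derivative[OF bounded_linear_vec_nth])
      show "((\<lambda>(x, t, p). V1 x t p (a $ i) (b $ i)) has_derivative ?D)
        (at (fst z $ i, snd z, p $ i) within (\<lambda>z. (fst z $ i, snd z, p $ i)) ` ?H)"
        by (rule has_derivative_subset[OF V1_deriv[OF a b assms]]) auto
    qed
    thus ?thesis by (simp add: dform_def)
  qed
  show ?thesis unfolding lin_val_def
  proof (rule has_derivative_eq_rhs, rule has_derivative_sum[OF 1], rule ext)
    fix h :: "(real ^ 'n) \<times> real"
    let ?u = "\<lambda>i. vx (fst z $ i) (snd z) (p $ i) (a $ i) (b $ i)"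
    have e: "(\<Sum>i\<in>UNIV. - (?u i)\<^sup>2 / 2 - potential1 (a $ i) (b $ i) (fst z $ i)) = - (norm (lin_vel a b z p))\<^sup>2 / 2 - potential a b (fst z)"
      by (simp add: power2_norm_vec lin_vel_def potential_def sum_subtractf sum_negf sum_divide_distrib)
    show "(\<Sum>i\<in>UNIV. ?u i * (fst h $ i) + (- (?u i)\<^sup>2 / 2 - potential1 (a $ i) (b $ i) (fst z $ i)) * snd h) = h \<bullet> lin_grad a b z p"
      unfolding sum.distrib sum_distrib_right[symmetric] e
      by (simp add: lin_grad_def inner_prod_def) (simp add: lin_vel_def inner_vec_def mult.commute)
  qed
qed

lemma GDERIV_lin_val:
  assumes "0 < snd z"
  shows "GDERIV (\<lambda>z. lin_val a b z p) z :> lin_grad a b z p"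
proof -
  have "open {z :: (real ^ 'n) \<times> real. 0 < snd z}" by (intro open_Collect_less continuous_intros)
  hence o: "at z within {z. 0 < snd z} = at z" using assms by (intro at_within_open) auto
  have "((\<lambda>z. lin_val a b z p) has_derivative (\<lambda>h. h \<bullet> lin_grad a b z p)) (at z within {z. 0 < snd z})"
    by (rule has_derivative_subset[OF deriv_lin_val]) (use assms in auto)
  thus ?thesis unfolding gderiv_def o .
qed

lemma lin_val_zero: "lin_val a b (x, 0) p = p \<bullet> x"
  by (simp add: lin_val_def V1_zero[OF a b] inner_vec_def)

lemma lin_val_upper: "0 \<le> t \<Longrightarrow> lin_val a b (x, t) p \<le> p \<bullet> x - t * potential a b x"
  unfolding lin_val_def potential_def inner_vec_def sum_distrib_left sum_subtractf[symmetric]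
  by (intro sum_mono) (simp add: V1_upper[OF a b])

lemma lin_val_lower: "\<exists>C. \<forall>x t. 0 \<le> t \<longrightarrow> t \<le> T \<longrightarrow> C \<le> lin_val a b (x, t) p - p \<bullet> x"
proof -
  have "\<forall>i. \<exists>C. \<forall>x t. 0 \<le> t \<longrightarrow> t \<le> T \<longrightarrow> C \<le> V1 x t (p $ i) (a $ i) (b $ i) - p $ i * x"
    using V1_lower[OF a b] by blast
  then obtain C where C: "\<And>i x t. 0 \<le> t \<Longrightarrow> t \<le> T \<Longrightarrow> C i \<le> V1 x t (p $ i) (a $ i) (b $ i) - p $ i * x"
    by metis
  show ?thesis
  proof (intro exI allI impI)
    fix x :: "real ^ 'n" and t assume "0 \<le> t" "t \<le> T"
    thus "(\<Sum>i\<in>UNIV. C i) \<le> lin_val a b (x, t) p - p \<bullet> x"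
      unfolding lin_val_def inner_vec_def sum_subtractf[symmetric] by (intro sum_mono) (simp add: C)
  qed
qed

text \<open>One crude constant for three purposes: the growth of the potential, the distance between
  velocity and \<open>p\<close>, and the error in the radial estimate.\<close>

definition slope_sum :: real where "slope_sum = (\<Sum>i\<in>UNIV. a $ i + b $ i)"

lemma slope_sum_nonneg: "0 \<le> slope_sum"
  unfolding slope_sum_def using a b by (intro sum_nonneg) (simp add: add_nonneg_nonneg less_imp_le)

lemma weighted_norm_le: "(\<Sum>i\<in>UNIV. (a $ i + b $ i) * \<bar>x $ i\<bar>) \<le> slope_sum * norm x"
  unfolding slope_sum_def sum_distrib_right using a b
  by (intro sum_mono mult_left_mono component_le_norm_cart) (simp add: add_nonneg_nonneg less_imp_le)

lemma potential_lower: "- potential a b x \<le> slope_sum * norm x"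
proof -
  have "- potential1 (a $ i) (b $ i) (x $ i) \<le> (a $ i + b $ i) * \<bar>x $ i\<bar>" for i
    using a[of i] b[of i] by (auto simp: potential1_def algebra_simps mult_le_0_iff)
  hence "- potential a b x \<le> (\<Sum>i\<in>UNIV. (a $ i + b $ i) * \<bar>x $ i\<bar>)"
    unfolding potential_def sum_negf[symmetric] by (intro sum_mono)
  thus ?thesis using weighted_norm_le by (rule order.trans)
qed

text \<open>The bound does not involve \<open>x\<close>. This uniformity lets a quadratic barrier
  absorb the transport term in \<open>supersolution_ge_linear_value\<close>.\<close>

lemma norm_lin_vel:
  assumes "0 \<le> t"
  shows "norm (lin_vel a b (x, t) p) \<le> norm p + slope_sum * t"
proof -
  have "norm (lin_vel a b (x, t) p - p) \<le> (\<Sum>i\<in>UNIV. \<bar>(lin_vel a b (x, t) p - p) $ i\<bar>)"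
    by (rule norm_le_l1_cart)
  also have "\<dots> \<le> (\<Sum>i\<in>UNIV. (a $ i + b $ i) * t)"
  proof (rule sum_mono)
    fix i
    have "0 \<le> a $ i * t" "0 \<le> b $ i * t" using a[of i] b[of i] assms by auto
    thus "\<bar>(lin_vel a b (x, t) p - p) $ i\<bar> \<le> (a $ i + b $ i) * t"
      using vx_bounds[OF a[of i] b[of i] assms, where p = "p $ i" and x = "x $ i"] by (simp add: lin_vel_def algebra_simps)
  qed
  finally show ?thesis using norm_triangle_ineq2[of "lin_vel a b (x, t) p" p]
    by (simp add: slope_sum_def sum_distrib_right)
qed

lemma lin_val_radial:
  assumes "0 \<le> t"
  shows "lin_val a b (x, t) p - lin_val a b (0, t) p - slope_sum * t * norm x \<le> x \<bullet> lin_vel a b (x, t) p"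
proof -
  have "lin_val a b (x, t) p - lin_val a b (0, t) p - (\<Sum>i\<in>UNIV. (a $ i + b $ i) * \<bar>x $ i\<bar>) * t
     = (\<Sum>i\<in>UNIV. V1 (x $ i) t (p $ i) (a $ i) (b $ i) - V1 0 t (p $ i) (a $ i) (b $ i) - (a $ i + b $ i) * t * \<bar>x $ i\<bar>)"
    by (simp add: lin_val_def sum_subtractf sum_distrib_left mult_ac)
  also have "\<dots> \<le> x \<bullet> lin_vel a b (x, t) p"
    unfolding inner_vec_def lin_vel_def by (intro sum_mono) (simp add: V1_radial[OF a b assms])
  finally have "lin_val a b (x, t) p - lin_val a b (0, t) p - (\<Sum>i\<in>UNIV. (a $ i + b $ i) * \<bar>x $ i\<bar>) * t \<le> x \<bullet> lin_vel a b (x, t) p" .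
  moreover have "(\<Sum>i\<in>UNIV. (a $ i + b $ i) * \<bar>x $ i\<bar>) * t \<le> slope_sum * norm x * t"
    using weighted_norm_le assms by (rule mult_right_mono)
  ultimately show ?thesis by (simp add: mult_ac)
qed

text \<open>Concavity holds in each coordinate and is strict in any coordinate where
  \<open>p\<close> and \<open>p'\<close> differ.\<close>

lemma lin_val_midpoint:
  assumes "0 < snd z" "p \<noteq> p'"
  shows "(lin_val a b z p + lin_val a b z p') / 2 < lin_val a b z ((1 / 2) *\<^sub>R (p + p'))"
proof -
  let ?v = "\<lambda>i r. V1 (fst z $ i) (snd z) r (a $ i) (b $ i)"
  have lt: "(?v i (p $ i) + ?v i (p' $ i)) / 2 < ?v i ((p $ i + p' $ i) / 2)" if "p $ i \<noteq> p' $ i" for i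
    using V1_midpoint_concave[OF a b assms(1), of "p $ i" "p' $ i"] V1_midpoint_concave[OF a b assms(1), of "p' $ i" "p $ i"] that
    by (cases "p $ i < p' $ i") (auto simp: add.commute)
  hence le: "(?v i (p $ i) + ?v i (p' $ i)) / 2 \<le> ?v i ((p $ i + p' $ i) / 2)" for i
    by (cases "p $ i = p' $ i") (auto intro: less_imp_le)
  obtain i where "p $ i \<noteq> p' $ i" using assms(2) by (auto simp: vec_eq_iff)
  hence "(\<Sum>i\<in>UNIV. (?v i (p $ i) + ?v i (p' $ i)) / 2) < (\<Sum>i\<in>UNIV. ?v i ((p $ i + p' $ i) / 2))"
    using le lt by (intro sum_strict_mono_ex1) auto
  thus ?thesis by (simp add: lin_val_def sum.distrib sum_divide_distrib[symmetric] add_divide_distrib)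
qed

end

section \<open>The value function\<close>

lemma norm_fst_le_norm: "norm (fst w) \<le> norm w"
  by (cases w) (simp add: norm_fst_le)

lemma norm_snd_le_norm: "norm (snd w) \<le> norm w"
  by (cases w) (simp add: norm_snd_le)

text \<open>Separates the point on the graph from the strict epigraph; the hyperplane is not
  vertical because \<Phi> is finite everywhere.\<close>

lemma convex_subgradient:
  fixes \<Phi> :: "'a::euclidean_space \<Rightarrow> real"
  assumes conv: "convex_on UNIV \<Phi>"
  shows "\<exists>p. \<forall>y. p \<bullet> y - \<Phi> y \<le> p \<bullet> x - \<Phi> x"
proof -
  let ?T = "{w :: 'a \<times> real. \<Phi> (fst w) < snd w}"
  have "convex ?T"
  proof (rule convexI)
    fix v w :: "'a \<times> real" and s r :: real
    assume h: "v \<in> ?T" "w \<in> ?T" "0 \<le> s" "0 \<le> r" "s + r = 1"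
    have "\<Phi> (s *\<^sub>R fst v + r *\<^sub>R fst w) \<le> s * \<Phi> (fst v) + r * \<Phi> (fst w)"
      using conv h unfolding convex_on_def by auto
    also have "\<dots> < s * snd v + r * snd w"
    proof (cases "s = 0")
      case True thus ?thesis using h by simp
    next
      case False
      hence "s * \<Phi> (fst v) < s * snd v" using h by simp
      moreover have "r * \<Phi> (fst w) \<le> r * snd w" using h by (intro mult_left_mono) auto
      ultimately show ?thesis by linarith
    qed
    finally show "s *\<^sub>R v + r *\<^sub>R w \<in> ?T" by simp
  qed
  moreover have "(x, \<Phi> x + 1) \<in> ?T" by simp
  hence "?T \<noteq> {}" by blast
  ultimately obtain n \<beta> where n: "n \<noteq> 0" "n \<bullet> (x, \<Phi> x) \<le> \<beta>" "\<And>w. w \<in> ?T \<Longrightarrow> \<beta> \<le> n \<bullet> w"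
    using separating_hyperplane_sets[OF convex_singleton[of "(x, \<Phi> x)"], of ?T] by force
  obtain q s where qs: "n = (q, s)" by (cases n)
  have key: "q \<bullet> x + s * \<Phi> x \<le> q \<bullet> y + s * r" if "\<Phi> y < r" for y r
    using n(2) n(3)[of "(y, r)"] that by (simp add: qs)
  have "0 \<le> s"
    using key[of x "\<Phi> x + 1"] by (simp add: algebra_simps)
  have "s \<noteq> 0"
  proof
    assume "s = 0"
    \<comment> \<open>A vertical hyperplane would bound the linear form \<open>q\<close> below on
      the whole space; the point \<open>x - q\<close> violates this.\<close>
    hence "q \<bullet> x \<le> q \<bullet> (x - q)" using key[of "x - q" "\<Phi> (x - q) + 1"] by simp
    hence "q \<bullet> q \<le> 0" by (simp add: inner_diff_right)
    hence "q = 0" using inner_ge_zero[of q] inner_eq_zero_iff[of q] by linarith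
    thus False using n(1) \<open>s = 0\<close> qs by (simp add: zero_prod_def)
  qed
  hence s: "0 < s" using \<open>0 \<le> s\<close> by simp
  show ?thesis
  proof (intro exI allI)
    fix y
    have "q \<bullet> x + s * \<Phi> x \<le> q \<bullet> y + s * \<Phi> y"
    \<comment> \<open>The strict epigraph omits the graph, which is approached from above.\<close>
    proof (rule field_le_epsilon)
      fix e :: real assume "0 < e"
      hence "\<Phi> y < \<Phi> y + e / s" using s by simp
      from key[OF this] show "q \<bullet> x + s * \<Phi> x \<le> q \<bullet> y + s * \<Phi> y + e" using s by (simp add: algebra_simps)
    qed
    hence "(q \<bullet> x + s * \<Phi> x) / s \<le> (q \<bullet> y + s * \<Phi> y) / s" using s by (intro divide_right_mono) auto
    hence "(q \<bullet> x) / s + \<Phi> x \<le> (q \<bullet> y) / s + \<Phi> y" using s by (simp add: add_divide_distrib)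
    thus "(- (q /\<^sub>R s)) \<bullet> y - \<Phi> y \<le> (- (q /\<^sub>R s)) \<bullet> x - \<Phi> x" by (simp add: divide_inverse mult.commute)
  qed
qed

lemma convex_continuous_UNIV:
  fixes \<Phi> :: "'a::euclidean_space \<Rightarrow> real"
  shows "convex_on UNIV \<Phi> \<Longrightarrow> continuous_on S \<Phi>"
  using convex_on_continuous[OF open_UNIV] continuous_on_subset by blast

text \<open>The hypograph of the objective: \<open>c\<close> is at most
  \<open>lin_val a b z p\<close> minus the conjugate of \<Phi> at \<open>p\<close>. Quantifying over
  \<open>y\<close> avoids extended reals where the conjugate is infinite and yields a closed
  condition on the pair of \<open>p\<close> and \<open>c\<close>.\<close>

definition admissible :: "(real ^ 'n \<Rightarrow> real) \<Rightarrow> real ^ 'n \<Rightarrow> real ^ 'n \<Rightarrow> (real ^ 'n) \<times> real \<Rightarrow> real ^ 'n \<Rightarrow> real \<Rightarrow> bool" where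
  "admissible \<Phi> a b z p c \<longleftrightarrow> (\<forall>y. p \<bullet> y - \<Phi> y \<le> lin_val a b z p - c)"

lemma onorm_inner_left_le: "onorm (\<lambda>h. h \<bullet> (v :: 'a::real_inner)) \<le> norm v"
  by (rule onorm_bound) (auto simp: Cauchy_Schwarz_ineq2 mult.commute[of "norm v"])

section \<open>Attainment of the supremum and local regularity of the value\<close>

context
  fixes a b :: "real ^ 'n" and \<Phi> :: "real ^ 'n \<Rightarrow> real"
  assumes a: "\<And>i. 0 < a $ i" and b: "\<And>i. 0 < b $ i" and conv: "convex_on UNIV \<Phi>"
begin

lemma continuous_on_F_compose:
  assumes "continuous_on S f" "continuous_on S g" "\<And>x. x \<in> S \<Longrightarrow> 0 \<le> snd (f x)"
  shows "continuous_on S (\<lambda>x. lin_val a b (f x) (g x))"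
proof -
  have "continuous_on S (\<lambda>x. (\<lambda>(z, p). lin_val a b z p) (f x, g x))"
    by (rule continuous_on_compose2[OF continuous_on_lin_val[OF a b]])
       (use assms in \<open>auto intro!: continuous_intros\<close>)
  thus ?thesis by simp
qed

lemma continuous_on_grad_compose:
  assumes "continuous_on S f" "continuous_on S g" "\<And>x. x \<in> S \<Longrightarrow> 0 \<le> snd (f x)"
  shows "continuous_on S (\<lambda>x. lin_grad a b (f x) (g x))"
proof -
  have "continuous_on S (\<lambda>x. (\<lambda>(z, p). lin_grad a b z p) (f x, g x))"
    by (rule continuous_on_compose2[OF continuous_on_lin_grad[OF a b]])
       (use assms in \<open>auto intro!: continuous_intros\<close>)
  thus ?thesis by simp
qed

text \<open>The point \<open>z\<close> enters only through \<open>lin_val\<close>, so a dual vector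
  used at one point competes at every other. All comparisons of values at two points rest on
  this.\<close>

lemma admissible_shift: "admissible \<Phi> a b z p c \<Longrightarrow> admissible \<Phi> a b z' p (c + lin_val a b z' p - lin_val a b z p)"
  unfolding admissible_def by simp

lemma admissible_upper:
  assumes "admissible \<Phi> a b (x, t) p c" "0 \<le> t" shows "c \<le> \<Phi> x - t * potential a b x"
proof -
  have "p \<bullet> x - \<Phi> x \<le> lin_val a b (x, t) p - c" using assms unfolding admissible_def by blast
  thus ?thesis using lin_val_upper[OF a b assms(2), of x p] by linarith
qed

text \<open>Coercivity in \<open>p\<close>: testing with a \<open>y\<close> of length
  \<open>R + 1\<close> in the direction of \<open>p\<close> gives \<open>(R + 1) * norm p\<close> on
  the left, against at most \<open>R * norm p\<close> on the right, and one \<open>norm p\<close> is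
  left over.\<close>

lemma admissible_bounded:
  assumes "0 \<le> R"
  shows "\<exists>B. \<forall>z p c. norm (fst z) \<le> R \<longrightarrow> 0 \<le> snd z \<longrightarrow> snd z \<le> R \<longrightarrow> admissible \<Phi> a b z p c \<longrightarrow> c\<^sub>0 \<le> c \<longrightarrow> norm p \<le> B"
proof -
  have "compact (\<Phi> ` cball 0 (R + 1))"
    by (intro compact_continuous_image convex_continuous_UNIV conv compact_cball)
  then obtain M where M': "\<forall>v\<in>\<Phi> ` cball 0 (R + 1). norm v \<le> M"
    using compact_imp_bounded bounded_iff by blast
  have M: "\<bar>\<Phi> y\<bar> \<le> M" if "norm y \<le> R + 1" for y using M' that by (auto simp: dist_norm)
  have M0: "0 \<le> M" using M[of 0] assms by simp
  show ?thesis
  proof (intro exI allI impI)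
    fix z :: "(real ^ 'n) \<times> real" and p c
    assume h: "norm (fst z) \<le> R" "0 \<le> snd z" "snd z \<le> R" "admissible \<Phi> a b z p c" "c\<^sub>0 \<le> c"
    obtain x t where z: "z = (x, t)" by (cases z)
    have "(R + 1) * norm p \<le> M + (p \<bullet> x - t * potential a b x - c)"
    proof -
      define y where "y = ((R + 1) / norm p) *\<^sub>R p"
      have y: "p \<bullet> y = (R + 1) * norm p" "norm y \<le> R + 1"
        using assms by (auto simp: y_def dot_square_norm power2_eq_square)
      have "p \<bullet> y - \<Phi> y \<le> lin_val a b z p - c" using h(4) unfolding admissible_def by blast
      moreover have "lin_val a b z p \<le> p \<bullet> x - t * potential a b x" using lin_val_upper[OF a b, of t x p] h z by simp
      moreover have "\<Phi> y \<le> M" using M[OF y(2)] by simp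
      ultimately show ?thesis using y(1) by linarith
    qed
    moreover have "p \<bullet> x \<le> norm p * R"
      using norm_cauchy_schwarz[of p x] h(1) z by (smt (verit) fst_conv mult_left_mono norm_ge_zero)
    moreover have "- (t * potential a b x) \<le> R * (slope_sum a b * R)"
    proof -
      have "t * (- potential a b x) \<le> t * (slope_sum a b * norm x)"
        using potential_lower[OF a b, of x] h z by (intro mult_left_mono) auto
      also have "\<dots> \<le> R * (slope_sum a b * R)" using h z slope_sum_nonneg[OF a b] by (intro mult_mono) auto
      finally show ?thesis by simp
    qed
    ultimately show "norm p \<le> M + R * (slope_sum a b * R) - c\<^sub>0" using h(5) by (simp add: algebra_simps)
  qed
qed

lemma closed_admissible:
  assumes "0 \<le> snd z" shows "closed {(p, c). admissible \<Phi> a b z p c}"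
  unfolding admissible_def case_prod_beta
  by (intro closed_Collect_all closed_Collect_le continuous_intros continuous_on_F_compose) (use assms in auto)

lemma exists_dual_point: "\<exists>p c. \<forall>y. p \<bullet> y - \<Phi> y \<le> c"
  using convex_subgradient[OF conv, of 0] by blast

lemma max_attained:
  assumes z: "0 \<le> snd z"
  shows "\<exists>p c. admissible \<Phi> a b z p c \<and> (\<forall>p' c'. admissible \<Phi> a b z p' c' \<longrightarrow> c' \<le> c)"
proof -
  obtain p0 d where p0: "\<And>y. p0 \<bullet> y - \<Phi> y \<le> d" using exists_dual_point by blast
  define c0 where "c0 = lin_val a b z p0 - d"
  have adm0: "admissible \<Phi> a b z p0 c0" using p0 by (simp add: admissible_def c0_def)
  define S where "S = {(p, c). admissible \<Phi> a b z p c} \<inter> {w. c0 \<le> snd w}"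
  have "closed S" unfolding S_def
    by (intro closed_Int closed_admissible z closed_Collect_le continuous_intros)
  moreover have "bounded S"
  proof -
    define R where "R = max (norm (fst z)) (snd z)"
    have R: "0 \<le> R" "norm (fst z) \<le> R" "snd z \<le> R" by (auto simp: R_def le_max_iff_disj)
    obtain B where B: "\<And>p c. admissible \<Phi> a b z p c \<Longrightarrow> c0 \<le> c \<Longrightarrow> norm p \<le> B"
      using admissible_bounded[OF R(1), of c0] R z by blast
    define u where "u = \<Phi> (fst z) - snd z * potential a b (fst z)"
    have "norm w \<le> B + (\<bar>c0\<bar> + \<bar>u\<bar>)" if "w \<in> S" for w
    proof -
      obtain p c where w: "w = (p, c)" by (cases w)
      have h: "admissible \<Phi> a b z p c" "c0 \<le> c" using that by (auto simp: S_def w)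
      have "c \<le> u" using admissible_upper[of "fst z" "snd z"] h z by (simp add: u_def)
      hence "norm c \<le> \<bar>c0\<bar> + \<bar>u\<bar>" using h by simp
      thus ?thesis unfolding w using B[OF h] norm_Pair_le[of p c] by linarith
    qed
    thus ?thesis unfolding bounded_iff by blast
  qed
  ultimately have "compact S" by (simp add: compact_eq_bounded_closed)
  moreover have "(p0, c0) \<in> S" using adm0 by (simp add: S_def)
  moreover have "continuous_on S snd" by (intro continuous_intros)
  ultimately obtain w where w: "w \<in> S" "\<And>v. v \<in> S \<Longrightarrow> snd v \<le> snd w"
    using continuous_attains_sup[of S snd] by blast
  have "c' \<le> snd w" if "admissible \<Phi> a b z p' c'" for p' c'
    using w(2)[of "(p', c')"] w(2)[of "(p0, c0)"] that adm0 by (cases "c0 \<le> c'") (auto simp: S_def)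
  moreover have "admissible \<Phi> a b z (fst w) (snd w)" using w(1) by (auto simp: S_def)
  ultimately show ?thesis by blast
qed

lemma value_ereal_eq:
  assumes "0 \<le> snd z" "admissible \<Phi> a b z p c" "\<And>p' c'. admissible \<Phi> a b z p' c' \<Longrightarrow> c' \<le> c"
  shows "value_ereal \<Phi> a b z = ereal c"
proof -
  have v: "value_ereal \<Phi> a b z = (SUP p. ereal (lin_val a b z p) - fenchel_conj \<Phi> p)"
    by (simp add: value_ereal_def lin_val_def case_prod_beta)
  have conj: "fenchel_conj \<Phi> p \<le> ereal d \<longleftrightarrow> (\<forall>y. p \<bullet> y - \<Phi> y \<le> d)" for p d
    unfolding fenchel_conj_def by (simp add: SUP_le_iff)
  show ?thesis unfolding v
  proof (rule antisym)
    show "(SUP p. ereal (lin_val a b z p) - fenchel_conj \<Phi> p) \<le> ereal c"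
    proof (rule SUP_least)
      fix q
      show "ereal (lin_val a b z q) - fenchel_conj \<Phi> q \<le> ereal c"
      proof (cases "fenchel_conj \<Phi> q")
        case (real r)
        have "admissible \<Phi> a b z q (lin_val a b z q - r)" using conj[of q r] real by (simp add: admissible_def)
        from assms(3)[OF this] show ?thesis using real by simp
      next
        case MInf
        \<comment> \<open>Excludes this case: the conjugate is bounded below by its value at
          \<open>y = 0\<close>.\<close>
        have "ereal (q \<bullet> 0 - \<Phi> 0) \<le> fenchel_conj \<Phi> q" unfolding fenchel_conj_def by (rule SUP_upper) simp
        thus ?thesis using MInf by simp
      qed simp
    qed
    have "fenchel_conj \<Phi> p \<le> ereal (lin_val a b z p - c)" using assms(2) conj by (simp add: admissible_def)
    hence "ereal (lin_val a b z p) - ereal (lin_val a b z p - c) \<le> ereal (lin_val a b z p) - fenchel_conj \<Phi> p"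
      by (intro ereal_minus_mono) auto
    moreover have "ereal (lin_val a b z p) - fenchel_conj \<Phi> p \<le> (SUP p. ereal (lin_val a b z p) - fenchel_conj \<Phi> p)"
      by (rule SUP_upper) simp
    ultimately show "ereal c \<le> (SUP p. ereal (lin_val a b z p) - fenchel_conj \<Phi> p)" by simp
  qed
qed

lemma value_ereal_real: "0 \<le> snd z \<Longrightarrow> value_ereal \<Phi> a b z = ereal (value_fun \<Phi> a b z)"
  using max_attained[of z] value_ereal_eq[of z] unfolding value_fun_def by (metis real_of_ereal.simps(1))

lemma value_attained: "0 \<le> snd z \<Longrightarrow> \<exists>p. admissible \<Phi> a b z p (value_fun \<Phi> a b z)"
  using max_attained[of z] value_ereal_eq[of z] value_ereal_real[of z] by (metis ereal.inject)

lemma admissible_le_value: "0 \<le> snd z \<Longrightarrow> admissible \<Phi> a b z p c \<Longrightarrow> c \<le> value_fun \<Phi> a b z"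
  using max_attained[of z] value_ereal_eq[of z] value_ereal_real[of z] by (metis ereal.inject)

text \<open>Biconjugation: at the initial time a subgradient at \<open>x\<close> attains the
  supremum.\<close>

lemma value_zero: "value_fun \<Phi> a b (x, 0) = \<Phi> x"
proof -
  obtain p where p: "\<And>y. p \<bullet> y - \<Phi> y \<le> p \<bullet> x - \<Phi> x" using convex_subgradient[OF conv] by blast
  have "admissible \<Phi> a b (x, 0) p (\<Phi> x)" using p by (simp add: admissible_def lin_val_zero[OF a b])
  hence "\<Phi> x \<le> value_fun \<Phi> a b (x, 0)" by (intro admissible_le_value) auto
  moreover obtain q where "admissible \<Phi> a b (x, 0) q (value_fun \<Phi> a b (x, 0))" using value_attained[of "(x, 0)"] by auto
  ultimately show ?thesis using admissible_upper[of x 0 q "value_fun \<Phi> a b (x, 0)"] by simp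
qed

lemma value_upper: "0 \<le> t \<Longrightarrow> value_fun \<Phi> a b (x, t) \<le> \<Phi> x - t * potential a b x"
  using value_attained[of "(x, t)"] admissible_upper by auto

text \<open>A single \<open>p\<close> with finite conjugate serves all \<open>T\<close>, and only
  \<open>C\<close> depends on \<open>T\<close>; \<open>uniqueness_class\<close> asks for the
  quantifiers in this order.\<close>

lemma value_lower: "\<exists>p. \<forall>T. \<exists>C. \<forall>x t. 0 \<le> t \<longrightarrow> t \<le> T \<longrightarrow> C \<le> value_fun \<Phi> a b (x, t) - p \<bullet> x"
proof -
  obtain p d where p: "\<And>y. p \<bullet> y - \<Phi> y \<le> d" using exists_dual_point by blast
  have "\<exists>C. \<forall>x t. 0 \<le> t \<longrightarrow> t \<le> T \<longrightarrow> C \<le> value_fun \<Phi> a b (x, t) - p \<bullet> x" for T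
  proof -
    obtain C where C: "\<And>x t. 0 \<le> t \<Longrightarrow> t \<le> T \<Longrightarrow> C \<le> lin_val a b (x, t) p - p \<bullet> x"
      using lin_val_lower[OF a b, of T p] by blast
    have "C - d \<le> value_fun \<Phi> a b (x, t) - p \<bullet> x" if "0 \<le> t" "t \<le> T" for x t
    proof -
      have "admissible \<Phi> a b (x, t) p (lin_val a b (x, t) p - d)" using p by (simp add: admissible_def)
      hence "lin_val a b (x, t) p - d \<le> value_fun \<Phi> a b (x, t)" using that by (intro admissible_le_value) auto
      thus ?thesis using C[OF that, of x] by linarith
    qed
    thus ?thesis by blast
  qed
  thus ?thesis by blast
qed

lemma value_ge_local: "\<exists>c. \<forall>z. norm (fst z) \<le> R \<longrightarrow> 0 \<le> snd z \<longrightarrow> snd z \<le> R \<longrightarrow> c \<le> value_fun \<Phi> a b z"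
proof -
  obtain p C where C: "\<And>x t. 0 \<le> t \<Longrightarrow> t \<le> R \<Longrightarrow> C \<le> value_fun \<Phi> a b (x, t) - p \<bullet> x"
    using value_lower by meson
  have "C - norm p * R \<le> value_fun \<Phi> a b z" if "norm (fst z) \<le> R" "0 \<le> snd z" "snd z \<le> R" for z
  proof -
    have "\<bar>p \<bullet> fst z\<bar> \<le> norm p * norm (fst z)" by (rule Cauchy_Schwarz_ineq2)
    also have "\<dots> \<le> norm p * R" using that by (intro mult_left_mono) auto
    finally show ?thesis using C[of "snd z" "fst z"] that by simp
  qed
  thus ?thesis by blast
qed

lemma maximizer_bounded:
  "\<exists>B. \<forall>z p. norm (fst z) \<le> R \<longrightarrow> 0 \<le> snd z \<longrightarrow> snd z \<le> R \<longrightarrow> admissible \<Phi> a b z p (value_fun \<Phi> a b z) \<longrightarrow> norm p \<le> B"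
proof (cases "0 \<le> R")
  case True
  obtain c where "\<And>z. norm (fst z) \<le> R \<Longrightarrow> 0 \<le> snd z \<Longrightarrow> snd z \<le> R \<Longrightarrow> c \<le> value_fun \<Phi> a b z" using value_ge_local by blast
  thus ?thesis using admissible_bounded[OF True, of c] by meson
next
  case False
  thus ?thesis by (meson norm_ge_zero order.trans)
qed

text \<open>Maximizers over a bounded region stay in a ball, where \<open>lin_grad\<close> is
  bounded. The maximizer at one point is used at the other. The one-sided derivative makes the
  estimate valid down to time zero.\<close>

lemma value_lipschitz:
  "\<exists>K\<ge>0. \<forall>z z'. norm (fst z) \<le> R \<longrightarrow> 0 \<le> snd z \<longrightarrow> snd z \<le> R \<longrightarrow>
     norm (fst z') \<le> R \<longrightarrow> 0 \<le> snd z' \<longrightarrow> snd z' \<le> R \<longrightarrow> \<bar>value_fun \<Phi> a b z - value_fun \<Phi> a b z'\<bar> \<le> K * norm (z - z')"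
proof -
  obtain B where B: "\<And>z p. norm (fst z) \<le> R \<Longrightarrow> 0 \<le> snd z \<Longrightarrow> snd z \<le> R \<Longrightarrow> admissible \<Phi> a b z p (value_fun \<Phi> a b z) \<Longrightarrow> norm p \<le> B"
    using maximizer_bounded by blast
  define S where "S = cball (0 :: real ^ 'n) R \<times> {0..R}"
  have mem: "z \<in> S \<longleftrightarrow> norm (fst z) \<le> R \<and> 0 \<le> snd z \<and> snd z \<le> R" for z
    by (cases z) (auto simp: S_def)
  have S0: "S \<subseteq> {z. 0 \<le> snd z}" by (auto simp: S_def)
  have "continuous_on (S \<times> cball 0 B) (\<lambda>w. lin_grad a b (fst w) (snd w))"
    using S0 by (intro continuous_on_grad_compose continuous_intros) auto
  hence "compact ((\<lambda>w. lin_grad a b (fst w) (snd w)) ` (S \<times> cball 0 B))"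
    unfolding S_def by (intro compact_continuous_image compact_Times compact_cball compact_Icc)
  then obtain K where K: "\<And>z p. z \<in> S \<Longrightarrow> norm p \<le> B \<Longrightarrow> norm (lin_grad a b z p) \<le> K"
    unfolding compact_eq_bounded_closed bounded_iff by force
  have lip: "\<bar>lin_val a b z p - lin_val a b z' p\<bar> \<le> K * norm (z - z')" if "z \<in> S" "z' \<in> S" "norm p \<le> B" for z z' p
  proof -
    have "norm (lin_val a b z p - lin_val a b z' p) \<le> K * norm (z - z')"
    proof (rule differentiable_bound[of S "\<lambda>z. lin_val a b z p" "\<lambda>z h. h \<bullet> lin_grad a b z p"])
      show "convex S" unfolding S_def by (intro convex_Times convex_cball convex_closed_interval convex_real_interval)
      show "((\<lambda>z. lin_val a b z p) has_derivative (\<lambda>h. h \<bullet> lin_grad a b x p)) (at x within S)" if "x \<in> S" for x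
        by (rule has_derivative_subset[OF deriv_lin_val[OF a b]]) (use that S0 in auto)
      show "onorm (\<lambda>h. h \<bullet> lin_grad a b x p) \<le> K" if "x \<in> S" for x
        using onorm_inner_left_le K[OF that \<open>norm p \<le> B\<close>] by (rule order.trans)
    qed (use that in auto)
    thus ?thesis by simp
  qed
  have one: "value_fun \<Phi> a b z - value_fun \<Phi> a b z' \<le> K * norm (z - z')" if h: "z \<in> S" "z' \<in> S" for z z'
  proof -
    obtain p where p: "admissible \<Phi> a b z p (value_fun \<Phi> a b z)" using value_attained[of z] h mem by blast
    hence "value_fun \<Phi> a b z + lin_val a b z' p - lin_val a b z p \<le> value_fun \<Phi> a b z'" using admissible_shift[OF p, of z'] h mem by (intro admissible_le_value) auto
    moreover have "norm p \<le> B" using B p h mem by blast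
    ultimately show ?thesis using lip[OF h] by (smt (verit))
  qed
  show ?thesis
  proof (intro exI conjI allI impI)
    fix z z' :: "(real ^ 'n) \<times> real"
    assume "norm (fst z) \<le> R" "0 \<le> snd z" "snd z \<le> R" "norm (fst z') \<le> R" "0 \<le> snd z'" "snd z' \<le> R"
    hence "z \<in> S" "z' \<in> S" by (auto simp: mem)
    hence "\<bar>value_fun \<Phi> a b z - value_fun \<Phi> a b z'\<bar> \<le> K * norm (z - z')" using one[of z z'] one[of z' z] by (simp add: norm_minus_commute abs_le_iff)
    also have "\<dots> \<le> max 0 K * norm (z - z')" by (intro mult_right_mono) auto
    finally show "\<bar>value_fun \<Phi> a b z - value_fun \<Phi> a b z'\<bar> \<le> max 0 K * norm (z - z')" .
  qed simp
qed

lemma continuous_on_value: "continuous_on (UNIV \<times> {0..}) (value_fun \<Phi> a b)"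
  unfolding continuous_on_iff
proof (intro ballI allI impI)
  fix z :: "(real ^ 'n) \<times> real" and e :: real assume z: "z \<in> UNIV \<times> {0..}" and e: "0 < e"
  define R where "R = norm z + 1"
  obtain K where K: "0 \<le> K" "\<And>z z'. norm (fst z) \<le> R \<Longrightarrow> 0 \<le> snd z \<Longrightarrow> snd z \<le> R \<Longrightarrow>
     norm (fst z') \<le> R \<Longrightarrow> 0 \<le> snd z' \<Longrightarrow> snd z' \<le> R \<Longrightarrow> \<bar>value_fun \<Phi> a b z - value_fun \<Phi> a b z'\<bar> \<le> K * norm (z - z')"
    using value_lipschitz[of R] by blast
  have small: "norm (fst w) \<le> R" "snd w \<le> R" if "norm w \<le> R" for w :: "(real ^ 'n) \<times> real"
    using that norm_fst_le_norm[of w] norm_snd_le_norm[of w] by auto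
  show "\<exists>d>0. \<forall>w\<in>UNIV \<times> {0..}. dist w z < d \<longrightarrow> dist (value_fun \<Phi> a b w) (value_fun \<Phi> a b z) < e"
  proof (intro exI conjI ballI impI)
    show "0 < min 1 (e / (K + 1))" using e K by simp
    fix w :: "(real ^ 'n) \<times> real" assume w: "w \<in> UNIV \<times> {0..}" "dist w z < min 1 (e / (K + 1))"
    have "norm w \<le> R" using w(2) norm_triangle_sub[of w z] by (simp add: R_def dist_norm)
    hence "\<bar>value_fun \<Phi> a b w - value_fun \<Phi> a b z\<bar> \<le> K * norm (w - z)" using K(2)[of w z] small[of w] small[of z] w z
      by (auto simp: R_def)
    also have "\<dots> \<le> (K + 1) * norm (w - z)" by (simp add: algebra_simps)
    also have "\<dots> < e" using w(2) K by (simp add: dist_norm field_simps)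
    finally show "dist (value_fun \<Phi> a b w) (value_fun \<Phi> a b z) < e" by (simp add: dist_norm)
  qed
qed

text \<open>In the admissibility condition the left-hand side is affine in the dual vector and the
  right-hand side strictly concave, so the midpoint of two maximizers would admit a larger
  value.\<close>

lemma maximizer_unique:
  assumes "0 < snd z" "admissible \<Phi> a b z p (value_fun \<Phi> a b z)" "admissible \<Phi> a b z q (value_fun \<Phi> a b z)"
  shows "p = q"
proof (rule ccontr)
  assume "p \<noteq> q"
  define m where "m = (1 / 2) *\<^sub>R (p + q)"
  define d where "d = lin_val a b z m - (lin_val a b z p + lin_val a b z q) / 2"
  have "0 < d" using lin_val_midpoint[OF a b assms(1) \<open>p \<noteq> q\<close>] by (simp add: d_def m_def)
  have "admissible \<Phi> a b z m (value_fun \<Phi> a b z + d)"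
    unfolding admissible_def
  proof
    fix y
    have "p \<bullet> y - \<Phi> y \<le> lin_val a b z p - value_fun \<Phi> a b z" "q \<bullet> y - \<Phi> y \<le> lin_val a b z q - value_fun \<Phi> a b z"
      using assms(2,3) unfolding admissible_def by auto
    moreover have "m \<bullet> y = (p \<bullet> y + q \<bullet> y) / 2" by (simp add: m_def inner_add_left)
    ultimately show "m \<bullet> y - \<Phi> y \<le> lin_val a b z m - (value_fun \<Phi> a b z + d)" by (simp add: d_def field_simps)
  qed
  hence "value_fun \<Phi> a b z + d \<le> value_fun \<Phi> a b z" using assms(1) by (intro admissible_le_value) auto
  thus False using \<open>0 < d\<close> by simp
qed

section \<open>Continuity of the maximizer and differentiability of the value\<close>

definition maximizer :: "(real ^ 'n) \<times> real \<Rightarrow> real ^ 'n" where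
  "maximizer z = (SOME p. admissible \<Phi> a b z p (value_fun \<Phi> a b z))"

lemma adm_maximizer: "0 \<le> snd z \<Longrightarrow> admissible \<Phi> a b z (maximizer z) (value_fun \<Phi> a b z)"
  unfolding maximizer_def using value_attained by (rule someI_ex)

text \<open>Closed graph with bounded range: uniqueness identifies the graph with the closed set of
  all admissible pairs. The boxes stay away from time zero, where concavity in \<open>p\<close> is
  not strict.\<close>

lemma continuous_on_maximizer: "continuous_on (UNIV \<times> {0<..}) maximizer"
proof -
  have box: "continuous_on (cball 0 R \<times> {r..R}) maximizer" if r: "0 < r" for R r
  proof -
    let ?S = "cball (0 :: real ^ 'n) R \<times> {r..R}"
    obtain B where B: "\<And>z p. norm (fst z) \<le> R \<Longrightarrow> 0 \<le> snd z \<Longrightarrow> snd z \<le> R \<Longrightarrow> admissible \<Phi> a b z p (value_fun \<Phi> a b z) \<Longrightarrow> norm p \<le> B"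
      using maximizer_bounded by blast
    have pos: "0 < snd z" if "z \<in> ?S" for z using that r by (simp add: mem_Times_iff)
    show ?thesis
    proof (rule continuous_from_closed_graph[of "cball 0 B"])
      show "maximizer \<in> ?S \<rightarrow> cball 0 B"
      proof
        fix z assume z: "z \<in> ?S"
        have z0: "0 \<le> snd z" using pos[OF z] by simp
        have "norm (fst z) \<le> R" "snd z \<le> R" using z by (auto simp: mem_Times_iff)
        from B[OF this(1) z0 this(2) adm_maximizer[OF z0]] show "maximizer z \<in> cball 0 B" by simp
      qed
      have "(\<lambda>z. (z, maximizer z)) ` ?S = {w \<in> ?S \<times> UNIV. \<forall>y. snd w \<bullet> y - \<Phi> y \<le> lin_val a b (fst w) (snd w) - value_fun \<Phi> a b (fst w)}"
      proof (intro equalityI subsetI)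
        fix w assume "w \<in> (\<lambda>z. (z, maximizer z)) ` ?S"
        then obtain z where z: "z \<in> ?S" "w = (z, maximizer z)" by blast
        have "admissible \<Phi> a b z (maximizer z) (value_fun \<Phi> a b z)" using pos[OF z(1)] by (intro adm_maximizer) simp
        thus "w \<in> {w \<in> ?S \<times> UNIV. \<forall>y. snd w \<bullet> y - \<Phi> y \<le> lin_val a b (fst w) (snd w) - value_fun \<Phi> a b (fst w)}"
          using z by (simp add: admissible_def)
      next
        fix w assume w: "w \<in> {w \<in> ?S \<times> UNIV. \<forall>y. snd w \<bullet> y - \<Phi> y \<le> lin_val a b (fst w) (snd w) - value_fun \<Phi> a b (fst w)}"
        obtain z p where zp: "w = (z, p)" by (cases w)
        have "z \<in> ?S" "admissible \<Phi> a b z p (value_fun \<Phi> a b z)" using w zp by (auto simp: admissible_def)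
        moreover from this have "p = maximizer z"
          using maximizer_unique[OF pos, of z p "maximizer z"] adm_maximizer[of z] pos[of z] by simp
        ultimately show "w \<in> (\<lambda>z. (z, maximizer z)) ` ?S" using zp by blast
      qed
      moreover have "closed {w \<in> ?S \<times> UNIV. \<forall>y. snd w \<bullet> y - \<Phi> y \<le> lin_val a b (fst w) (snd w) - value_fun \<Phi> a b (fst w)}"
      proof -
        have S: "closed (?S \<times> (UNIV :: (real ^ 'n) set))" by (intro closed_Times closed_cball closed_atLeastAtMost closed_UNIV)
        have "closed {w \<in> ?S \<times> UNIV. snd w \<bullet> y - \<Phi> y \<le> lin_val a b (fst w) (snd w) - value_fun \<Phi> a b (fst w)}" for y
          using r
          by (intro continuous_closed_preimage_constant[of "?S \<times> UNIV"] continuous_on_closed_Collect_le S continuous_intros continuous_on_F_compose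
              continuous_on_compose2[OF continuous_on_value]) auto
        hence "closed (\<Inter>y. {w \<in> ?S \<times> UNIV. snd w \<bullet> y - \<Phi> y \<le> lin_val a b (fst w) (snd w) - value_fun \<Phi> a b (fst w)})"
          by (intro closed_INT) auto
        moreover have "(\<Inter>y. {w \<in> ?S \<times> UNIV. snd w \<bullet> y - \<Phi> y \<le> lin_val a b (fst w) (snd w) - value_fun \<Phi> a b (fst w)})
          = {w \<in> ?S \<times> UNIV. \<forall>y. snd w \<bullet> y - \<Phi> y \<le> lin_val a b (fst w) (snd w) - value_fun \<Phi> a b (fst w)}" by auto
        ultimately show ?thesis by simp
      qed
      ultimately show "closed ((\<lambda>z. (z, maximizer z)) ` ?S)" by simp
    qed auto
  qed
  show ?thesis
  proof (rule continuous_at_imp_continuous_on, rule ballI)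
    fix z :: "(real ^ 'n) \<times> real" assume z: "z \<in> UNIV \<times> {0<..}"
    obtain x t where xt: "z = (x, t)" "0 < t" using z by auto
    define R where "R = norm x + t + 1"
    have "z \<in> ball 0 R \<times> {t / 2<..<R}" using xt by (auto simp: R_def add_nonneg_pos)
    moreover have "open (ball (0 :: real ^ 'n) R \<times> {t / 2<..<R})" by (intro open_Times) auto
    moreover have "continuous_on (ball 0 R \<times> {t / 2<..<R}) maximizer"
      by (rule continuous_on_subset[OF box[of "t / 2" R]]) (use xt in auto)
    ultimately show "isCont maximizer z" using continuous_on_eq_continuous_at by blast
  qed
qed

text \<open>The same error bound must hold for all \<open>p\<close> near \<open>p\<^sub>0\<close>,
  because the maximizer moves with \<open>z\<close>. It follows from the mean value inequality and
  the joint continuity of \<open>lin_grad\<close>.\<close>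

lemma lin_val_uniform_derivative:
  assumes z0: "0 < snd z\<^sub>0" and e: "0 < e"
  shows "\<exists>d>0. \<forall>z p. norm (z - z\<^sub>0) < d \<longrightarrow> norm (p - p\<^sub>0) < d \<longrightarrow>
    \<bar>lin_val a b z p - lin_val a b z\<^sub>0 p - (z - z\<^sub>0) \<bullet> lin_grad a b z\<^sub>0 p\<^sub>0\<bar> \<le> e * norm (z - z\<^sub>0)"
proof -
  let ?S = "(UNIV \<times> {0<..}) \<times> UNIV :: (((real ^ 'n) \<times> real) \<times> (real ^ 'n)) set"
  have "continuous_on ?S (\<lambda>w. lin_grad a b (fst w) (snd w))"
    by (intro continuous_on_grad_compose continuous_intros) auto
  moreover have "open ?S" by (intro open_Times) auto
  moreover have "(z\<^sub>0, p\<^sub>0) \<in> ?S" using z0 by (cases z\<^sub>0) auto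
  ultimately have "isCont (\<lambda>w. lin_grad a b (fst w) (snd w)) (z\<^sub>0, p\<^sub>0)"
    using continuous_on_eq_continuous_at by blast
  then obtain r where r: "0 < r" "\<And>w. dist w (z\<^sub>0, p\<^sub>0) < r \<Longrightarrow>
      dist (lin_grad a b (fst w) (snd w)) (lin_grad a b z\<^sub>0 p\<^sub>0) < e"
    using e unfolding continuous_at_eps_delta by (auto simp: dist_commute)
  define d where "d = min (r / 2) (snd z\<^sub>0)"
  have d: "0 < d" using r z0 by (simp add: d_def)
  show ?thesis
  proof (intro exI conjI allI impI)
    show "0 < d" by (rule d)
    fix z p assume zp: "norm (z - z\<^sub>0) < d" "norm (p - p\<^sub>0) < d"
    have pos: "0 < snd x" if "x \<in> ball z\<^sub>0 d" for x
    proof -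
      have "\<bar>snd x - snd z\<^sub>0\<bar> \<le> norm (x - z\<^sub>0)" using norm_snd_le_norm[of "x - z\<^sub>0"] by simp
      moreover have "norm (x - z\<^sub>0) < snd z\<^sub>0" using that by (simp add: d_def dist_norm norm_minus_commute)
      ultimately show ?thesis by linarith
    qed
    let ?g = "\<lambda>x. lin_val a b x p - x \<bullet> lin_grad a b z\<^sub>0 p\<^sub>0"
    have "norm (?g z - ?g z\<^sub>0) \<le> e * norm (z - z\<^sub>0)"
    proof (rule differentiable_bound[of "ball z\<^sub>0 d" ?g "\<lambda>x h. h \<bullet> (lin_grad a b x p - lin_grad a b z\<^sub>0 p\<^sub>0)"])
      fix x assume x: "x \<in> ball z\<^sub>0 d"
      have "((\<lambda>x. lin_val a b x p) has_derivative (\<lambda>h. h \<bullet> lin_grad a b x p)) (at x within ball z\<^sub>0 d)"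
        using GDERIV_lin_val[OF a b pos[OF x], of p] unfolding gderiv_def by (rule has_derivative_at_withinI)
      moreover have "((\<lambda>x. x \<bullet> lin_grad a b z\<^sub>0 p\<^sub>0) has_derivative (\<lambda>h. h \<bullet> lin_grad a b z\<^sub>0 p\<^sub>0)) (at x within ball z\<^sub>0 d)"
        by (intro bounded_linear.has_derivative[OF bounded_linear_inner_left] has_derivative_ident)
      ultimately show "(?g has_derivative (\<lambda>h. h \<bullet> (lin_grad a b x p - lin_grad a b z\<^sub>0 p\<^sub>0))) (at x within ball z\<^sub>0 d)"
        unfolding inner_diff_right by (rule has_derivative_diff)
      have "dist (x, p) (z\<^sub>0, p\<^sub>0) \<le> dist x z\<^sub>0 + dist p p\<^sub>0"
        by (simp add: dist_norm norm_Pair_le)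
      also have "\<dots> < r" using x zp by (auto simp: d_def dist_norm norm_minus_commute)
      finally have "norm (lin_grad a b x p - lin_grad a b z\<^sub>0 p\<^sub>0) < e" using r(2)[of "(x, p)"] by (simp add: dist_norm)
      thus "onorm (\<lambda>h. h \<bullet> (lin_grad a b x p - lin_grad a b z\<^sub>0 p\<^sub>0)) \<le> e"
        using onorm_inner_left_le[of "lin_grad a b x p - lin_grad a b z\<^sub>0 p\<^sub>0"] by linarith
    qed (use zp d in \<open>auto simp: dist_norm norm_minus_commute\<close>)
    thus "\<bar>lin_val a b z p - lin_val a b z\<^sub>0 p - (z - z\<^sub>0) \<bullet> lin_grad a b z\<^sub>0 p\<^sub>0\<bar> \<le> e * norm (z - z\<^sub>0)"
      by (simp add: inner_diff_left algebra_simps)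
  qed
qed

text \<open>Danskin's theorem: comparing with the maximizer at \<open>z\<^sub>0\<close> bounds the increment of the value from
  below, comparing with the one at \<open>z\<close> bounds it from above.\<close>

lemma GDERIV_value:
  assumes z0: "0 < snd z\<^sub>0"
  shows "GDERIV (value_fun \<Phi> a b) z\<^sub>0 :> lin_grad a b z\<^sub>0 (maximizer z\<^sub>0)"
  unfolding gderiv_def has_derivative_at_alt
proof (intro conjI allI impI)
  let ?p = "maximizer z\<^sub>0"
  let ?G = "lin_grad a b z\<^sub>0 ?p"
  show "bounded_linear (\<lambda>h. h \<bullet> ?G)" by (rule bounded_linear_inner_left)
  fix e :: real assume e: "0 < e"
  obtain d where d: "0 < d" "\<And>z p. norm (z - z\<^sub>0) < d \<Longrightarrow> norm (p - ?p) < d \<Longrightarrow>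
    \<bar>lin_val a b z p - lin_val a b z\<^sub>0 p - (z - z\<^sub>0) \<bullet> ?G\<bar> \<le> e * norm (z - z\<^sub>0)"
    using lin_val_uniform_derivative[OF z0 e] by blast
  have "z\<^sub>0 \<in> UNIV \<times> {0<..}" using z0 by (cases z\<^sub>0) auto
  hence "isCont maximizer z\<^sub>0"
    using continuous_on_maximizer continuous_on_eq_continuous_at[of "UNIV \<times> {0<..}" maximizer]
      open_Times[OF open_UNIV open_greaterThan] by blast
  then obtain r where r: "0 < r" "\<And>z. norm (z - z\<^sub>0) < r \<Longrightarrow> norm (maximizer z - ?p) < d"
    using d(1) unfolding continuous_at_eps_delta dist_norm by blast
  show "\<exists>d>0. \<forall>z. norm (z - z\<^sub>0) < d \<longrightarrow> norm (value_fun \<Phi> a b z - value_fun \<Phi> a b z\<^sub>0 - (z - z\<^sub>0) \<bullet> ?G) \<le> e * norm (z - z\<^sub>0)"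
  proof (intro exI conjI allI impI)
    show "0 < min (min d r) (snd z\<^sub>0)" using d r z0 by simp
    fix z assume z: "norm (z - z\<^sub>0) < min (min d r) (snd z\<^sub>0)"
    have "\<bar>snd z - snd z\<^sub>0\<bar> \<le> norm (z - z\<^sub>0)" using norm_snd_le_norm[of "z - z\<^sub>0"] by simp
    hence sz: "0 \<le> snd z" using z by linarith
    have "value_fun \<Phi> a b z\<^sub>0 + lin_val a b z ?p - lin_val a b z\<^sub>0 ?p \<le> value_fun \<Phi> a b z"
      using admissible_le_value[OF sz admissible_shift[OF adm_maximizer[of z\<^sub>0]]] z0 by simp
    moreover have "value_fun \<Phi> a b z + lin_val a b z\<^sub>0 (maximizer z) - lin_val a b z (maximizer z) \<le> value_fun \<Phi> a b z\<^sub>0"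
      using admissible_le_value[OF _ admissible_shift[OF adm_maximizer[OF sz]], of z\<^sub>0] z0 by simp
    moreover have "\<bar>lin_val a b z ?p - lin_val a b z\<^sub>0 ?p - (z - z\<^sub>0) \<bullet> ?G\<bar> \<le> e * norm (z - z\<^sub>0)"
      using d z by simp
    moreover have "\<bar>lin_val a b z (maximizer z) - lin_val a b z\<^sub>0 (maximizer z) - (z - z\<^sub>0) \<bullet> ?G\<bar> \<le> e * norm (z - z\<^sub>0)"
      using d(2)[of z "maximizer z"] r(2)[of z] z by simp
    ultimately show "norm (value_fun \<Phi> a b z - value_fun \<Phi> a b z\<^sub>0 - (z - z\<^sub>0) \<bullet> ?G) \<le> e * norm (z - z\<^sub>0)" by simp
  qed
qed

lemma C1_on_value: "C1_on (UNIV \<times> {0<..}) (value_fun \<Phi> a b) (\<lambda>z. lin_grad a b z (maximizer z))"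
  unfolding C1_on_def
  by (intro conjI ballI GDERIV_value continuous_on_grad_compose continuous_on_maximizer continuous_intros) auto

lemma classical_solution_value: "classical_solution (potential a b) \<Phi> (value_fun \<Phi> a b)"
  unfolding classical_solution_def
  using continuous_on_value C1_on_value value_zero by (auto simp: lin_grad_def)

end

section \<open>Viscosity solutions\<close>

lemma GDERIV_eq_at_local_max:
  fixes f g :: "'a::real_inner \<Rightarrow> real"
  assumes "GDERIV f z :> df" "GDERIV g z :> dg"
    and "\<forall>\<^sub>F w in nhds z. f w - g w \<le> f z - g z"
  shows "df = dg"
proof -
  obtain S where S: "open S" "z \<in> S" "\<And>w. w \<in> S \<Longrightarrow> f w - g w \<le> f z - g z"
    using assms(3) unfolding eventually_nhds by blast
  have "((\<lambda>w. f w - g w) has_derivative (\<lambda>h. h \<bullet> (df - dg))) (at z)"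
    using GDERIV_diff[OF assms(1,2)] unfolding gderiv_def .
  from differential_zero_maxmin[OF S(2,1) this] S(3) have "(\<lambda>h. h \<bullet> (df - dg)) = (\<lambda>h. 0)" by blast
  hence "(df - dg) \<bullet> (df - dg) = 0" by metis
  thus ?thesis by simp
qed

text \<open>Where a test function touches a differentiable function from either side, their
  gradients coincide, and the equation carries over.\<close>

lemma classical_imp_viscosity:
  assumes "classical_solution U \<Phi> W"
  shows "viscosity_solution U \<Phi> W"
proof -
  obtain DW where DW: "C1_on (UNIV \<times> {0<..}) W DW"
    "\<And>x t. 0 < t \<Longrightarrow> snd (DW (x, t)) + 1 / 2 * (norm (fst (DW (x, t))))\<^sup>2 + U x = 0"
    using assms unfolding classical_solution_def by blast
  have eq: "D\<phi> (x, t) = DW (x, t)" if "C1_on (UNIV \<times> {0<..}) \<phi> D\<phi>" "0 < t"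
    "(\<forall>\<^sub>F z in nhds (x, t). W z - \<phi> z \<le> W (x, t) - \<phi> (x, t)) \<or>
     (\<forall>\<^sub>F z in nhds (x, t). W z - \<phi> z \<ge> W (x, t) - \<phi> (x, t))" for \<phi> D\<phi> x t
  proof -
    have g: "GDERIV W (x, t) :> DW (x, t)" "GDERIV \<phi> (x, t) :> D\<phi> (x, t)"
      using DW(1) that(1,2) unfolding C1_on_def by auto
    have "(\<forall>\<^sub>F z in nhds (x, t). \<phi> z - W z \<le> \<phi> (x, t) - W (x, t))"
      if "\<forall>\<^sub>F z in nhds (x, t). W z - \<phi> z \<ge> W (x, t) - \<phi> (x, t)"
      using that by eventually_elim linarith
    thus ?thesis using that(3) GDERIV_eq_at_local_max[OF g] GDERIV_eq_at_local_max[OF g(2,1)] by fastforce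
  qed
  have "viscosity_subsolution U W"
    unfolding viscosity_subsolution_def
  proof (intro allI impI)
    fix \<phi> D\<phi> x and t :: real
    assume "C1_on (UNIV \<times> {0<..}) \<phi> D\<phi>" "0 < t" "\<forall>\<^sub>F z in nhds (x, t). W z - \<phi> z \<le> W (x, t) - \<phi> (x, t)"
    thus "snd (D\<phi> (x, t)) + 1 / 2 * (norm (fst (D\<phi> (x, t))))\<^sup>2 + U x \<le> 0" using eq DW(2)[of t x] by simp
  qed
  moreover have "viscosity_supersolution U W"
    unfolding viscosity_supersolution_def
  proof (intro allI impI)
    fix \<phi> D\<phi> x and t :: real
    assume "C1_on (UNIV \<times> {0<..}) \<phi> D\<phi>" "0 < t" "\<forall>\<^sub>F z in nhds (x, t). W z - \<phi> z \<ge> W (x, t) - \<phi> (x, t)"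
    thus "snd (D\<phi> (x, t)) + 1 / 2 * (norm (fst (D\<phi> (x, t))))\<^sup>2 + U x \<ge> 0" using eq DW(2)[of t x] by simp
  qed
  ultimately show ?thesis using assms unfolding viscosity_solution_def classical_solution_def by blast
qed

text \<open>If the claim failed, the maximum of \<open>W - \<phi>\<close> over \<open>K\<close>
  would be positive. Hence strictness, positive time and distance from the boundary are required
  only where \<open>\<phi> < W\<close>, which lets the barriers rule out boundary points by their
  size.\<close>

lemma subsolution_le_strict_supersolution:
  assumes sub: "viscosity_subsolution U W" and C1: "C1_on (UNIV \<times> {0<..}) \<phi> D\<phi>"
    and K: "compact K" "continuous_on K W" "continuous_on K \<phi>"
    and strict: "\<And>x t. (x, t) \<in> K \<Longrightarrow> \<phi> (x, t) < W (x, t) \<Longrightarrow> 0 < t \<and> (x, t) \<in> interior K \<and>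
      0 < snd (D\<phi> (x, t)) + 1 / 2 * (norm (fst (D\<phi> (x, t))))\<^sup>2 + U x"
    and z: "z \<in> K"
  shows "W z \<le> \<phi> z"
proof (rule ccontr)
  assume "\<not> W z \<le> \<phi> z"
  moreover obtain x t where w: "(x, t) \<in> K" "\<And>v. v \<in> K \<Longrightarrow> W v - \<phi> v \<le> W (x, t) - \<phi> (x, t)"
    using continuous_attains_sup[of K "\<lambda>z. W z - \<phi> z"] z K continuous_on_diff by (metis emptyE surj_pair)
  ultimately have "\<phi> (x, t) < W (x, t)" using w(2)[OF z] by simp
  note s = strict[OF w(1) this]
  hence "\<forall>\<^sub>F v in nhds (x, t). v \<in> interior K" by (intro eventually_nhds_in_open open_interior) auto
  hence "\<forall>\<^sub>F v in nhds (x, t). W v - \<phi> v \<le> W (x, t) - \<phi> (x, t)"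
    by eventually_elim (use w(2) interior_subset in blast)
  from sub[unfolded viscosity_subsolution_def, rule_format, OF C1 _ this] show False using s by simp
qed

lemma strict_subsolution_le_supersolution:
  assumes super: "viscosity_supersolution U W" and C1: "C1_on (UNIV \<times> {0<..}) \<phi> D\<phi>"
    and K: "compact K" "continuous_on K W" "continuous_on K \<phi>"
    and strict: "\<And>x t. (x, t) \<in> K \<Longrightarrow> W (x, t) < \<phi> (x, t) \<Longrightarrow> 0 < t \<and> (x, t) \<in> interior K \<and>
      snd (D\<phi> (x, t)) + 1 / 2 * (norm (fst (D\<phi> (x, t))))\<^sup>2 + U x < 0"
    and z: "z \<in> K"
  shows "\<phi> z \<le> W z"
proof (rule ccontr)
  assume "\<not> \<phi> z \<le> W z"
  moreover obtain x t where w: "(x, t) \<in> K" "\<And>v. v \<in> K \<Longrightarrow> W (x, t) - \<phi> (x, t) \<le> W v - \<phi> v"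
    using continuous_attains_inf[of K "\<lambda>z. W z - \<phi> z"] z K continuous_on_diff by (metis emptyE surj_pair)
  ultimately have "W (x, t) < \<phi> (x, t)" using w(2)[OF z] by simp
  note s = strict[OF w(1) this]
  hence "\<forall>\<^sub>F v in nhds (x, t). v \<in> interior K" by (intro eventually_nhds_in_open open_interior) auto
  hence "\<forall>\<^sub>F v in nhds (x, t). W v - \<phi> v \<ge> W (x, t) - \<phi> (x, t)"
    by eventually_elim (use w(2) interior_subset in blast)
  from super[unfolded viscosity_supersolution_def, rule_format, OF C1 _ this] show False using s by simp
qed

section \<open>Smooth barriers and the size of subgradients\<close>

lemma C1_on_imp_continuous_on: "C1_on S f g \<Longrightarrow> continuous_on S f"
  unfolding C1_on_def gderiv_def
  by (meson continuous_at_imp_continuous_on has_derivative_continuous)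

lemma C1_on_add: "C1_on S f f' \<Longrightarrow> C1_on S g g' \<Longrightarrow> C1_on S (\<lambda>z. f z + g z) (\<lambda>z. f' z + g' z)"
  unfolding C1_on_def by (auto intro: GDERIV_add continuous_intros)

lemma C1_on_diff: "C1_on S f f' \<Longrightarrow> C1_on S g g' \<Longrightarrow> C1_on S (\<lambda>z. f z - g z) (\<lambda>z. f' z - g' z)"
  unfolding C1_on_def by (auto intro: GDERIV_diff continuous_intros)

lemma C1_on_compose:
  assumes "C1_on S f f'" "\<And>r. (h has_real_derivative h' r) (at r)" "continuous_on UNIV h'"
  shows "C1_on S (\<lambda>z. h (f z)) (\<lambda>z. h' (f z) *\<^sub>R f' z)"
  using assms(1) GDERIV_DERIV_compose[OF _ assms(2)] C1_on_imp_continuous_on[OF assms(1)]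
  unfolding C1_on_def by (auto intro!: continuous_intros continuous_on_compose2[OF assms(3)])

definition growth :: "real \<Rightarrow> 'a::real_inner \<times> real \<Rightarrow> real" where
  "growth c z = (1 + fst z \<bullet> fst z) * exp (c * snd z)"

lemma C1_on_growth:
  "C1_on S (growth c) (\<lambda>z. ((2 * exp (c * snd z)) *\<^sub>R fst z, c * growth c z))"
  unfolding C1_on_def growth_def[abs_def]
proof (intro conjI ballI)
  fix z :: "'a \<times> real"
  show "GDERIV (\<lambda>z. (1 + fst z \<bullet> fst z) * exp (c * snd z)) z :>
    ((2 * exp (c * snd z)) *\<^sub>R fst z, c * ((1 + fst z \<bullet> fst z) * exp (c * snd z)))"
    unfolding gderiv_def
    by (rule derivative_eq_intros refl)+
       (auto simp: fun_eq_iff inner_prod_def inner_commute algebra_simps)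
qed (intro continuous_intros)

lemma C1_on_time: "C1_on S (\<lambda>z :: 'a::real_inner \<times> real. snd z) (\<lambda>z. (0, 1))"
  unfolding C1_on_def gderiv_def
  by (auto intro!: derivative_eq_intros simp: inner_prod_def)

lemma growth_ge_1: "0 \<le> c \<Longrightarrow> 0 \<le> snd z \<Longrightarrow> 1 + fst z \<bullet> fst z \<le> growth c z"
  unfolding growth_def using mult_left_mono[of 1 "exp (c * snd z)" "1 + fst z \<bullet> fst z"] by simp

lemma two_norm_le_one_plus_square: "2 * norm (x :: 'a::real_inner) \<le> 1 + x \<bullet> x"
proof -
  have "0 \<le> (norm x - 1)\<^sup>2" by simp
  thus ?thesis by (simp add: power2_diff power2_norm_eq_inner)
qed

lemma norm_le_one_plus_square: "norm (x :: 'a::real_inner) \<le> 1 + x \<bullet> x"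
  using two_norm_le_one_plus_square[of x] norm_ge_zero[of x] by linarith

text \<open>Along the direction of \<open>q\<close> the difference quotient is at most
  \<open>K - norm q\<close>, which must not be negative in the limit.\<close>

lemma norm_frechet_subdifferential_le:
  fixes f :: "'a::real_inner \<Rightarrow> real"
  assumes q: "q \<in> frechet_subdifferential f x" and K: "0 \<le> K"
    and lip: "\<And>y. norm (y - x) < 1 \<Longrightarrow> f y - f x \<le> K * norm (y - x)"
  shows "norm q \<le> K"
proof (rule ccontr)
  assume n: "\<not> norm q \<le> K"
  hence q0: "0 < norm q" using K by linarith
  have "ereal (- (norm q - K)) < 0" using n by simp
  hence "\<forall>\<^sub>F y in at x. ereal (- (norm q - K)) < ereal ((f y - f x - q \<bullet> (y - x)) / norm (y - x))"
    using q unfolding frechet_subdifferential_def by (simp only: mem_Collect_eq le_Liminf_iff)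
  then obtain d where d: "0 < d" "\<And>y. y \<noteq> x \<Longrightarrow> dist y x < d \<Longrightarrow> - (norm q - K) < (f y - f x - q \<bullet> (y - x)) / norm (y - x)"
    unfolding eventually_at by auto
  \<comment> \<open>The bound \<open>1 / 2\<close> keeps the step inside the unit ball, where
    \<open>lip\<close> is available.\<close>
  define s where "s = min (d / 2) (1 / 2)"
  have s: "0 < s" "s < d" "s < 1" using d(1) by (auto simp: s_def)
  define y where "y = x + (s / norm q) *\<^sub>R q"
  have yx: "y - x = (s / norm q) *\<^sub>R q" "norm (y - x) = s" using q0 s by (auto simp: y_def)
  have "q \<bullet> (y - x) = s * norm q" unfolding yx using q0 by (simp add: dot_square_norm power2_eq_square)
  moreover have "f y - f x \<le> K * s" using lip[of y] yx s by simp
  ultimately have "(f y - f x - q \<bullet> (y - x)) / norm (y - x) \<le> (K * s - s * norm q) / s"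
    unfolding yx(2) using s by (intro divide_right_mono) auto
  also have "\<dots> = - (norm q - K)" using s by (simp add: field_simps)
  finally show False using d(2)[of y] yx s q0 by (auto simp: dist_norm y_def)
qed

section \<open>Membership in the uniqueness class and the radial estimate\<close>

context
  fixes a b :: "real ^ 'n" and \<Phi> :: "real ^ 'n \<Rightarrow> real"
  assumes a: "\<And>i. 0 < a $ i" and b: "\<And>i. 0 < b $ i" and conv: "convex_on UNIV \<Phi>"
begin

lemma value_in_uniqueness_class: "value_fun \<Phi> a b \<in> uniqueness_class"
  unfolding uniqueness_class_def mem_Collect_eq
proof (intro conjI allI impI)
  show "continuous_on (UNIV \<times> {0..}) (value_fun \<Phi> a b)" by (rule continuous_on_value[OF a b conv])
  show "\<exists>\<alpha>. \<forall>T>0. \<exists>C. \<forall>x. \<forall>t\<in>{0..T}. C \<le> value_fun \<Phi> a b (x, t) - \<alpha> \<bullet> x"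
    using value_lower[OF a b conv] by (meson atLeastAtMost_iff)
  fix R :: real assume R: "0 < R"
  \<comment> \<open>The radius \<open>R + 1\<close> leaves room for the unit neighbourhoods in which
    subgradients are tested.\<close>
  obtain K where K: "0 \<le> K" "\<And>z z'. norm (fst z) \<le> R + 1 \<Longrightarrow> 0 \<le> snd z \<Longrightarrow> snd z \<le> R + 1 \<Longrightarrow>
     norm (fst z') \<le> R + 1 \<Longrightarrow> 0 \<le> snd z' \<Longrightarrow> snd z' \<le> R + 1 \<Longrightarrow> \<bar>value_fun \<Phi> a b z - value_fun \<Phi> a b z'\<bar> \<le> K * norm (z - z')"
    using value_lipschitz[OF a b conv, of "R + 1"] by blast
  have "compact ((value_fun \<Phi> a b) ` (cball 0 R \<times> {0..R}))"
    by (intro compact_continuous_image continuous_on_subset[OF continuous_on_value[OF a b conv]] compact_Times) auto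
  then obtain M where M: "\<And>z. z \<in> cball 0 R \<times> {0..R} \<Longrightarrow> \<bar>value_fun \<Phi> a b z\<bar> \<le> M"
    unfolding compact_eq_bounded_closed bounded_iff by force
  have "local_norm R (value_fun \<Phi> a b) \<le> ereal (M + K)"
    unfolding local_norm_def
  proof (rule Sup_least)
    fix s assume "s \<in> {ereal (\<bar>value_fun \<Phi> a b (x, t)\<bar> + norm q) |x t q.
          x \<in> cball 0 R \<and> t \<in> {0..R} \<and> q \<in> frechet_subdifferential (\<lambda>y. value_fun \<Phi> a b (y, t)) x}"
    then obtain x t q where s: "s = ereal (\<bar>value_fun \<Phi> a b (x, t)\<bar> + norm q)" and h: "x \<in> cball 0 R" "t \<in> {0..R}"
      "q \<in> frechet_subdifferential (\<lambda>y. value_fun \<Phi> a b (y, t)) x" by blast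
    have "norm q \<le> K"
    proof (rule norm_frechet_subdifferential_le[OF h(3) K(1)])
      fix y assume y: "norm (y - x) < 1"
      have "norm y \<le> R + 1" using norm_triangle_sub[of y x] y h(1) by (simp add: dist_norm)
      hence "\<bar>value_fun \<Phi> a b (y, t) - value_fun \<Phi> a b (x, t)\<bar> \<le> K * norm ((y, t) - (x, t))" using h by (intro K(2)) (auto simp: dist_norm)
      thus "value_fun \<Phi> a b (y, t) - value_fun \<Phi> a b (x, t) \<le> K * norm (y - x)" by simp
    qed
    thus "s \<le> ereal (M + K)" using M[of "(x, t)"] h s by simp
  qed
  thus "local_norm R (value_fun \<Phi> a b) < \<infinity>" by (rule le_less_trans) simp
qed

text \<open>The maximizer at \<open>(x, t)\<close> competes at \<open>(0, t)\<close>, so the linear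
  problem it selects gains at least
  \<open>value_fun \<Phi> a b (x, t) - value_fun \<Phi> a b (0, t)\<close> from 0 to
  \<open>x\<close>; \<open>lin_val_radial\<close> turns this gain into the inner product.\<close>

lemma value_radial:
  assumes "0 < T"
  shows "\<exists>C\<ge>0. \<forall>x t. 0 \<le> t \<longrightarrow> t \<le> T \<longrightarrow>
    - C * (1 + x \<bullet> x) \<le> lin_vel a b (x, t) (maximizer a b \<Phi> (x, t)) \<bullet> x"
proof -
  obtain p C where C: "\<And>x t. 0 \<le> t \<Longrightarrow> t \<le> T \<Longrightarrow> C \<le> value_fun \<Phi> a b (x, t) - p \<bullet> x"
    using value_lower[OF a b conv] by meson
  define B N D where "B = \<bar>C\<bar> + \<bar>\<Phi> 0\<bar>" and "N = norm p + slope_sum a b * T" and "D = B + N"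
  have A: "0 \<le> slope_sum a b * T" using slope_sum_nonneg[OF a b] assms by simp
  have "- D * (1 + x \<bullet> x) \<le> lin_vel a b (x, t) (maximizer a b \<Phi> (x, t)) \<bullet> x" if t: "0 \<le> t" "t \<le> T" for x t
  proof -
    let ?P = "maximizer a b \<Phi> (x, t)"
    have h: "admissible \<Phi> a b (x, t) ?P (value_fun \<Phi> a b (x, t))" using adm_maximizer[OF a b conv, of "(x, t)"] t by simp
    have "value_fun \<Phi> a b (x, t) + lin_val a b (0, t) ?P - lin_val a b (x, t) ?P \<le> value_fun \<Phi> a b (0, t)"
      by (rule admissible_le_value[OF a b conv _ admissible_shift[OF a b conv h]]) (use t in auto)
    moreover have "value_fun \<Phi> a b (0, t) \<le> \<Phi> 0"
      using value_upper[OF a b conv t(1), of 0] by (simp add: potential_def potential1_def)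
    moreover have "slope_sum a b * t * norm x \<le> slope_sum a b * T * norm x"
      using slope_sum_nonneg[OF a b] t by (intro mult_right_mono mult_left_mono) auto
    moreover have "- (norm p * norm x) \<le> p \<bullet> x" using Cauchy_Schwarz_ineq2[of p x] by linarith
    ultimately have 1: "C - \<Phi> 0 - N * norm x \<le> lin_vel a b (x, t) ?P \<bullet> x"
      using lin_val_radial[OF a b t(1), of x ?P] C[OF t, of x] by (simp add: N_def inner_commute algebra_simps)
    have "N * norm x \<le> N * (1 + x \<bullet> x)"
      using A by (intro mult_left_mono norm_le_one_plus_square) (simp add: N_def)
    moreover have "B * 1 \<le> B * (1 + x \<bullet> x)"
      by (intro mult_left_mono) (auto simp: B_def)
    moreover have "- D * (1 + x \<bullet> x) = - (B * (1 + x \<bullet> x)) - N * (1 + x \<bullet> x)"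
      unfolding D_def by (simp add: algebra_simps)
    moreover have "- B \<le> C - \<Phi> 0" unfolding B_def by linarith
    ultimately show ?thesis using 1 by linarith
  qed
  moreover have "0 \<le> D" using A by (simp add: D_def B_def N_def)
  ultimately show ?thesis by blast
qed

end

section \<open>Comparison with the value function\<close>

lemma C1_on_scaled_power:
  assumes "C1_on S f f'" "c \<noteq> 0"
  shows "C1_on S (\<lambda>z. \<eta> * (f z / c) ^ Suc n) (\<lambda>z. (\<eta> * real (Suc n) * (f z / c) ^ n / c) *\<^sub>R f' z)"
  by (rule C1_on_compose[OF assms(1), where h = "\<lambda>r. \<eta> * (r / c) ^ Suc n"])
     (use assms(2) in \<open>auto intro!: derivative_eq_intros continuous_intros simp: mult_ac simp del: power_Suc of_nat_Suc\<close>)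

lemma C1_on_scale: "C1_on S f f' \<Longrightarrow> C1_on S (\<lambda>z. c * f z) (\<lambda>z. c *\<^sub>R f' z)"
  using C1_on_compose[of S f f' "\<lambda>r. c * r" "\<lambda>r. c"] by (auto intro!: derivative_eq_intros continuous_intros)

lemma continuous_on_growth: "continuous_on S (growth c)"
  using C1_on_growth by (rule C1_on_imp_continuous_on)

context
  fixes a b :: "real ^ 'n" and \<Phi> :: "real ^ 'n \<Rightarrow> real"
  assumes a: "\<And>i. 0 < a $ i" and b: "\<And>i. 0 < b $ i" and conv: "convex_on UNIV \<Phi>"
begin

text \<open>The value is raised by \<eta> times a high power of \<open>\<rho> z / R\<close> and
  \<eta> times the same power of \<open>snd z / t\<close>. Both ratios are 1 at
  \<open>(x, t)\<close>, where the cost is \<open>2 * \<eta>\<close> against a gap of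
  \<open>3 * \<eta>\<close>. At the exits of \<open>K\<close> one ratio is at least
  \<open>q > 1\<close>, so a large power exceeds any gap there.\<close>

lemma subsolution_le_value:
  fixes W :: "(real ^ 'n) \<times> real \<Rightarrow> real"
  assumes cont: "continuous_on (UNIV \<times> {0..}) W" and sub: "viscosity_subsolution (potential a b) W"
    and init: "\<And>x. W (x, 0) = \<Phi> x" and t: "0 < t"
  shows "W (x, t) \<le> value_fun \<Phi> a b (x, t)"
proof (rule ccontr)
  let ?V = "value_fun \<Phi> a b" and ?P = "maximizer a b \<Phi>"
  assume "\<not> ?thesis"
  hence gap: "?V (x, t) < W (x, t)" by simp
  define T where "T = t + 1"
  have T: "0 < T" "t < T" using t by (auto simp: T_def)
  obtain C where C: "0 \<le> C" "\<And>y s. 0 \<le> s \<Longrightarrow> s \<le> T \<Longrightarrow> - C * (1 + y \<bullet> y) \<le> lin_vel a b (y, s) (?P (y, s)) \<bullet> y"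
    using value_radial[OF a b conv T(1)] by blast
  \<comment> \<open>The rate \<open>2 * C\<close> compensates the drift: the radial estimate bounds
    the inner product of the velocity with the spatial gradient of \<rho> below by
    \<open>- 2 * C * \<rho>\<close>, so \<rho> does not decrease along the flow of the
    value.\<close>
  define \<rho> :: "(real ^ 'n) \<times> real \<Rightarrow> real" where "\<rho> = growth (2 * C)"
  have \<rho>: "\<rho> z = growth (2 * C) z" for z by (simp add: \<rho>_def)
  have \<rho>_ge: "1 + fst z \<bullet> fst z \<le> \<rho> z" if "0 \<le> snd z" for z
    unfolding \<rho> using C(1) that by (intro growth_ge_1) auto
  define R where "R = \<rho> (x, t)"
  have R: "1 \<le> R"
  proof -
    have "1 + x \<bullet> x \<le> R" using \<rho>_ge[of "(x, t)"] t by (simp add: R_def)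
    thus ?thesis using inner_ge_zero[of x] by linarith
  qed
  define \<eta> where "\<eta> = (W (x, t) - ?V (x, t)) / 3"
  have \<eta>: "0 < \<eta>" using gap by (simp add: \<eta>_def)
  define K where "K = {z. 0 \<le> snd z \<and> snd z \<le> T \<and> \<rho> z \<le> 2 * R}"
  have c\<rho>: "continuous_on S \<rho>" for S unfolding \<rho>_def by (simp add: continuous_on_growth)
  have "closed K" unfolding K_def
    by (intro closed_Collect_conj closed_Collect_le continuous_intros c\<rho>)
  moreover have "K \<subseteq> cball 0 (2 * R) \<times> {0..T}"
  proof
    fix z assume z: "z \<in> K"
    hence "norm (fst z) \<le> 2 * R"
      using \<rho>_ge[of z] norm_le_one_plus_square[of "fst z"] by (auto simp: K_def)
    thus "z \<in> cball 0 (2 * R) \<times> {0..T}" using z by (cases z) (auto simp: K_def)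
  qed
  hence "bounded K" by (rule bounded_subset[rotated]) (intro bounded_Times bounded_cball bounded_closed_interval)
  ultimately have K: "compact K" by (simp add: compact_eq_bounded_closed)
  have Ksub: "K \<subseteq> UNIV \<times> {0..}" by (auto simp: K_def)
  have cV: "continuous_on K ?V" and cW: "continuous_on K W"
    using continuous_on_value[OF a b conv] cont Ksub continuous_on_subset by blast+
  have "compact ((\<lambda>z. W z - ?V z) ` K)"
    by (intro compact_continuous_image continuous_intros cV cW K)
  then obtain M where M: "\<And>z. z \<in> K \<Longrightarrow> W z - ?V z \<le> M"
    unfolding compact_eq_bounded_closed bounded_iff by (metis abs_le_D1 image_eqI real_norm_def)
  \<comment> \<open>The exits are \<open>\<rho> z = 2 * R\<close> and \<open>snd z = T\<close>, with
    ratios 2 and \<open>T / t\<close>. The bound \<open>M\<close> depends on \<open>K\<close> only,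
    so \<open>n\<close> can be chosen after it.\<close>
  define q where "q = min 2 (T / t)"
  have q: "1 < q" using t T by (simp add: q_def)
  obtain n where n: "M / \<eta> < q ^ n" using real_arch_pow[OF q] by blast
  have big: "M < \<eta> * r ^ Suc n" if "q \<le> r" for r
  proof -
    have "q ^ n \<le> q ^ Suc n" using q by (intro power_increasing) auto
    also have "\<dots> \<le> r ^ Suc n" using q that by (intro power_mono) auto
    finally have "M / \<eta> < r ^ Suc n" using n by linarith
    thus ?thesis using \<eta> by (simp add: pos_divide_less_eq mult.commute)
  qed
  define \<psi> where "\<psi> z = \<eta> * (\<rho> z / R) ^ Suc n + \<eta> * (snd z / t) ^ Suc n" for z
  define D where "D z = lin_grad a b z (?P z) +
    ((\<eta> * real (Suc n) * (\<rho> z / R) ^ n / R) *\<^sub>R ((2 * exp (2 * C * snd z)) *\<^sub>R fst z, 2 * C * \<rho> z) +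
     (\<eta> * real (Suc n) * (snd z / t) ^ n / t) *\<^sub>R (0, 1))" for z
  have C1: "C1_on (UNIV \<times> {0<..}) (\<lambda>z. ?V z + \<psi> z) D"
    unfolding \<psi>_def D_def \<rho>
    by (intro C1_on_add C1_on_value[OF a b conv] C1_on_scaled_power C1_on_growth C1_on_time) (use R t in auto)
  have "W (x, t) \<le> ?V (x, t) + \<psi> (x, t)"
  proof (rule subsolution_le_strict_supersolution[OF sub C1 K cW])
    show "continuous_on K (\<lambda>z. ?V z + \<psi> z)" unfolding \<psi>_def
      by (intro continuous_intros cV c\<rho>) (use R t in auto)
    show "(x, t) \<in> K" using R t T by (simp add: K_def R_def)
    fix y s assume z: "(y, s) \<in> K" and less: "?V (y, s) + \<psi> (y, s) < W (y, s)"
    have h: "0 \<le> s" "s \<le> T" "\<rho> (y, s) \<le> 2 * R" using z by (auto simp: K_def)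
    have \<rho>0: "0 < \<rho> (y, s)"
    proof -
      have "1 + y \<bullet> y \<le> \<rho> (y, s)" using \<rho>_ge[of "(y, s)"] h by simp
      thus ?thesis using inner_ge_zero[of y] by linarith
    qed
    have nn: "0 \<le> \<eta> * (\<rho> (y, s) / R) ^ Suc n" "0 \<le> \<eta> * (s / t) ^ Suc n"
      using \<eta> \<rho>0 R h t by auto
    have "s \<noteq> 0"
    proof
      assume "s = 0"
      thus False using less nn init[of y] value_zero[OF a b conv, of y] by (simp add: \<psi>_def)
    qed
    hence s: "0 < s" using h by simp
    have "s \<noteq> T"
    proof
      assume "s = T"
      hence "M < \<eta> * (s / t) ^ Suc n" by (intro big) (simp add: q_def)
      thus False using less nn M[OF z] by (simp add: \<psi>_def)
    qed
    have "\<rho> (y, s) \<noteq> 2 * R"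
    proof
      assume "\<rho> (y, s) = 2 * R"
      hence "M < \<eta> * (\<rho> (y, s) / R) ^ Suc n" using R by (intro big) (simp add: q_def)
      thus False using less nn M[OF z] by (simp add: \<psi>_def)
    qed
    define O' where "O' = {z. 0 < snd z \<and> snd z < T \<and> \<rho> z < 2 * R}"
    have "open O'" unfolding O'_def by (intro open_Collect_conj open_Collect_less continuous_intros c\<rho>)
    moreover have "O' \<subseteq> K" by (auto simp: O'_def K_def)
    moreover have "(y, s) \<in> O'" using s h \<open>s \<noteq> T\<close> \<open>\<rho> (y, s) \<noteq> 2 * R\<close> by (simp add: O'_def)
    ultimately have int: "(y, s) \<in> interior K" using interior_maximal by blast
    define v where "v = lin_vel a b (y, s) (?P (y, s))"
    define k where "k = \<eta> * real (Suc n) * (\<rho> (y, s) / R) ^ n / R"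
    define l where "l = \<eta> * real (Suc n) * (s / t) ^ n / t"
    define e where "e = exp (2 * C * s)"
    have k: "0 \<le> k" using \<eta> \<rho>0 R by (simp add: k_def)
    have l: "0 < l" using \<eta> s t by (simp add: l_def)
    have re: "\<rho> (y, s) = (1 + y \<bullet> y) * e" by (simp add: \<rho> growth_def e_def)
    have D: "D (y, s) = (v + k *\<^sub>R (2 * e) *\<^sub>R y, - (norm v)\<^sup>2 / 2 - potential a b y + k * (2 * C * \<rho> (y, s)) + l)"
      by (simp add: D_def lin_grad_def v_def k_def l_def e_def)
    \<comment> \<open>The squared gradient of the barrier is dropped; however steep the barrier is,
      this term helps.\<close>
    have "(norm v)\<^sup>2 + 2 * (v \<bullet> u) \<le> (norm (v + u))\<^sup>2" for u
      by (simp add: power2_norm_eq_inner inner_add_left inner_add_right inner_commute)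
    note 1 = this[of "k *\<^sub>R (2 * e) *\<^sub>R y"]
    have "(k * (2 * e)) * (- C * (1 + y \<bullet> y)) \<le> (k * (2 * e)) * (v \<bullet> y)"
      using C(2)[OF h(1,2), of y] k unfolding v_def e_def by (intro mult_left_mono) auto
    moreover have "(k * (2 * e)) * (- C * (1 + y \<bullet> y)) = - (k * (2 * C * \<rho> (y, s)))"
      by (simp add: re algebra_simps)
    moreover have "(k * (2 * e)) * (v \<bullet> y) = v \<bullet> (k *\<^sub>R (2 * e) *\<^sub>R y)" by simp
    ultimately have "0 < snd (D (y, s)) + 1 / 2 * (norm (fst (D (y, s))))\<^sup>2 + potential a b y"
      unfolding D fst_conv snd_conv using 1 l by linarith
    thus "0 < s \<and> (y, s) \<in> interior K \<and> 0 < snd (D (y, s)) + 1 / 2 * (norm (fst (D (y, s))))\<^sup>2 + potential a b y"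
      using s int by blast
  qed
  moreover have "\<psi> (x, t) = 2 * \<eta>" using R t by (simp add: \<psi>_def R_def[symmetric])
  moreover have "3 * \<eta> = W (x, t) - ?V (x, t)" by (simp add: \<eta>_def)
  ultimately show False using \<eta> by linarith
qed

text \<open>The linear problem starts below \<Phi> by the choice of \<open>d\<close> and is lowered
  by \<epsilon> times a quadratic barrier plus \<eta> times a power of time. Since \<open>W\<close>
  is bounded below by an affine function, it falls below the linear problem at most linearly in
  space, which the quadratic term outweighs far out.\<close>

lemma supersolution_ge_linear_value:
  fixes W :: "(real ^ 'n) \<times> real \<Rightarrow> real"
  assumes cont: "continuous_on (UNIV \<times> {0..}) W" and super: "viscosity_supersolution (potential a b) W"
    and init: "\<And>x. W (x, 0) = \<Phi> x" and t: "0 < t"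
    and lower: "\<And>T. 0 < T \<Longrightarrow> \<exists>C. \<forall>x. \<forall>t\<in>{0..T}. C \<le> W (x, t) - \<alpha> \<bullet> x"
    and p: "\<And>y. p \<bullet> y - \<Phi> y \<le> d"
  shows "lin_val a b (x, t) p - d \<le> W (x, t)"
proof (rule ccontr)
  define G where "G z = lin_val a b z p - d" for z
  assume "\<not> ?thesis"
  hence gap: "W (x, t) < G (x, t)" by (simp add: G_def)
  define T where "T = t + 1"
  have T: "0 < T" "t < T" using t by (auto simp: T_def)
  let ?A = "slope_sum a b"
  have A: "0 \<le> ?A" by (rule slope_sum_nonneg[OF a b])
  obtain C where C: "\<And>y s. 0 \<le> s \<Longrightarrow> s \<le> T \<Longrightarrow> C \<le> W (y, s) - \<alpha> \<bullet> y"
    using lower[OF T(1)] by (meson atLeastAtMost_iff)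
  define B where "B = norm p + ?A * T"
  have vel: "norm (lin_vel a b (y, s) p) \<le> B" if "0 \<le> s" "s \<le> T" for y s
  proof -
    have "?A * s \<le> ?A * T" using A that by (intro mult_left_mono) auto
    thus ?thesis using norm_lin_vel[OF a b that(1), of y p] by (simp add: B_def)
  qed
  \<comment> \<open>Collects the linear growth of three terms: the affine lower bound of
    \<open>W\<close>, the datum \<open>p \<bullet> y\<close>, and the potential over time
    \<open>T\<close>.\<close>
  define c1 where "c1 = norm \<alpha> + norm p + T * ?A"
  define c2 where "c2 = \<bar>C\<bar> + \<bar>d\<bar>"
  have c12: "0 \<le> c1" "0 \<le> c2" using A T by (auto simp: c1_def c2_def)
  have WG: "- (c1 * norm y + c2) \<le> W (y, s) - G (y, s)" if "0 \<le> s" "s \<le> T" for y s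
  proof -
    have "lin_val a b (y, s) p \<le> p \<bullet> y - s * potential a b y" by (rule lin_val_upper[OF a b that(1)])
    moreover have "s * (- potential a b y) \<le> T * (?A * norm y)"
      using potential_lower[OF a b, of y] that A
      by (meson mult_left_mono mult_right_mono mult_nonneg_nonneg norm_ge_zero order.trans)
    moreover have "p \<bullet> y \<le> norm p * norm y" "- (norm \<alpha> * norm y) \<le> \<alpha> \<bullet> y"
      using Cauchy_Schwarz_ineq2[of p y] Cauchy_Schwarz_ineq2[of \<alpha> y] by linarith+
    ultimately show ?thesis using C[OF that, of y] unfolding G_def c1_def c2_def
      by (simp add: algebra_simps)
  qed
  \<comment> \<open>In the exponential rate, \<open>B\<close> pays for transport at speed at most
    \<open>B\<close>, and 2 pays for the squared gradient of the barrier.\<close>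
  define c where "c = B + 2"
  have B0: "0 \<le> B" using A T by (simp add: B_def)
  define E :: "(real ^ 'n) \<times> real \<Rightarrow> real" where "E = growth c"
  have E: "E z = growth c z" for z by (simp add: E_def)
  have E_ge: "1 + fst z \<bullet> fst z \<le> E z" if "0 \<le> snd z" for z
    unfolding E using B0 that by (intro growth_ge_1) (auto simp: c_def)
  define \<eta> where "\<eta> = (G (x, t) - W (x, t)) / 3"
  have \<eta>: "0 < \<eta>" using gap by (simp add: \<eta>_def)
  have Ext: "0 < E (x, t)"
  proof -
    have "1 + x \<bullet> x \<le> E (x, t)" using E_ge[of "(x, t)"] t by simp
    thus ?thesis using inner_ge_zero[of x] by linarith
  qed
  \<comment> \<open>The first bound gives \<open>\<epsilon> * exp (c * s) \<le> 1\<close> up to time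
    \<open>T\<close>, so that the square of the barrier gradient is controlled by the barrier
    itself; the second limits the cost at \<open>(x, t)\<close> to \<eta>.\<close>
  define \<epsilon> where "\<epsilon> = min (exp (- (c * T))) (\<eta> / E (x, t))"
  have \<epsilon>: "0 < \<epsilon>" "\<epsilon> * E (x, t) \<le> \<eta>" "\<epsilon> \<le> exp (- (c * T))"
    using \<eta> Ext by (auto simp: \<epsilon>_def min_def field_simps)
  \<comment> \<open>On the sphere of radius \<open>r\<close> the barrier is at least
    \<open>\<epsilon> * r\<^sup>2\<close>, hence at least \<open>(c1 + c2) * r\<close>, which covers
    the possible deficit \<open>c1 * r + c2\<close> as \<open>r\<close> is at least 1.\<close>
  define r where "r = (c1 + c2) / \<epsilon> + 1 + norm x"
  have r: "1 \<le> r" "norm x < r" "c1 + c2 \<le> \<epsilon> * r"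
  proof -
    have "0 \<le> (c1 + c2) / \<epsilon>" using c12 \<epsilon> by simp
    thus "1 \<le> r" "norm x < r" using norm_ge_zero[of x] unfolding r_def by linarith+
    have "(c1 + c2) / \<epsilon> \<le> r" unfolding r_def by simp
    thus "c1 + c2 \<le> \<epsilon> * r" using \<epsilon> by (simp add: pos_divide_le_eq mult.commute)
  qed
  define K where "K = cball (0 :: real ^ 'n) r \<times> {0..T}"
  have K: "compact K" unfolding K_def by (intro compact_Times compact_cball compact_Icc)
  define q where "q = T / t"
  have q: "1 < q" using t T by (simp add: q_def)
  obtain n where n: "(c1 * r + c2) / \<eta> < q ^ n" using real_arch_pow[OF q] by blast
  have big: "c1 * r + c2 < \<eta> * q ^ Suc n"
  proof -
    have "q ^ n \<le> q ^ Suc n" using q by (intro power_increasing) auto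
    hence "(c1 * r + c2) / \<eta> < q ^ Suc n" using n by linarith
    thus ?thesis using \<eta> by (simp add: pos_divide_less_eq mult.commute)
  qed
  define \<psi> where "\<psi> z = \<epsilon> * E z + \<eta> * (snd z / t) ^ Suc n" for z
  define D where "D z = lin_grad a b z p - (\<epsilon> *\<^sub>R ((2 * exp (c * snd z)) *\<^sub>R fst z, c * E z) +
     (\<eta> * real (Suc n) * (snd z / t) ^ n / t) *\<^sub>R (0, 1))" for z
  have CG: "C1_on (UNIV \<times> {0<..}) G (\<lambda>z. lin_grad a b z p)"
    unfolding C1_on_def G_def[abs_def]
  proof (intro conjI ballI)
    fix z :: "(real ^ 'n) \<times> real" assume "z \<in> UNIV \<times> {0<..}"
    hence "0 < snd z" by auto
    from GDERIV_diff[OF GDERIV_lin_val[OF a b this, of p] GDERIV_const[of d]]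
    show "GDERIV (\<lambda>z. lin_val a b z p - d) z :> lin_grad a b z p" by simp
  next
    show "continuous_on (UNIV \<times> {0<..}) (\<lambda>z. lin_grad a b z p)"
      by (intro continuous_on_grad_compose[OF a b conv] continuous_intros) auto
  qed
  have C1: "C1_on (UNIV \<times> {0<..}) (\<lambda>z. G z - \<psi> z) D"
    unfolding \<psi>_def D_def E
    by (intro C1_on_diff C1_on_add CG C1_on_scaled_power C1_on_scale C1_on_growth C1_on_time) (use t in auto)
  have "G (x, t) - \<psi> (x, t) \<le> W (x, t)"
  proof (rule strict_subsolution_le_supersolution[OF super C1 K])
    have Ksub: "K \<subseteq> UNIV \<times> {0..}" by (auto simp: K_def)
    show "continuous_on K W" using cont Ksub by (rule continuous_on_subset)
    have "continuous_on K G" unfolding G_def[abs_def]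
      by (intro continuous_intros continuous_on_F_compose[OF a b conv]) (use Ksub in auto)
    thus "continuous_on K (\<lambda>z. G z - \<psi> z)" unfolding \<psi>_def E
      by (intro continuous_intros continuous_on_growth) (use t in auto)
    show "(x, t) \<in> K" using r t T by (simp add: K_def dist_norm)
    fix y s assume z: "(y, s) \<in> K" and less: "W (y, s) < G (y, s) - \<psi> (y, s)"
    have h: "norm y \<le> r" "0 \<le> s" "s \<le> T" using z by (auto simp: K_def dist_norm)
    have yy: "1 + y \<bullet> y \<le> E (y, s)" using E_ge[of "(y, s)"] h by simp
    have E0: "0 < E (y, s)" using yy inner_ge_zero[of y] by linarith
    have nn: "0 \<le> \<epsilon> * E (y, s)" "0 \<le> \<eta> * (s / t) ^ Suc n" using \<epsilon> E0 \<eta> h t by auto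
    have "c1 * norm y \<le> c1 * r" using c12 h by (intro mult_left_mono) auto
    hence WGr: "- (c1 * r + c2) \<le> W (y, s) - G (y, s)" using WG[OF h(2,3), of y] by linarith
    have "s \<noteq> 0"
    proof
      assume s0: "s = 0"
      have "G (y, s) \<le> \<Phi> y" using p[of y] by (simp add: G_def s0 lin_val_zero[OF a b])
      thus False using less nn init[of y] by (simp add: \<psi>_def s0)
    qed
    hence s: "0 < s" using h by simp
    have "s \<noteq> T"
    proof
      assume "s = T"
      hence "c1 * r + c2 < \<eta> * (s / t) ^ Suc n" using big by (simp only: q_def)
      thus False using less nn WGr unfolding \<psi>_def snd_conv by linarith
    qed
    have "norm y \<noteq> r"
    proof
      assume y: "norm y = r"
      have "c1 * r + c2 \<le> (c1 + c2) * r"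
        using mult_left_mono[OF r(1) c12(2)] by (simp add: algebra_simps)
      also have "\<dots> \<le> \<epsilon> * r * r" using r by (intro mult_right_mono) auto
      also have "\<dots> = \<epsilon> * (y \<bullet> y)" using y by (simp add: dot_square_norm power2_eq_square)
      also have "\<dots> \<le> \<epsilon> * E (y, s)" using yy \<epsilon> by (intro mult_left_mono) auto
      finally show False using less nn WGr unfolding \<psi>_def snd_conv by linarith
    qed
    have "ball 0 r \<times> {0<..<T} \<subseteq> interior K" unfolding K_def
      by (intro interior_maximal open_Times) auto
    hence int: "(y, s) \<in> interior K" using s h \<open>s \<noteq> T\<close> \<open>norm y \<noteq> r\<close> by (auto simp: dist_norm)
    define v where "v = lin_vel a b (y, s) p"
    define l where "l = \<eta> * real (Suc n) * (s / t) ^ n / t"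
    define e where "e = exp (c * s)"
    have l: "0 < l" using \<eta> s t by (simp add: l_def)
    have e: "0 < e" by (simp add: e_def)
    have Ee: "E (y, s) = (1 + y \<bullet> y) * e" by (simp add: E growth_def e_def)
    have \<epsilon>e: "\<epsilon> * e \<le> 1"
    proof -
      have "\<epsilon> * e \<le> exp (- (c * T)) * exp (c * T)"
        using \<epsilon> h B0 unfolding e_def by (intro mult_mono) (auto simp: c_def intro!: mult_left_mono)
      thus ?thesis by (simp add: exp_minus)
    qed
    have D: "D (y, s) = (v - \<epsilon> *\<^sub>R (2 * e) *\<^sub>R y, - (norm v)\<^sup>2 / 2 - potential a b y - \<epsilon> * (c * E (y, s)) - l)"
      by (simp add: D_def lin_grad_def v_def l_def e_def)
    define X Y Z where "X = (\<epsilon> * e) * (v \<bullet> y)" and "Y = (\<epsilon> * e) * (\<epsilon> * e) * (y \<bullet> y)" and "Z = \<epsilon> * E (y, s)"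
    have 1: "(norm (v - \<epsilon> *\<^sub>R (2 * e) *\<^sub>R y))\<^sup>2 = (norm v)\<^sup>2 - 4 * X + 4 * Y"
      by (simp add: X_def Y_def power2_norm_eq_inner inner_diff_left inner_diff_right inner_commute algebra_simps)
    have ee: "0 \<le> \<epsilon> * e" using \<epsilon> e by simp
    \<comment> \<open>One factor \<open>\<epsilon> * e\<close> is estimated by 1; without this the
      quadratic term could not be absorbed.\<close>
    have "(\<epsilon> * e) * (\<epsilon> * e) * (y \<bullet> y) \<le> (\<epsilon> * e) * 1 * (1 + y \<bullet> y)"
      using mult_mono[OF mult_left_mono[OF \<epsilon>e ee], of "y \<bullet> y" "1 + y \<bullet> y"] ee by simp
    moreover have "(\<epsilon> * e) * 1 * (1 + y \<bullet> y) = \<epsilon> * E (y, s)" by (simp add: Ee)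
    ultimately have 2: "Y \<le> Z" unfolding Y_def Z_def by linarith
    have "- (v \<bullet> y) \<le> norm v * norm y" using Cauchy_Schwarz_ineq2[of v y] by linarith
    also have "\<dots> \<le> B * norm y" using vel[OF h(2,3), of y] by (intro mult_right_mono) (auto simp: v_def)
    also have "2 * (B * norm y) \<le> B * (1 + y \<bullet> y)"
      using mult_left_mono[OF two_norm_le_one_plus_square[of y] B0] by simp
    finally have "- (2 * (v \<bullet> y)) \<le> B * (1 + y \<bullet> y)" by simp
    from mult_left_mono[OF this ee] have 3: "- (2 * X) \<le> B * Z"
      by (simp add: X_def Z_def Ee mult_ac)
    have 4: "\<epsilon> * (c * E (y, s)) = B * Z + 2 * Z" by (simp add: Z_def c_def algebra_simps)
    have "- m / 2 - u - (w + 2 * Z) - l + 1 / 2 * (m - 4 * X + 4 * Y) + u < 0" if "- (2 * X) \<le> w" for m u w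
      using 2 l that by (simp add: field_simps)
    from this[OF 3] have "snd (D (y, s)) + 1 / 2 * (norm (fst (D (y, s))))\<^sup>2 + potential a b y < 0"
      unfolding D fst_conv snd_conv 1 4 .
    thus "0 < s \<and> (y, s) \<in> interior K \<and> snd (D (y, s)) + 1 / 2 * (norm (fst (D (y, s))))\<^sup>2 + potential a b y < 0"
      using s int by blast
  qed
  moreover have "\<psi> (x, t) \<le> 2 * \<eta>" using \<epsilon> t by (simp add: \<psi>_def)
  moreover have "3 * \<eta> = G (x, t) - W (x, t)" by (simp add: \<eta>_def)
  ultimately show False using \<eta> by linarith
qed

lemma viscosity_solution_unique:
  assumes W: "W \<in> uniqueness_class" and sol: "viscosity_solution (potential a b) \<Phi> W" and t: "0 \<le> t"
  shows "W (x, t) = value_fun \<Phi> a b (x, t)"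
proof (cases "t = 0")
  case True
  thus ?thesis using sol value_zero[OF a b conv, of x] by (simp add: viscosity_solution_def)
next
  case False
  hence t: "0 < t" using t by simp
  have s: "continuous_on (UNIV \<times> {0..}) W" "viscosity_subsolution (potential a b) W" "viscosity_supersolution (potential a b) W"
    "\<And>x. W (x, 0) = \<Phi> x" using sol by (auto simp: viscosity_solution_def)
  obtain \<alpha> where \<alpha>: "\<And>T. 0 < T \<Longrightarrow> \<exists>C. \<forall>x. \<forall>t\<in>{0..T}. C \<le> W (x, t) - \<alpha> \<bullet> x"
    using W unfolding uniqueness_class_def by blast
  obtain p where p: "admissible \<Phi> a b (x, t) p (value_fun \<Phi> a b (x, t))"
    using value_attained[OF a b conv, of "(x, t)"] t by auto
  \<comment> \<open>With the maximizing \<open>p\<close> and the largest \<open>d\<close> that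
    admissibility allows, the linear lower bound at \<open>(x, t)\<close> is exactly the
    value.\<close>
  have "lin_val a b (x, t) p - (lin_val a b (x, t) p - value_fun \<Phi> a b (x, t)) \<le> W (x, t)"
    using p unfolding admissible_def by (intro supersolution_ge_linear_value[OF s(1,3,4) t \<alpha>]) auto
  moreover have "W (x, t) \<le> value_fun \<Phi> a b (x, t)"
    by (rule subsolution_le_value[OF s(1,2,4) t])
  ultimately show ?thesis by simp
qed

end

theorem proposition2p3:
  fixes \<Phi> :: "real ^ 'n \<Rightarrow> real" and a b :: "real ^ 'n"
  assumes "convex_on UNIV \<Phi>"
    and "\<forall>i. a $ i > 0" and "\<forall>i. b $ i > 0"
  shows "(\<forall>x. \<forall>t\<ge>0. \<bar>value_ereal \<Phi> a b (x, t)\<bar> \<noteq> \<infinity>) \<and>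
    classical_solution (potential a b) \<Phi> (value_fun \<Phi> a b) \<and>
    ((\<exists>C\<ge>0. \<exists>\<delta>\<ge>0. growth_condition \<Phi> C \<delta>) \<longrightarrow>
       value_fun \<Phi> a b \<in> uniqueness_class \<and>
       viscosity_solution (potential a b) \<Phi> (value_fun \<Phi> a b) \<and>
       (\<forall>W\<in>uniqueness_class. viscosity_solution (potential a b) \<Phi> W \<longrightarrow>
          (\<forall>x. \<forall>t\<ge>0. W (x, t) = value_fun \<Phi> a b (x, t))))"
proof -
  have ab: "\<And>i. 0 < a $ i" "\<And>i. 0 < b $ i" using assms by auto
  note h = ab assms(1)
  note sol = classical_solution_value[OF h]
  show ?thesis
  proof (intro conjI impI allI ballI)
    \<comment> \<open>Finiteness ensures that \<open>real_of_ereal\<close>, which maps infinities to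
      0, does not hide a divergent supremum in \<open>value_fun\<close>.\<close>
    show "\<bar>value_ereal \<Phi> a b (x, t)\<bar> \<noteq> \<infinity>" if "0 \<le> t" for x t
      using value_ereal_real[OF h, of "(x, t)"] that by simp
    show "classical_solution (potential a b) \<Phi> (value_fun \<Phi> a b)" by (rule sol)
    show "value_fun \<Phi> a b \<in> uniqueness_class" by (rule value_in_uniqueness_class[OF h])
    show "viscosity_solution (potential a b) \<Phi> (value_fun \<Phi> a b)" by (rule classical_imp_viscosity[OF sol])
    show "W (x, t) = value_fun \<Phi> a b (x, t)"
      if "W \<in> uniqueness_class" "viscosity_solution (potential a b) \<Phi> W" "0 \<le> t" for W x t
      by (rule viscosity_solution_unique[OF h that])
  qed
qed

end
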